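(* Let $m,l,\delta\in\mathbb{N}$ and let $T$ be a tree with $T\in\mathcal{T}_{m,l+1}^{\delta}$. If $T$ is embeddable in $\overline{K_l}\vee mS_\delta$, then there exists $N\in\mathbb{N}$ such that for all $n>N$, every $G\in\mathrm{SPEX}(n,T)$ satisfies $G=K_l\vee H_2$, where $H_2$ is a graph on $n-l$ vertices with $\Delta(H_2)\le\delta-1$ and at most $(m-1)((\delta-1)^2+1)$ vertices of degree $\delta-1$. Consequently, \[f(\delta-2,n)\le\mathrm{spex}(n,T)\le f(\delta-2,n)+\frac{2(m-1)((\delta-1)^2+1)}{n}.\]
   Context: Every tree $T$ has a unique bipartition $\{A,B\}$ with $|A|\le|B|$. $\mathcal{T}_{m,l+1}^{\delta}$ denotes the set of trees on $m$ vertices whose smaller partite set $A$ has exactly $l+1$ vertices and such that $\min\{d_T(v):v\in A\}=\delta$. $\overline{K_l}$ is the edgeless graph on $l$ vertices; $S_\delta=K_{1,\delta-1}$ and $mS_\delta$ is the disjoint union of $m$ copies of $S_\delta$. $G_1\vee G_2$ denotes the join (disjoint union plus all edges between the two vertex sets). "Embeddable" means contained as a subgraph. $\lambda(G)$ is the largest adjacency eigenvalue of $G$; $\mathrm{spex}(n,T)$ is the maximum of $\lambda(G)$ over $n$-vertex graphs containing no copy of $T$, and $\mathrm{SPEX}(n,T)$ is the set of such graphs attaining it. $\Delta$ is the maximum degree. For real $x$, \[f(x,n)=\frac{l+x-1+\sqrt{(l+x-1)^2+4(nl+x-lx-l^2)}}{2}.\] *)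

theory Defs
  imports "Graph_Theory.Graph_Theory" "Jordan_Normal_Form.Spectral_Radius"
begin

text \<open>
  Finite simple graphs are the \<^locale>\<open>pair_graph\<close>s of Graph Theory: an undirected edge
  \<open>uv\<close> is the pair of arcs \<open>(u, v)\<close> and \<open>(v, u)\<close>, and the degree of a vertex is its
  \<^const>\<open>out_degree\<close>.
\<close>

text \<open>
  The library's \<open>tree\<close> is meant for digraphs and cannot be used: in a symmetric digraph
  every edge yields a closed walk \<open>u, v, u\<close>, which counts as a \<^const>\<open>pre_digraph.cycle\<close>.
  The cycles of the undirected graph are those with at least three arcs.
\<close>
definition undirected_tree :: "'a pair_pre_digraph \<Rightarrow> bool" where
  "undirected_tree T \<longleftrightarrow> pair_graph T \<and> Digraph_Component.connected (with_proj T) \<and>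
     \<not> (\<exists>p. pre_digraph.cycle (with_proj T) p \<and> length p \<ge> 3)"

definition bipartition :: "'a pair_pre_digraph \<Rightarrow> 'a set \<Rightarrow> 'a set \<Rightarrow> bool" where
  "bipartition G A B \<longleftrightarrow> A \<union> B = pverts G \<and> A \<inter> B = {} \<and> parcs G \<subseteq> A \<times> B \<union> B \<times> A"

text \<open>
  \<open>tree_class m k d\<close> is the class of trees on \<open>m\<close> vertices whose smaller part \<open>A\<close> has \<open>k \<ge> 1\<close>
  vertices and minimum degree (in the tree) \<open>d\<close>.  If both parts have the same size, either one
  may serve as \<open>A\<close>; this is harmless, because then each part contains a leaf
  (the tree has \<open>2 * k - 1\<close> edges), so that \<open>d = 1\<close> for both choices.
\<close>
definition tree_class :: "nat \<Rightarrow> nat \<Rightarrow> nat \<Rightarrow> 'a pair_pre_digraph set" where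
  "tree_class m k d = {T. undirected_tree T \<and> card (pverts T) = m \<and>
     (\<exists>A B. bipartition T A B \<and> card A \<le> card B \<and> card A = k \<and>
            Min (out_degree (with_proj T) ` A) = d)}"

definition edgeless_graph :: "nat \<Rightarrow> nat pair_pre_digraph" where
  "edgeless_graph n = \<lparr> pverts = {0..<n}, parcs = {} \<rparr>"

definition complete_graph :: "nat \<Rightarrow> nat pair_pre_digraph" where
  "complete_graph n = \<lparr> pverts = {0..<n}, parcs = {(u, v). u < n \<and> v < n \<and> u \<noteq> v} \<rparr>"

definition join :: "'a pair_pre_digraph \<Rightarrow> 'b pair_pre_digraph \<Rightarrow> ('a + 'b) pair_pre_digraph" where
  "join G H = \<lparr> pverts = pverts G <+> pverts H,
     parcs = map_prod Inl Inl ` parcs G \<union> map_prod Inr Inr ` parcs H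
       \<union> (Inl ` pverts G) \<times> (Inr ` pverts H) \<union> (Inr ` pverts H) \<times> (Inl ` pverts G) \<rparr>"

definition complete_bipartite_graph :: "nat \<Rightarrow> nat \<Rightarrow> (nat + nat) pair_pre_digraph" where
  "complete_bipartite_graph s t = join (edgeless_graph s) (edgeless_graph t)"

text \<open>\<open>star d\<close> has \<open>d\<close> vertices in total, i.e. \<open>d - 1\<close> leaves; it is used for \<open>d \<ge> 1\<close> only.\<close>
definition star :: "nat \<Rightarrow> (nat + nat) pair_pre_digraph" where
  "star d = complete_bipartite_graph 1 (d - 1)"

definition disjoint_copies :: "nat \<Rightarrow> 'a pair_pre_digraph \<Rightarrow> (nat \<times> 'a) pair_pre_digraph" where
  "disjoint_copies k G = \<lparr> pverts = {0..<k} \<times> pverts G,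
     parcs = {((i, u), (i, v)) | i u v. i < k \<and> (u, v) \<in> parcs G} \<rparr>"

text \<open>Containment as a (not necessarily induced) subgraph, up to isomorphism.\<close>
definition embeddable :: "'a pair_pre_digraph \<Rightarrow> 'b pair_pre_digraph \<Rightarrow> bool" where
  "embeddable T G \<longleftrightarrow>
     (\<exists>S :: 'b pair_pre_digraph. subgraph (with_proj S) (with_proj G) \<and>
        digraph_iso (with_proj T) (with_proj S))"

definition max_degree :: "'a pair_pre_digraph \<Rightarrow> nat" where
  "max_degree G = Max (out_degree (with_proj G) ` pverts G)"

text \<open>For graphs with vertex set \<open>{0..<n}\<close>.\<close>
definition adjacency_matrix :: "nat pair_pre_digraph \<Rightarrow> real mat" where
  "adjacency_matrix G =
     (let n = card (pverts G) in mat n n (\<lambda>(i, j). if (i, j) \<in> parcs G then 1 else 0))"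

definition largest_eigenvalue :: "nat pair_pre_digraph \<Rightarrow> real" where
  "largest_eigenvalue G = Max (spectrum (adjacency_matrix G))"

text \<open>
  Every graph on \<open>n\<close> vertices is isomorphic to one with vertex set \<open>{0..<n}\<close>, so the extremal
  problem is posed for this finite set of labelled graphs.
\<close>
definition free_graphs :: "nat \<Rightarrow> 'a pair_pre_digraph \<Rightarrow> nat pair_pre_digraph set" where
  "free_graphs n T = {G. pair_graph G \<and> pverts G = {0..<n} \<and> \<not> embeddable T G}"

definition spex :: "nat \<Rightarrow> 'a pair_pre_digraph \<Rightarrow> real" where
  "spex n T = Max (largest_eigenvalue ` free_graphs n T)"

definition SPEX :: "nat \<Rightarrow> 'a pair_pre_digraph \<Rightarrow> nat pair_pre_digraph set" where
  "SPEX n T = {G \<in> free_graphs n T. largest_eigenvalue G = spex n T}"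

text \<open>
  For an \<open>x\<close>-regular graph \<open>H\<close> on \<open>n - l\<close> vertices, this is the largest eigenvalue of the join
  of the complete graph on \<open>l\<close> vertices and \<open>H\<close>.
\<close>
definition f_spex :: "nat \<Rightarrow> real \<Rightarrow> nat \<Rightarrow> real" where
  "f_spex l x n = (real l + x - 1 + sqrt ((real l + x - 1)\<^sup>2
     + 4 * (real n * real l + x - real l * x - (real l)\<^sup>2))) / 2"


lemma finite_free_graphs: "finite (free_graphs n T)"
proof -
  have "free_graphs n T \<subseteq> (\<lambda>E. \<lparr> pverts = {0..<n}, parcs = E \<rparr>) ` Pow ({0..<n} \<times> {0..<n})"
  proof
    fix G assume G: "G \<in> free_graphs n T"
    then interpret pair_graph G by (simp add: free_graphs_def)
    have "parcs G \<subseteq> {0..<n} \<times> {0..<n}"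
      using G in_arcsD1 in_arcsD2 unfolding free_graphs_def by fast
    moreover have "G = \<lparr> pverts = {0..<n}, parcs = parcs G \<rparr>"
      using G by (simp add: free_graphs_def)
    ultimately show "G \<in> (\<lambda>E. \<lparr> pverts = {0..<n}, parcs = E \<rparr>) ` Pow ({0..<n} \<times> {0..<n})"
      by blast
  qed
  then show ?thesis by (rule finite_subset) simp
qed

lemma digraph_iso_pair_iff:
  assumes "pair_wf_digraph G"
  shows "digraph_iso (with_proj G) (with_proj H) \<longleftrightarrow>
    (\<exists>h. bij_betw h (pverts G) (pverts H) \<and> parcs H = map_prod h h ` parcs G)"
    (is "?L \<longleftrightarrow> ?R")
proof
  assume ?L
  then obtain k where k: "pre_digraph.digraph_isomorphism (with_proj G) k"
      "with_proj H = app_iso k (with_proj G)"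
    unfolding digraph_iso_def by blast
  define h where "h = iso_verts k"
  have HV: "pverts H = h ` pverts G"
    using arg_cong[OF k(2), of verts] by (simp add: app_iso_def h_def)
  have HA: "parcs H = iso_arcs k ` parcs G"
    using arg_cong[OF k(2), of arcs] by (simp add: app_iso_def)
  have t: "iso_tail k = fst" "iso_head k = snd"
    using arg_cong[OF k(2), of tail] arg_cong[OF k(2), of head] by (simp_all add: app_iso_def)
  have inj: "inj_on h (pverts G)"
    and arcs: "\<And>a. a \<in> parcs G \<Longrightarrow> h (fst a) = fst (iso_arcs k a) \<and> h (snd a) = snd (iso_arcs k a)"
    using k(1) unfolding pre_digraph.digraph_isomorphism_def by (simp_all add: t h_def)
  have "iso_arcs k a = map_prod h h a" if "a \<in> parcs G" for a
    using arcs[OF that] by (simp add: prod_eq_iff)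
  then have "parcs H = map_prod h h ` parcs G"
    unfolding HA by (rule image_cong[OF refl])
  moreover have "bij_betw h (pverts G) (pverts H)"
    using inj HV by (simp add: bij_betw_def)
  ultimately show ?R by blast
next
  assume ?R
  then obtain h where h: "inj_on h (pverts G)" "pverts H = h ` pverts G"
      "parcs H = map_prod h h ` parcs G" unfolding bij_betw_def by blast
  let ?k = "\<lparr> iso_verts = h, iso_arcs = map_prod h h, iso_head = snd, iso_tail = fst \<rparr>"
  interpret pair_wf_digraph G by fact
  have "parcs G \<subseteq> pverts G \<times> pverts G" by (auto dest: in_arcsD1 in_arcsD2)
  then have "inj_on (map_prod h h) (parcs G)"
    by (rule inj_on_subset[OF map_prod_inj_on[OF h(1) h(1)]])
  then have "pre_digraph.digraph_isomorphism (with_proj G) ?k"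
    using h(1) wf_digraph unfolding pre_digraph.digraph_isomorphism_def by simp
  moreover have "with_proj H = app_iso ?k (with_proj G)"
    by (simp add: app_iso_def with_proj_def h(2,3))
  ultimately show ?L unfolding digraph_iso_def by blast
qed

lemma embeddable_iff:
  assumes T: "pair_wf_digraph T" and G: "pair_wf_digraph G"
  shows "embeddable T G \<longleftrightarrow> (\<exists>h. inj_on h (pverts T) \<and> h ` pverts T \<subseteq> pverts G \<and>
    map_prod h h ` parcs T \<subseteq> parcs G)" (is "?L \<longleftrightarrow> ?R")
proof
  assume ?L
  then obtain S :: "'b pair_pre_digraph"
    where S: "subgraph (with_proj S) (with_proj G)" "digraph_iso (with_proj T) (with_proj S)"
    unfolding embeddable_def by blast
  from S(2) obtain h where h: "bij_betw h (pverts T) (pverts S)" "parcs S = map_prod h h ` parcs T"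
    unfolding digraph_iso_pair_iff[OF T] by blast
  from S(1) have "pverts S \<subseteq> pverts G" "parcs S \<subseteq> parcs G"
    by (simp_all add: subgraph_def)
  with h have "inj_on h (pverts T) \<and> h ` pverts T \<subseteq> pverts G \<and> map_prod h h ` parcs T \<subseteq> parcs G"
    by (simp add: bij_betw_def)
  then show ?R by (intro exI[of _ h])
next
  assume ?R
  then obtain h where h: "inj_on h (pverts T)" "h ` pverts T \<subseteq> pverts G"
    "map_prod h h ` parcs T \<subseteq> parcs G" by blast
  let ?S = "\<lparr> pverts = h ` pverts T, parcs = map_prod h h ` parcs T \<rparr>"
  have "pair_wf_digraph ?S"
  proof
    fix e assume "e \<in> parcs ?S"
    then obtain a where a: "a \<in> parcs T" "e = map_prod h h a" by auto
    show "fst e \<in> pverts ?S" "snd e \<in> pverts ?S"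
      using pair_wf_digraph.arc_fst_in_verts[OF T a(1)] pair_wf_digraph.arc_snd_in_verts[OF T a(1)]
      by (simp_all add: a(2))
  qed
  then have "subgraph (with_proj ?S) (with_proj G)"
    using h(2,3) G by (simp add: subgraph_def compatible_def wf_digraph_wp_iff)
  moreover have "digraph_iso (with_proj T) (with_proj ?S)"
    unfolding digraph_iso_pair_iff[OF T]
    using h(1) by (intro exI[of _ h]) (simp add: bij_betw_def)
  ultimately show ?L unfolding embeddable_def by blast
qed

end

theory Submission
  imports Defs "HOL-Analysis.Function_Topology" "HOL-Analysis.Convex"
begin

text \<open>
  Let \<open>A\<close> be the smaller part of \<open>T\<close> and let \<open>G\<close> be extremal with largest eigenvalue \<open>\<mu>\<close> and Perron
  vector \<open>x\<close>, normalised to have maximum \<open>1\<close>.  Comparison with \<open>K\<^sub>l\<close> joined to an almost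
  \<open>(\<delta> - 2)\<close>-regular graph gives the lower bound, in particular \<open>\<mu>\<^sup>2 \<ge> l (n - l)\<close>.

  As \<open>T\<close> is a tree, greedy embedding shows that a \<open>T\<close>-free graph has \<open>O(n)\<close> edges, and at most
  \<open>m |X| + l |Y|\<close> edges between disjoint sets \<open>X\<close> and \<open>Y\<close>.  Counting walks of length two then yields
  \<open>x\<^sub>v \<le> d(v) / n + o(1)\<close>.  Since all but boundedly many vertices have at most \<open>l\<close> neighbours among
  the boundedly many vertices of linear degree, \<open>\<mu>\<^sup>2 \<ge> l (n - l)\<close> forces a set \<open>S\<close> of \<open>l\<close> vertices with
  entries \<open>1 - o(1)\<close> and degrees \<open>(1 - o(1)) n\<close>, while all other entries are \<open>o(1)\<close>.

  A vertex not joined to all of \<open>S\<close> can be chosen so that replacing its edges by edges to \<open>S\<close>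
  increases the Rayleigh quotient; this keeps the graph \<open>T\<close>-free, so \<open>S\<close> is joined to everything
  else.  Then a vertex with \<open>\<delta>\<close> neighbours outside of \<open>S\<close>, or \<open>m\<close> disjoint stars \<open>S\<^sub>\<delta>\<close> there, would
  give a copy of \<open>T\<close>.  The upper bound follows by eliminating the common entry on \<open>S\<close> from the
  eigenvector equations.
\<close>

section \<open>Trees and greedy embeddings\<close>

text \<open>The argument rests on matching leading terms: since \<open>A\<close> has only
  \<open>l + 1\<close> vertices, the walk count bounds \<open>\<mu>\<^sup>2\<close> by about
  \<open>l n\<close>, just as the comparison graph bounds it from below. No regular comparison graph
  need exist, for parity reasons; one outside vertex of degree \<open>\<delta> - 1\<close> repairs
  this and is still tolerated by the forest count that excludes \<open>T\<close>. The constant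
  \<open>(\<delta> - 1)\<^sup>2 + 1\<close> is the size of a ball of radius two at maximum degree
  \<open>\<delta> - 1\<close>: vertices of full degree lie within distance two of a maximal family
  of disjoint stars, which has at most \<open>m - 1\<close> members. That \<open>S\<close> is a
  clique takes an exchange of its own: boundedly many edges between entries \<open>o(1)\<close> are
  traded for one edge between entries near \<open>1\<close>. Extremal graphs are not known to be
  connected in advance, so the Perron vector is only non-negative, and a vanishing entry has to be
  excluded separately in the exchange at a single vertex. The tolerance for \<open>o(1)\<close> is
  fixed from \<open>m\<close>, \<open>l\<close> and \<open>\<delta>\<close> before \<open>n\<close>
  is taken large.\<close>

definition one_degenerate :: "'a set \<Rightarrow> 'a rel \<Rightarrow> bool" where
  "one_degenerate V P \<longleftrightarrow> (\<forall>U\<subseteq>V. U \<noteq> {} \<longrightarrow> (\<exists>v\<in>U. card (P `` {v} \<inter> U) \<le> 1))"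

lemma one_degenerateD:
  "one_degenerate V P \<Longrightarrow> U \<subseteq> V \<Longrightarrow> U \<noteq> {} \<Longrightarrow> \<exists>v\<in>U. card (P `` {v} \<inter> U) \<le> 1"
  by (simp add: one_degenerate_def)

lemma walk_of_vertex_list:
  assumes "pair_wf_digraph T"
  shows "vs \<noteq> [] \<Longrightarrow> set vs \<subseteq> pverts T \<Longrightarrow> successively (\<lambda>a b. (a, b) \<in> parcs T) vs \<Longrightarrow>
    pre_digraph.awalk (with_proj T) (hd vs) (zip vs (tl vs)) (last vs) \<and>
    pawalk_verts (hd vs) (zip vs (tl vs)) = vs"
proof (induction vs rule: induct_list012)
  case 1
  then show ?case by simp
next
  case (2 x)
  then show ?case by (simp add: pre_digraph.awalk_def cas_with_proj_eq)
next
  case (3 x y zs)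
  then show ?case by (simp add: pre_digraph.awalk_def cas_with_proj_eq)
qed

text \<open>The first vertex of a longest path inside \<open>U\<close> has all its neighbours in
  \<open>U\<close> on the path, so a second neighbour closes a cycle. This turns acyclicity into the
  hereditary degree condition on which the edge count and the greedy embedding run their
  inductions.\<close>

lemma one_degenerate_tree:
  assumes T: "undirected_tree T"
  shows "one_degenerate (pverts T) (parcs T)"
  unfolding one_degenerate_def
proof (intro allI impI, rule ccontr)
  fix U assume U: "U \<subseteq> pverts T" "U \<noteq> {}" "\<not> (\<exists>v\<in>U. card (parcs T `` {v} \<inter> U) \<le> 1)"
  from T interpret pair_graph T by (simp add: undirected_tree_def)
  have fU: "finite U" using U(1) pair_finite_verts finite_subset by blast
  have symP: "(a, b) \<in> parcs T \<Longrightarrow> (b, a) \<in> parcs T" for a b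
    using pair_sym_arcs by (auto simp: symmetric_def sym_def)
  define Q where "Q vs \<longleftrightarrow> distinct vs \<and> set vs \<subseteq> U \<and> vs \<noteq> [] \<and>
      successively (\<lambda>a b. (a, b) \<in> parcs T) vs" for vs
  obtain u where "u \<in> U" using U(2) by blast
  then have Q1: "Q [u]" by (simp add: Q_def)
  have "\<forall>vs. Q vs \<longrightarrow> length vs \<le> card U"
    using fU unfolding Q_def by (metis card_mono distinct_card)
  then obtain vs where vs: "Q vs" "\<And>ws. Q ws \<Longrightarrow> length ws \<le> length vs"
    using ex_has_greatest_nat[of Q "[u]" length "Suc (card U)"] Q1 by (auto simp: less_Suc_eq_le)
  define v where "v = hd vs"
  then have v: "v = hd vs" "v \<in> U" using vs(1) unfolding Q_def by auto
  have nb: "w \<in> set vs" if "w \<in> parcs T `` {v} \<inter> U" for w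
  proof (rule ccontr)
    assume "w \<notin> set vs"
    then have "Q (w # vs)"
      using vs(1) that v(1) symP unfolding Q_def by (cases vs) auto
    with vs(2) show False by fastforce
  qed
  have "card (parcs T `` {v} \<inter> U) \<ge> 2" using U(3) v(2) by force
  \<comment> \<open>\<open>vs ! 1\<close> is the successor of \<open>v\<close> on the path. If the
    path is \<open>[v]\<close>, the value is arbitrary and harmless, since neighbours lie on the
    path and differ from \<open>v\<close>.\<close>
  then have "\<not> parcs T `` {v} \<inter> U \<subseteq> {vs ! 1}"
    using card_mono[of "{vs ! 1}" "parcs T `` {v} \<inter> U"] by auto
  then obtain w where w: "w \<in> parcs T `` {v} \<inter> U" "w \<noteq> vs ! 1" by blast
  from nb[OF w(1)] obtain i where i: "i < length vs" "vs ! i = w" by (auto simp: in_set_conv_nth)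
  have "vs ! 0 = v" using v(1) vs(1) by (simp add: Q_def hd_conv_nth)
  moreover have "w \<noteq> v" using w(1) no_loops' by blast
  ultimately have i2: "i \<ge> 2" using i w(2) by (metis One_nat_def less_2_cases not_le_imp_less)
  define c where "c = take (Suc i) vs @ [v]"
  have tk: "take (Suc i) vs = take i vs @ [w]" using i by (simp add: take_Suc_conv_app_nth)
  have "successively (\<lambda>a b. (a, b) \<in> parcs T) (take (Suc i) vs)"
    using vs(1) unfolding Q_def by (metis append_take_drop_id successively_append_iff)
  then have s: "successively (\<lambda>a b. (a, b) \<in> parcs T) c"
    unfolding c_def successively_append_iff using w(1) symP by (simp add: tk)
  have hd: "hd c = v" using v(1) vs(1) unfolding c_def Q_def by (cases vs) auto
  have ne: "c \<noteq> []" "last c = v" by (auto simp: c_def)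
  have sub: "set c \<subseteq> pverts T"
    using vs(1) U(1) v(2) unfolding c_def Q_def by (auto dest: in_set_takeD)
  from walk_of_vertex_list[OF pair_wf_digraph_axioms ne(1) sub s]
  have wk: "awalk v (zip c (tl c)) v" "pawalk_verts v (zip c (tl c)) = c" by (simp_all add: hd ne)
  have "distinct (tl c)"
  proof -
    obtain ws where ws: "vs = v # ws" using v(1) vs(1) by (cases vs) (auto simp: Q_def)
    then have "tl c = take i ws @ [v]" by (simp add: c_def)
    moreover have "distinct (v # ws)" using vs(1) ws by (simp add: Q_def)
    ultimately show ?thesis by (auto dest: in_set_takeD)
  qed
  moreover have len: "length (zip c (tl c)) = Suc i" using i(1) by (simp add: c_def)
  ultimately have "cycle (zip c (tl c))"
    unfolding cycle_def using wk by (metis list.size(3) nat.distinct(1))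
  moreover have "length (zip c (tl c)) \<ge> 3" using len i2 by simp
  ultimately show False using T unfolding undirected_tree_def by blast
qed

text \<open>Connectedness in the form of a closure argument; it serves to exclude the minimum
  degrees \<open>0\<close> and \<open>1\<close>.\<close>

lemma undirected_tree_closed_set:
  assumes T: "undirected_tree T" and W: "W \<subseteq> pverts T" "W \<noteq> {}"
    and cl: "\<And>u v. (u, v) \<in> parcs T \<Longrightarrow> u \<in> W \<Longrightarrow> v \<in> W"
  shows "W = pverts T"
proof -
  from T interpret pair_graph T by (simp add: undirected_tree_def)
  have symP: "(a, b) \<in> parcs T \<Longrightarrow> (b, a) \<in> parcs T" for a b
    using pair_sym_arcs by (auto simp: symmetric_def sym_def)
  obtain u where u: "u \<in> W" using W by blast
  have "v \<in> W" if "v \<in> pverts T" for v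
  proof -
    have "u \<rightarrow>\<^sup>*\<^bsub>mk_symmetric (with_proj T)\<^esub> v"
      using T u W that unfolding undirected_tree_def connected_def strongly_connected_def
      by auto
    then have "(u, v) \<in> rtrancl_on (pverts T) (arcs_ends (mk_symmetric (with_proj T)))"
      by (simp add: reachable_def)
    then show ?thesis
    proof (induction rule: rtrancl_on_induct)
      case base
      then show ?case using u by simp
    next
      case (step a b)
      then have "(a, b) \<in> parcs T \<or> (b, a) \<in> parcs T"
        by (auto simp: mk_symmetric_def arcs_ends_def)
      then show ?case using step cl symP by blast
    qed
  qed
  then show ?thesis using W by blast
qed

lemma one_degenerate_subset:
  "one_degenerate V P \<Longrightarrow> V' \<subseteq> V \<Longrightarrow> one_degenerate V' P"
  unfolding one_degenerate_def by (meson subset_trans)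

text \<open>A forest has fewer edges than vertices, by induction over a vertex of degree at most
  one. Only arcs from \<open>X\<close> to \<open>Y\<close> are counted, so each edge contributes
  once although \<open>P\<close> contains both directions.\<close>

lemma one_degenerate_bipartite_arcs:
  assumes "finite X" "finite Y" "one_degenerate (X \<union> Y) P" "sym P" "X \<inter> Y = {}" "X \<union> Y \<noteq> {}"
  shows "card (P \<inter> X \<times> Y) + 1 \<le> card X + card Y"
  using assms
proof (induction "card (X \<union> Y)" arbitrary: X Y)
  case 0
  then show ?case by auto
next
  case (Suc k)
  obtain v where v: "v \<in> X \<union> Y" "card (P `` {v} \<inter> (X \<union> Y)) \<le> 1"
    using one_degenerateD[OF Suc.prems(3) subset_refl Suc.prems(6)] by blast
  show ?case
  proof (cases "X \<union> Y = {v}")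
    case True
    then have "X \<subseteq> {v}" "Y \<subseteq> {v}" by auto
    then have "X = {} \<or> X = {v}" "Y = {} \<or> Y = {v}" by (simp_all add: subset_singleton_iff)
    then show ?thesis using Suc.prems(5,6) by auto
  next
    case False
    have fin: "finite (P \<inter> X \<times> Y)" using Suc.prems by simp
    have k: "k = card (X \<union> Y - {v})" using Suc.hyps(2) Suc.prems v(1) by simp
    show ?thesis
    proof (cases "v \<in> X")
      case True
      then have nY: "v \<notin> Y" using Suc.prems by blast
      have IH: "card (P \<inter> (X - {v}) \<times> Y) + 1 \<le> card (X - {v}) + card Y"
      proof (rule Suc.hyps(1))
        show "k = card (X - {v} \<union> Y)" using k nY by (simp add: Un_Diff)
      next
        show "one_degenerate (X - {v} \<union> Y) P" by (rule one_degenerate_subset[OF Suc.prems(3)]) auto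
      qed (use Suc.prems False v(1) in auto)
      have "P \<inter> X \<times> Y \<subseteq> P \<inter> (X - {v}) \<times> Y \<union> Pair v ` (P `` {v} \<inter> (X \<union> Y))" by auto
      then have "card (P \<inter> X \<times> Y) \<le> card (P \<inter> (X - {v}) \<times> Y \<union> Pair v ` (P `` {v} \<inter> (X \<union> Y)))"
        using Suc.prems by (intro card_mono) auto
      also have "\<dots> \<le> card (P \<inter> (X - {v}) \<times> Y) + card (Pair v ` (P `` {v} \<inter> (X \<union> Y)))"
        by (rule card_Un_le)
      also have "card (Pair v ` (P `` {v} \<inter> (X \<union> Y))) \<le> 1"
        using v(2) Suc.prems by (meson card_image_le finite_Int finite_UnI le_trans)
      finally show ?thesis using IH True Suc.prems(1) card_Suc_Diff1[of X v] by linarith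
    next
      case False
      note vX = this
      then have vY: "v \<in> Y" using v by blast
      have IH: "card (P \<inter> X \<times> (Y - {v})) + 1 \<le> card X + card (Y - {v})"
      proof (rule Suc.hyps(1))
        show "k = card (X \<union> (Y - {v}))" using k vX by (simp add: Un_Diff)
      next
        show "one_degenerate (X \<union> (Y - {v})) P" by (rule one_degenerate_subset[OF Suc.prems(3)]) auto
      qed (use Suc.prems \<open>X \<union> Y \<noteq> {v}\<close> v(1) in auto)
      have "P \<inter> X \<times> Y \<subseteq> P \<inter> X \<times> (Y - {v}) \<union> (\<lambda>w. (w, v)) ` (P `` {v} \<inter> (X \<union> Y))"
        using Suc.prems(4) by (auto dest: symD)
      then have "card (P \<inter> X \<times> Y)
          \<le> card (P \<inter> X \<times> (Y - {v}) \<union> (\<lambda>w. (w, v)) ` (P `` {v} \<inter> (X \<union> Y)))"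
        using Suc.prems by (intro card_mono) auto
      also have "\<dots> \<le> card (P \<inter> X \<times> (Y - {v})) + card ((\<lambda>w. (w, v)) ` (P `` {v} \<inter> (X \<union> Y)))"
        by (rule card_Un_le)
      also have "card ((\<lambda>w. (w, v)) ` (P `` {v} \<inter> (X \<union> Y))) \<le> 1"
        using v(2) Suc.prems by (meson card_image_le finite_Int finite_UnI le_trans)
      finally show ?thesis using IH vY Suc.prems(2) card_Suc_Diff1[of Y v] by linarith
    qed
  qed
qed

text \<open>The candidate sets \<open>D\<close> cover both unrestricted embeddings (constant
  \<open>D\<close>) and embeddings that respect the two parts. A vertex with at most one remaining
  neighbour \<open>s\<close> is removed, and reinserted among the neighbours of the image of
  \<open>s\<close>. Only vertices whose candidate sets meet \<open>D t\<close> can occupy places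
  there, which is what the cardinality conditions count.\<close>

lemma greedy_embedding:
  fixes D :: "'a \<Rightarrow> 'b set"
  assumes V: "finite V" "one_degenerate V P" "sym P" "irrefl P"
    and D: "\<And>t. t \<in> V \<Longrightarrow> finite (D t)" "\<And>t. t \<in> V \<Longrightarrow> D t \<noteq> {}"
      "\<And>t. t \<in> V \<Longrightarrow> card {u \<in> V. D u \<inter> D t \<noteq> {}} \<le> card (D t)"
    and step: "\<And>s t x. (s, t) \<in> P \<Longrightarrow> s \<in> V \<Longrightarrow> t \<in> V \<Longrightarrow> x \<in> D s \<Longrightarrow>
      card {u \<in> V. D u \<inter> D t \<noteq> {}} \<le> card (E `` {x} \<inter> D t)"
    and E: "sym E"
  shows "\<exists>h. inj_on h V \<and> (\<forall>t\<in>V. h t \<in> D t) \<and> (\<forall>s\<in>V. \<forall>t\<in>V. (s, t) \<in> P \<longrightarrow> (h s, h t) \<in> E)"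
proof -
  have "\<exists>h. inj_on h U \<and> (\<forall>t\<in>U. h t \<in> D t) \<and> (\<forall>s\<in>U. \<forall>t\<in>U. (s, t) \<in> P \<longrightarrow> (h s, h t) \<in> E)"
    if "U \<subseteq> V" for U
    using that
  proof (induction "card U" arbitrary: U)
    case 0
    then have "U = {}" using V(1) finite_subset by fastforce
    then show ?case by simp
  next
    case (Suc k)
    have fU: "finite U" using Suc.prems V(1) finite_subset by blast
    have "U \<noteq> {}" using Suc.hyps(2) by auto
    then obtain v where v: "v \<in> U" "card (P `` {v} \<inter> U) \<le> 1"
      using one_degenerateD[OF V(2) Suc.prems] by blast
    have vV: "v \<in> V" using v(1) Suc.prems by blast
    define U' where "U' = U - {v}"
    have "k = card U'" "U' \<subseteq> V" using Suc.hyps(2) Suc.prems v(1) fU by (auto simp: U'_def)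
    from Suc.hyps(1)[OF this] obtain h where h: "inj_on h U'" "\<And>t. t \<in> U' \<Longrightarrow> h t \<in> D t"
      "\<And>s t. s \<in> U' \<Longrightarrow> t \<in> U' \<Longrightarrow> (s, t) \<in> P \<Longrightarrow> (h s, h t) \<in> E" by blast
    define M where "M = {u \<in> V. D u \<inter> D v \<noteq> {}}"
    have fM: "finite M" "v \<in> M" using V(1) vV D(2) by (auto simp: M_def)
    have "h ` U' \<inter> D v \<subseteq> h ` (M - {v})"
      using h(2) \<open>U' \<subseteq> V\<close> by (auto simp: M_def U'_def intro!: imageI)
    then have "card (h ` U' \<inter> D v) \<le> card (M - {v})"
      using fM by (meson card_image_le card_mono finite_Diff finite_imageI le_trans)
    \<comment> \<open>The vertex \<open>v\<close> belongs to \<open>M\<close> but is not placed yet,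
      so a candidate set of size \<open>card M\<close> always has a free place.\<close>
    then have lt: "card (h ` U' \<inter> D v) < card M" 
      using card_Diff1_less[OF fM] by linarith
    have pick: "\<exists>y\<in>C. y \<notin> h ` U'" if "C \<subseteq> D v" "card M \<le> card C" for C
    proof (rule ccontr)
      assume "\<not> (\<exists>y\<in>C. y \<notin> h ` U')"
      then have "C \<subseteq> h ` U' \<inter> D v" using that(1) by blast
      then have "card C \<le> card (h ` U' \<inter> D v)"
        using D(1)[OF vV] by (intro card_mono) auto
      with lt that(2) show False by simp
    qed
    have "\<exists>y\<in>D v. y \<notin> h ` U' \<and> (\<forall>s\<in>U'. (s, v) \<in> P \<longrightarrow> (h s, y) \<in> E)"
    proof (cases "P `` {v} \<inter> U = {}")
      case True
      then have "\<forall>s\<in>U'. (s, v) \<notin> P" using V(3) by (auto simp: U'_def dest: symD)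
      moreover obtain y where "y \<in> D v" "y \<notin> h ` U'"
        using pick[of "D v"] D(3)[OF vV] by (auto simp: M_def)
      ultimately show ?thesis by blast
    next
      case False
      have "card (P `` {v} \<inter> U) = 1" using False v(2) fU by (simp add: le_antisym Suc_le_eq card_gt_0_iff)
      then obtain s where s: "P `` {v} \<inter> U = {s}" by (rule card_1_singletonE)
      have sU: "s \<in> U'" using s V(4) by (auto simp: U'_def irrefl_def)
      have sv: "(s, v) \<in> P" using s V(3) by (auto dest: symD)
      have "card M \<le> card (E `` {h s} \<inter> D v)"
        unfolding M_def using step[OF sv _ vV h(2)[OF sU]] sU \<open>U' \<subseteq> V\<close> by blast
      then obtain y where y: "y \<in> E `` {h s} \<inter> D v" "y \<notin> h ` U'"
        using pick[of "E `` {h s} \<inter> D v"] by blast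
      moreover have "s' = s" if "s' \<in> U'" "(s', v) \<in> P" for s'
        using that s V(3) by (auto simp: U'_def dest: symD)
      ultimately show ?thesis by (intro bexI[of _ y]) auto
    qed
    then obtain y where y: "y \<in> D v" "y \<notin> h ` U'" "\<And>s. s \<in> U' \<Longrightarrow> (s, v) \<in> P \<Longrightarrow> (h s, y) \<in> E"
      by blast
    define g where "g = h(v := y)"
    have "inj_on g U"
    proof -
      have "inj_on g (insert v U')"
        using h(1) y(2) by (auto simp: g_def U'_def inj_on_def)
      then show ?thesis using v(1) by (simp add: U'_def insert_absorb)
    qed
    moreover have "\<forall>t\<in>U. g t \<in> D t" using h(2) y(1) by (auto simp: g_def U'_def)
    moreover have gE: "(g s, g t) \<in> E" if "s \<in> U" "t \<in> U" "(s, t) \<in> P" for s t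
    proof -
      have "s \<noteq> t" using that V(4) by (auto simp: irrefl_def)
      then show ?thesis
        using that h(3)[of s t] y(3)[of s] y(3)[of t] V(3) E
        by (auto simp: g_def U'_def dest: symD)
    qed
    ultimately show ?case by (intro exI[of _ g]) (simp add: gE)
  qed
  from this[OF subset_refl] show ?thesis .
qed

section \<open>Copies of a tree in a relation\<close>

text \<open>Relational form of \<open>embeddable\<close>, suited to graphs that are modified as bare
  arc sets on a fixed vertex set.\<close>

definition copy_in :: "'a set \<Rightarrow> 'a rel \<Rightarrow> 'b set \<Rightarrow> 'b rel \<Rightarrow> bool" where
  "copy_in V P U E \<longleftrightarrow> (\<exists>h. inj_on h V \<and> h ` V \<subseteq> U \<and> (\<forall>(s, t)\<in>P. (h s, h t) \<in> E))"

lemma copy_inI: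
  assumes "inj_on h V" "\<And>t. t \<in> V \<Longrightarrow> h t \<in> U" "\<And>s t. (s, t) \<in> P \<Longrightarrow> (h s, h t) \<in> E"
  shows "copy_in V P U E"
  unfolding copy_in_def using assms by (intro exI[of _ h]) auto

lemma copy_inD:
  assumes "copy_in V P U E"
  shows "\<exists>h. inj_on h V \<and> (\<forall>t\<in>V. h t \<in> U) \<and> (\<forall>s t. (s, t) \<in> P \<longrightarrow> (h s, h t) \<in> E)"
  using assms unfolding copy_in_def by blast

lemma copy_in_trans:
  assumes "copy_in V P W Q" "copy_in W Q U E"
  shows "copy_in V P U E"
proof -
  obtain g where g: "inj_on g V" "\<And>t. t \<in> V \<Longrightarrow> g t \<in> W" "\<And>s t. (s, t) \<in> P \<Longrightarrow> (g s, g t) \<in> Q"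
    using copy_inD[OF assms(1)] by blast
  obtain h where h: "inj_on h W" "\<And>t. t \<in> W \<Longrightarrow> h t \<in> U" "\<And>s t. (s, t) \<in> Q \<Longrightarrow> (h s, h t) \<in> E"
    using copy_inD[OF assms(2)] by blast
  have "inj_on (h \<circ> g) V"
    using g(2) by (intro comp_inj_on[OF g(1)] inj_on_subset[OF h(1)]) auto
  then show ?thesis by (rule copy_inI) (simp_all add: g h)
qed

section \<open>Counting arcs in graphs without a copy of the tree\<close>

lemma card_arcs_remove_vertex:
  assumes "finite W" "w \<in> W" "sym E"
  shows "card (E \<inter> W \<times> W) \<le> card (E \<inter> (W - {w}) \<times> (W - {w})) + 2 * card (E `` {w} \<inter> W)"
proof -
  have "E \<inter> W \<times> W \<subseteq> E \<inter> (W - {w}) \<times> (W - {w}) \<union>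
      (Pair w ` (E `` {w} \<inter> W) \<union> (\<lambda>u. (u, w)) ` (E `` {w} \<inter> W))"
    using assms(3) by (auto dest: symD)
  then have "card (E \<inter> W \<times> W) \<le> card (E \<inter> (W - {w}) \<times> (W - {w}) \<union>
      (Pair w ` (E `` {w} \<inter> W) \<union> (\<lambda>u. (u, w)) ` (E `` {w} \<inter> W)))"
    using assms(1) by (intro card_mono) auto
  also have "\<dots> \<le> card (E \<inter> (W - {w}) \<times> (W - {w})) +
      (card (Pair w ` (E `` {w} \<inter> W)) + card ((\<lambda>u. (u, w)) ` (E `` {w} \<inter> W)))"
    using card_Un_le[of "E \<inter> (W - {w}) \<times> (W - {w})"
        "Pair w ` (E `` {w} \<inter> W) \<union> (\<lambda>u. (u, w)) ` (E `` {w} \<inter> W)"]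
      card_Un_le[of "Pair w ` (E `` {w} \<inter> W)" "(\<lambda>u. (u, w)) ` (E `` {w} \<inter> W)"] by linarith
  also have "\<dots> \<le> card (E \<inter> (W - {w}) \<times> (W - {w})) + 2 * card (E `` {w} \<inter> W)"
    using assms(1) card_image_le[of "E `` {w} \<inter> W" "Pair w"]
      card_image_le[of "E `` {w} \<inter> W" "\<lambda>u. (u, w)"] by simp
  finally show ?thesis .
qed

lemma card_arcs_Times_remove_left:
  assumes "finite X" "finite Y" "x \<in> X"
  shows "card (E \<inter> X \<times> Y) \<le> card (E \<inter> (X - {x}) \<times> Y) + card (E `` {x} \<inter> Y)"
proof -
  have "E \<inter> X \<times> Y \<subseteq> E \<inter> (X - {x}) \<times> Y \<union> Pair x ` (E `` {x} \<inter> Y)" by auto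
  then have "card (E \<inter> X \<times> Y) \<le> card (E \<inter> (X - {x}) \<times> Y \<union> Pair x ` (E `` {x} \<inter> Y))"
    using assms by (intro card_mono) auto
  also have "\<dots> \<le> card (E \<inter> (X - {x}) \<times> Y) + card (Pair x ` (E `` {x} \<inter> Y))"
    by (rule card_Un_le)
  also have "card (Pair x ` (E `` {x} \<inter> Y)) \<le> card (E `` {x} \<inter> Y)"
    using assms by (intro card_image_le) auto
  finally show ?thesis by simp
qed

lemma card_arcs_Times_swap: "sym E \<Longrightarrow> card (E \<inter> X \<times> Y) = card (E \<inter> Y \<times> X)"
  by (rule bij_betw_same_card[of prod.swap])
    (auto intro!: bij_betwI[of _ _ _ prod.swap] dest: symD)

lemma card_arcs_Times_remove_right:
  assumes "finite X" "finite Y" "y \<in> Y" "sym E"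
  shows "card (E \<inter> X \<times> Y) \<le> card (E \<inter> X \<times> (Y - {y})) + card (E `` {y} \<inter> X)"
  using card_arcs_Times_remove_left[OF assms(2,1,3), of E] assms(4)
  by (simp add: card_arcs_Times_swap)

locale tree_parts =
  fixes P :: "'a rel" and A B :: "'a set" and l m d :: nat
  assumes finite_parts: "finite A" "finite B"
    and degenerate: "one_degenerate (A \<union> B) P" and sym_P: "sym P"
    and disjoint_parts: "A \<inter> B = {}" and bipartite: "P \<subseteq> A \<times> B \<union> B \<times> A"
    and card_A: "card A = l + 1" and card_parts: "card A + card B = m"
    and min_degree: "\<And>a. a \<in> A \<Longrightarrow> d \<le> card (P `` {a})"
    and min_degree_attained: "\<exists>a\<in>A. card (P `` {a}) = d"
begin

lemma irrefl_P: "irrefl P"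
  using bipartite disjoint_parts by (auto simp: irrefl_def)

lemma nbrs_A: "a \<in> A \<Longrightarrow> P `` {a} \<subseteq> B" and nbrs_B: "b \<in> B \<Longrightarrow> P `` {b} \<subseteq> A"
  using bipartite disjoint_parts by auto

lemma card_B_le: "card B \<le> m" and card_V: "card (A \<union> B) = m"
  using card_parts by (simp_all add: card_Un_disjoint finite_parts disjoint_parts)

lemma m_pos: "m > 0"
  using card_A card_parts by simp

text \<open>If every vertex of \<open>W\<close> had \<open>m\<close> neighbours in \<open>W\<close>,
  the tree would embed greedily with all candidate sets equal to \<open>W\<close>. So some vertex
  has fewer, and deleting it loses fewer than \<open>2 * m\<close> ordered arcs.\<close>

lemma card_arcs_le:
  assumes U: "finite U" and E: "sym E" and free: "\<not> copy_in (A \<union> B) P U E"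
  shows "W \<subseteq> U \<Longrightarrow> card (E \<inter> W \<times> W) \<le> 2 * m * card W"
proof (induction "card W" arbitrary: W)
  case 0
  then have "W = {}" using U finite_subset by fastforce
  then show ?case by simp
next
  case (Suc k)
  have fW: "finite W" using Suc.prems U finite_subset by blast
  have "\<exists>w\<in>W. card (E `` {w} \<inter> W) < m"
  proof (rule ccontr)
    assume "\<not> (\<exists>w\<in>W. card (E `` {w} \<inter> W) < m)"
    then have ge: "m \<le> card (E `` {w} \<inter> W)" if "w \<in> W" for w using that by force
    have ne: "W \<noteq> {}" using Suc.hyps(2) by auto
    then obtain w where "w \<in> W" by blast
    then have mW: "m \<le> card W" using ge fW card_mono[of W "E `` {w} \<inter> W"] by fastforce
    have all: "card {u \<in> A \<union> B. W \<inter> W \<noteq> {}} \<le> m"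
      using card_V card_mono[of "A \<union> B" "{u \<in> A \<union> B. W \<inter> W \<noteq> {}}"] finite_parts by auto
    have "\<exists>h. inj_on h (A \<union> B) \<and> (\<forall>t\<in>A \<union> B. h t \<in> W) \<and>
        (\<forall>s\<in>A \<union> B. \<forall>t\<in>A \<union> B. (s, t) \<in> P \<longrightarrow> (h s, h t) \<in> E)"
    proof (rule greedy_embedding[OF _ degenerate sym_P irrefl_P])
      show "finite (A \<union> B)" using finite_parts by simp
      show "card {u \<in> A \<union> B. W \<inter> W \<noteq> {}} \<le> card W" using all mW by (rule order_trans)
      show "card {u \<in> A \<union> B. W \<inter> W \<noteq> {}} \<le> card (E `` {x} \<inter> W)" if "x \<in> W" for x
        using all ge[OF that] by (rule order_trans)
    qed (use fW ne E in simp_all)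
    then obtain h where "inj_on h (A \<union> B)" "\<forall>t\<in>A \<union> B. h t \<in> W"
        "\<forall>s\<in>A \<union> B. \<forall>t\<in>A \<union> B. (s, t) \<in> P \<longrightarrow> (h s, h t) \<in> E" by blast
    then have "copy_in (A \<union> B) P U E"
      using Suc.prems bipartite by (intro copy_inI[of h]) auto
    with free show False by simp
  qed
  then obtain w where w: "w \<in> W" "card (E `` {w} \<inter> W) < m" by blast
  have k: "k = card (W - {w})" "card W = Suc k" using Suc.hyps(2) w(1) fW by auto
  have "card (E \<inter> (W - {w}) \<times> (W - {w})) \<le> 2 * m * k"
    using Suc.hyps(1)[OF k(1)] Suc.prems k(1) by auto
  moreover have "card (E \<inter> W \<times> W) \<le> card (E \<inter> (W - {w}) \<times> (W - {w})) + 2 * card (E `` {w} \<inter> W)"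
    by (rule card_arcs_remove_vertex[OF fW w(1) E])
  ultimately show ?case using w(2) k(2) by (simp add: algebra_simps)
qed

text \<open>Vertices of \<open>X\<close> with fewer than \<open>m\<close> neighbours in
  \<open>Y\<close>, and vertices of \<open>Y\<close> with at most \<open>l\<close> neighbours in
  \<open>X\<close>, can be deleted one at a time. If neither kind is left, the tree embeds with
  \<open>A\<close> in \<open>X\<close> and \<open>B\<close> in \<open>Y\<close>. The coefficient
  \<open>l\<close> comes from \<open>card A = l + 1\<close> and becomes the leading coefficient of
  the spectral estimates.\<close>

lemma card_arcs_Times_le:
  assumes E: "sym E" and free: "\<not> copy_in (A \<union> B) P U E"
  shows "finite X \<Longrightarrow> finite Y \<Longrightarrow> X \<subseteq> U \<Longrightarrow> Y \<subseteq> U \<Longrightarrow> X \<inter> Y = {} \<Longrightarrow>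
    card (E \<inter> X \<times> Y) \<le> m * card X + l * card Y"
proof (induction "card X + card Y" arbitrary: X Y)
  case 0
  then show ?case by simp
next
  case (Suc k)
  note fin = Suc.prems(1,2)
  consider "X = {} \<or> Y = {}" | x where "x \<in> X" "card (E `` {x} \<inter> Y) < m"
    | y where "y \<in> Y" "card (E `` {y} \<inter> X) \<le> l"
    | "X \<noteq> {}" "Y \<noteq> {}" "\<And>x. x \<in> X \<Longrightarrow> m \<le> card (E `` {x} \<inter> Y)"
      "\<And>y. y \<in> Y \<Longrightarrow> l + 1 \<le> card (E `` {y} \<inter> X)" by force
  then show ?case
  proof cases
    case 1
    then show ?thesis by auto
  next
    case (2 x)
    have c: "card X = Suc (card (X - {x}))" using fin 2(1) by (metis card_Suc_Diff1)
    have "card (E \<inter> (X - {x}) \<times> Y) \<le> m * card (X - {x}) + l * card Y"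
      by (rule Suc.hyps(1)) (use Suc.hyps(2) Suc.prems c in auto)
    with card_arcs_Times_remove_left[OF fin 2(1), of E] 2(2) c show ?thesis
      by (simp add: algebra_simps)
  next
    case (3 y)
    have c: "card Y = Suc (card (Y - {y}))" using fin 3(1) by (metis card_Suc_Diff1)
    have "card (E \<inter> X \<times> (Y - {y})) \<le> m * card X + l * card (Y - {y})"
      by (rule Suc.hyps(1)) (use Suc.hyps(2) Suc.prems c in auto)
    with card_arcs_Times_remove_right[OF fin 3(1) E] 3(2) c show ?thesis
      by (simp add: algebra_simps)
  next
    case 4
    define D where "D t = (if t \<in> A then X else Y)" for t
    have DA: "t \<in> A \<Longrightarrow> D t = X" and DB: "t \<in> B \<Longrightarrow> D t = Y" for t
      using disjoint_parts by (auto simp: D_def)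
    have "{u \<in> A \<union> B. D u \<inter> X \<noteq> {}} \<subseteq> A" "{u \<in> A \<union> B. D u \<inter> Y \<noteq> {}} \<subseteq> B"
      using DA DB Suc.prems(5) by (auto simp: Int_commute)
    from card_mono[OF finite_parts(1) this(1)] card_mono[OF finite_parts(2) this(2)]
    have clsA: "card {u \<in> A \<union> B. D u \<inter> X \<noteq> {}} \<le> l + 1"
      and clsB: "card {u \<in> A \<union> B. D u \<inter> Y \<noteq> {}} \<le> m"
      using card_A card_B_le by linarith+
    obtain x y where xy: "x \<in> X" "y \<in> Y" using 4 by blast
    have mY: "m \<le> card Y"
      using 4(3)[OF xy(1)] fin card_mono[of Y "E `` {x} \<inter> Y"] by fastforce
    have lX: "l + 1 \<le> card X"
      using 4(4)[OF xy(2)] fin card_mono[of X "E `` {y} \<inter> X"] by fastforce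
    have "\<exists>h. inj_on h (A \<union> B) \<and> (\<forall>t\<in>A \<union> B. h t \<in> D t) \<and>
        (\<forall>s\<in>A \<union> B. \<forall>t\<in>A \<union> B. (s, t) \<in> P \<longrightarrow> (h s, h t) \<in> E)"
    proof (rule greedy_embedding[OF _ degenerate sym_P irrefl_P])
      show "finite (A \<union> B)" using finite_parts by simp
      fix t assume t: "t \<in> A \<union> B"
      show "finite (D t)" "D t \<noteq> {}" using 4 fin by (auto simp: D_def)
      show "card {u \<in> A \<union> B. D u \<inter> D t \<noteq> {}} \<le> card (D t)"
        using t DA[of t] DB[of t] order_trans[OF clsA lX] order_trans[OF clsB mY] by (elim UnE) simp_all
      fix s x assume st: "(s, t) \<in> P" "x \<in> D s"
      then consider "s \<in> A" "t \<in> B" | "s \<in> B" "t \<in> A" using bipartite by blast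
      then show "card {u \<in> A \<union> B. D u \<inter> D t \<noteq> {}} \<le> card (E `` {x} \<inter> D t)"
      proof cases
        case 1
        then have "x \<in> X" "D t = Y" using st(2) DA DB by auto
        then show ?thesis using order_trans[OF clsB 4(3)[of x]] by simp
      next
        case 2
        then have "x \<in> Y" "D t = X" using st(2) DA DB by auto
        then show ?thesis using order_trans[OF clsA 4(4)[of x]] by simp
      qed
    qed (rule E)
    then obtain h where h: "inj_on h (A \<union> B)" "\<forall>t\<in>A \<union> B. h t \<in> D t"
        "\<forall>s\<in>A \<union> B. \<forall>t\<in>A \<union> B. (s, t) \<in> P \<longrightarrow> (h s, h t) \<in> E" by blast
    have "D t \<subseteq> U" for t using Suc.prems by (simp add: D_def)
    then have "copy_in (A \<union> B) P U E"
      using h bipartite by (intro copy_inI[of h]) blast+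
    with free show ?thesis by simp
  qed
qed

text \<open>Together with \<open>m\<close> common neighbours, \<open>X\<close> would span a complete
  bipartite graph large enough to receive \<open>A\<close> and \<open>B\<close> by arbitrary
  injections.\<close>

lemma card_common_nbrs_less:
  assumes "irrefl E" "sym E" "\<not> copy_in (A \<union> B) P U E" "finite U" "X \<subseteq> U" "card X = l + 1"
  shows "card {w \<in> U. X \<subseteq> E `` {w}} < m"
proof (rule ccontr)
  define C where "C = {w \<in> U. X \<subseteq> E `` {w}}"
  assume "\<not> card {w \<in> U. X \<subseteq> E `` {w}} < m"
  then have cC: "card B \<le> card C" using card_B_le unfolding C_def by simp
  have fX: "finite X" "finite C" using assms finite_subset unfolding C_def by auto
  obtain f where f: "bij_betw f A X"
    using finite_same_card_bij[OF finite_parts(1) fX(1)] card_A assms(6) by metis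
  obtain g where g: "inj_on g B" "g ` B \<subseteq> C"
    using card_le_inj[OF finite_parts(2) fX(2) cC] by blast
  have XC: "X \<inter> C = {}" using assms(1) by (auto simp: C_def irrefl_def)
  define h where "h t = (if t \<in> A then f t else g t)" for t
  have hA: "t \<in> A \<Longrightarrow> h t = f t" "t \<in> A \<Longrightarrow> f t \<in> X" for t
    using f by (auto simp: h_def bij_betw_def)
  have hB: "t \<in> B \<Longrightarrow> h t = g t" "t \<in> B \<Longrightarrow> g t \<in> C" for t
    using g disjoint_parts by (auto simp: h_def)
  have "inj_on h (A \<union> B)"
  proof (rule inj_onI)
    have 1: "s = t" if "s \<in> A" "t \<in> A" "h s = h t" for s t
      using that hA(1)[of s] hA(1)[of t] f by (simp add: bij_betw_def inj_on_def)
    have 2: "s = t" if "s \<in> B" "t \<in> B" "h s = h t" for s t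
      using that hB(1)[of s] hB(1)[of t] g(1) by (simp add: inj_on_def)
    have 3: "h s \<noteq> h t" if "s \<in> A" "t \<in> B" for s t
      using hA[OF that(1)] hB[OF that(2)] XC by auto
    fix s t assume "s \<in> A \<union> B" "t \<in> A \<union> B" "h s = h t"
    then show "s = t" using 1[of s t] 2[of s t] 3[of s t] 3[of t s] by auto
  qed
  moreover have "(h s, h t) \<in> E" if st: "(s, t) \<in> P" for s t
  proof -
    have XE: "(x, c) \<in> E \<and> (c, x) \<in> E" if "x \<in> X" "c \<in> C" for x c
      using that assms(2) by (auto simp: C_def dest: symD)
    consider "s \<in> A" "t \<in> B" | "s \<in> B" "t \<in> A" using st bipartite by blast
    then show ?thesis using hA hB XE by cases simp_all
  qed
  moreover have "h t \<in> U" if "t \<in> A \<union> B" for t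
    using that hA hB assms(5) unfolding C_def by auto
  ultimately have "copy_in (A \<union> B) P U E" by (intro copy_inI[of h]) auto
  with assms(3) show False by simp
qed

text \<open>A vertex \<open>a\<close> of \<open>A\<close> of minimum degree \<open>d\<close> goes to
  \<open>v\<close>, its neighbours go to neighbours of \<open>v\<close> in \<open>R\<close>, the
  other \<open>l\<close> vertices of \<open>A\<close> fill \<open>S\<close>, and the rest of
  \<open>B\<close> is spread over \<open>R\<close>. All arcs not at \<open>a\<close> then run
  between \<open>S\<close> and \<open>R\<close>.\<close>

lemma copy_in_of_big_star:
  assumes E: "sym E" "irrefl E" and S: "S \<subseteq> U" "card S = l" "finite S"
    and R: "R \<subseteq> U" "finite R" "S \<inter> R = {}" "S \<times> R \<subseteq> E" "m < card R"
    and v: "v \<in> U" "v \<notin> S" "d \<le> card (E `` {v} \<inter> R)"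
  shows "copy_in (A \<union> B) P U E"
proof -
  obtain a where a: "a \<in> A" "card (P `` {a}) = d" using min_degree_attained by blast
  define N where "N = P `` {a}"
  have N: "N \<subseteq> B" "card N = d" "finite N"
    using nbrs_A[OF a(1)] a(2) finite_parts finite_subset by (auto simp: N_def)
  obtain N' where N': "N' \<subseteq> E `` {v} \<inter> R" "card N' = d" "finite N'"
    using obtain_subset_with_card_n[OF v(3)] by metis
  obtain f where f: "bij_betw f N N'" using finite_same_card_bij N N' by metis
  have "card (A - {a}) = card S" using a(1) card_A S(2) finite_parts by simp
  then obtain g where g: "bij_betw g (A - {a}) S"
    using finite_same_card_bij[of "A - {a}" S] finite_parts(1) S(3) by auto
  have vN': "v \<notin> N'" using N'(1) E(2) by (auto simp: irrefl_def)
  \<comment> \<open>\<open>v\<close> may itself lie in \<open>R\<close>, so up to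
    \<open>d + 1\<close> vertices of \<open>R\<close> are reserved. The rest of \<open>B\<close>
    still fits because \<open>card B < m < card R\<close>.\<close>
  have "card R - card (insert v N') \<le> card (R - insert v N')"
    using N'(3) by (intro diff_card_le_card_Diff) simp
  then have "card R - d - 1 \<le> card (R - insert v N')" using vN' N' by simp
  moreover have "card (B - N) = card B - d" using N by (simp add: card_Diff_subset)
  moreover have "card B < m" using card_A card_parts by simp
  ultimately have "card (B - N) \<le> card (R - insert v N')" using R(5) by linarith
  then obtain k where k: "inj_on k (B - N)" "k ` (B - N) \<subseteq> R - insert v N'"
    using card_le_inj[of "B - N" "R - insert v N'"] finite_parts R(2) by auto
  define h where "h t = (if t = a then v else if t \<in> A then g t else if t \<in> N then f t else k t)" for t
  have aB: "a \<notin> B" using a disjoint_parts by blast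
  have ha: "h a = v" by (simp add: h_def)
  have hA: "h t = g t" "h t \<in> S" if "t \<in> A" "t \<noteq> a" for t
    using that g by (auto simp: h_def bij_betw_def)
  have hN: "h t = f t" "h t \<in> N'" if "t \<in> N" for t
  proof -
    have "t \<notin> A" "t \<noteq> a" using that N(1) aB disjoint_parts by auto
    then show "h t = f t" "h t \<in> N'" using that f by (auto simp: h_def bij_betw_def)
  qed
  have hB: "h t = k t" "h t \<in> R" "h t \<notin> N'" "h t \<noteq> v" if "t \<in> B" "t \<notin> N" for t
  proof -
    have "t \<notin> A" "t \<noteq> a" using that N(1) aB disjoint_parts by auto
    then show "h t = k t" using that by (simp add: h_def)
    moreover have "k t \<in> R - insert v N'" using that k(2) by blast
    ultimately show "h t \<in> R" "h t \<notin> N'" "h t \<noteq> v" by auto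
  qed
  have hBR: "h t \<in> R" "h t \<noteq> v" if "t \<in> B" for t
  proof -
    show "h t \<in> R" using that hN(2)[of t] hB(2)[of t] N'(1) by blast
    show "h t \<noteq> v" using that hN(2)[of t] hB(4)[of t] vN' by metis
  qed
  have inj: "inj_on h (A \<union> B)"
  proof (rule inj_onI)
    have inj_g: "inj_on g (A - {a})" and inj_f: "inj_on f N" using f g by (auto simp: bij_betw_def)
    have *: "s = t" if "s \<in> A" "t \<in> A" "h s = h t" for s t
      using that hA ha v(2) inj_g unfolding inj_on_def by (metis Diff_iff singletonD)
    have **: "s = t" if "s \<in> B" "t \<in> B" "h s = h t" for s t
      using that hN[of s] hN[of t] hB[of s] hB[of t] inj_f k(1) unfolding inj_on_def
      by (metis Diff_iff)
    have ***: "h s \<noteq> h t" if "s \<in> A" "t \<in> B" for s t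
      using that hBR[of t] ha hA[of s] R(3) by (metis disjoint_iff)
    fix s t assume "s \<in> A \<union> B" "t \<in> A \<union> B" "h s = h t"
    then show "s = t" using * ** *** by (metis UnE)
  qed
  have arcAB: "(h s, h t) \<in> E" if "(s, t) \<in> P" "s \<in> A" "t \<in> B" for s t
  proof (cases "s = a")
    case True
    then have "t \<in> N" using that by (simp add: N_def)
    then show ?thesis using hN[of t] N'(1) True ha by auto
  next
    case False
    then show ?thesis using hA(2)[OF that(2)] hBR(1)[OF that(3)] R(4) by blast
  qed
  show ?thesis
  proof (rule copy_inI[OF inj])
    fix t assume "t \<in> A \<union> B"
    then show "h t \<in> U" using ha hA hBR v(1) S(1) R(1) by (metis UnE subsetD)
  next
    fix s t assume st: "(s, t) \<in> P"
    then have "(t, s) \<in> P" using sym_P by (auto dest: symD)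
    then show "(h s, h t) \<in> E"
      using st bipartite arcAB E(1) by (auto dest: symD)
  qed
qed

text \<open>
  A copy in a join \<open>S \<or> H\<close> with \<open>card S \<le> l\<close> puts at most \<open>l\<close> vertices on \<open>S\<close>.  Since the arcs
  between the remaining vertices of \<open>A\<close> and the part of \<open>B\<close> placed on \<open>S\<close> form a forest, either
  some vertex of \<open>A\<close> keeps all its neighbours in \<open>H\<close>, or two of them lose only one.
\<close>
lemma not_copy_in_join:
  assumes S: "card S \<le> l" "finite S" and U: "finite U"
    and deg: "\<And>v. v \<in> U - S \<Longrightarrow> card (E `` {v} \<inter> (U - S)) \<le> d - 1"
    and uniq: "\<And>u v. u \<in> U - S \<Longrightarrow> v \<in> U - S \<Longrightarrow> d - 1 \<le> card (E `` {u} \<inter> (U - S)) \<Longrightarrow>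
      d - 1 \<le> card (E `` {v} \<inter> (U - S)) \<Longrightarrow> u = v"
    and d: "d > 0"
  shows "\<not> copy_in (A \<union> B) P U E"
proof
  assume "copy_in (A \<union> B) P U E"
  then obtain h where h: "inj_on h (A \<union> B)" "\<And>t. t \<in> A \<union> B \<Longrightarrow> h t \<in> U"
    "\<And>s t. (s, t) \<in> P \<Longrightarrow> (h s, h t) \<in> E" using copy_inD by metis
  define A' where "A' = {a \<in> A. h a \<notin> S}"
  define A\<^sub>0 where "A\<^sub>0 = {a \<in> A. h a \<in> S}"
  define B\<^sub>0 where "B\<^sub>0 = {b \<in> B. h b \<in> S}"
  have fin: "finite A'" "finite A\<^sub>0" "finite B\<^sub>0"
    using finite_parts by (simp_all add: A'_def A\<^sub>0_def B\<^sub>0_def)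
  have "inj_on h (A\<^sub>0 \<union> B\<^sub>0)" "h ` (A\<^sub>0 \<union> B\<^sub>0) \<subseteq> S"
    using h(1) by (auto simp: A\<^sub>0_def B\<^sub>0_def intro: inj_on_subset)
  then have "card (A\<^sub>0 \<union> B\<^sub>0) \<le> l" using S card_inj_on_le order_trans by metis
  then have AB0: "card A\<^sub>0 + card B\<^sub>0 \<le> l"
    using disjoint_parts fin by (subst (asm) card_Un_disjoint) (auto simp: A\<^sub>0_def B\<^sub>0_def)
  have "card A = card A\<^sub>0 + card A'"
    using fin by (subst card_Un_disjoint[symmetric]) (auto simp: A\<^sub>0_def A'_def intro: arg_cong[of _ _ card])
  then have A'B0: "card B\<^sub>0 < card A'" using AB0 card_A by simp
  define f where "f a = card (P `` {a} \<inter> B\<^sub>0)" for a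
  have out: "d \<le> f a + card (E `` {h a} \<inter> (U - S))" if "a \<in> A'" for a
  proof -
    have aA: "a \<in> A" using that by (simp add: A'_def)
    have fN: "finite (P `` {a})" using nbrs_A[OF aA] finite_parts finite_subset by blast
    have "P `` {a} = P `` {a} \<inter> B\<^sub>0 \<union> (P `` {a} - B\<^sub>0)" by blast
    then have "card (P `` {a}) \<le> f a + card (P `` {a} - B\<^sub>0)"
      unfolding f_def by (metis card_Un_le)
    moreover have "card (P `` {a} - B\<^sub>0) \<le> card (E `` {h a} \<inter> (U - S))"
    proof (rule card_inj_on_le)
      show "inj_on h (P `` {a} - B\<^sub>0)"
        using nbrs_A[OF aA] by (intro inj_on_subset[OF h(1)]) auto
      show "h ` (P `` {a} - B\<^sub>0) \<subseteq> E `` {h a} \<inter> (U - S)"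
        using nbrs_A[OF aA] h(2,3) by (auto simp: B\<^sub>0_def)
    qed (use U in auto)
    ultimately show ?thesis using min_degree[OF aA] by linarith
  qed
  have hA': "h a \<in> U - S" "a \<in> A" if "a \<in> A'" for a using that h(2) by (auto simp: A'_def)
  have f1: "1 \<le> f a" if "a \<in> A'" for a
    using out[OF that] deg[OF hA'(1)[OF that]] d by linarith
  have f2: "a = b" if "a \<in> A'" "b \<in> A'" "f a \<le> 1" "f b \<le> 1" for a b
  proof -
    have "h a = h b"
      using out[OF that(1)] out[OF that(2)] that(3,4) hA'(1)[OF that(1)] hA'(1)[OF that(2)]
      by (intro uniq) auto
    then show ?thesis using h(1) hA'(2)[OF that(1)] hA'(2)[OF that(2)] by (auto simp: inj_on_def)
  qed
  \<comment> \<open>Every vertex of \<open>A'\<close> loses at least one neighbour to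
    \<open>S\<close>, and at most one vertex loses exactly one. These \<open>2 * card A' - 1\<close>
    arcs violate the forest bound, since \<open>B\<^sub>0\<close> is smaller than
    \<open>A'\<close>.\<close>
  have "2 * card A' \<le> (\<Sum>a\<in>A'. f a) + 1"
  proof (cases "\<exists>a\<in>A'. f a \<le> 1")
    case True
    then obtain a where a: "a \<in> A'" "f a \<le> 1" by blast
    have "2 \<le> f b" if "b \<in> A' - {a}" for b
    proof (rule ccontr)
      assume "\<not> 2 \<le> f b"
      then have "b = a" using f2[of b a] that a by auto
      then show False using that by simp
    qed
    then have "(\<Sum>b\<in>A' - {a}. 2) \<le> (\<Sum>b\<in>A' - {a}. f b)" by (intro sum_mono) auto
    then have "2 * (card A' - 1) \<le> (\<Sum>b\<in>A' - {a}. f b)" using a(1) fin by simp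
    moreover have "(\<Sum>b\<in>A'. f b) = f a + (\<Sum>b\<in>A' - {a}. f b)" using fin a(1) by (simp add: sum.remove)
    ultimately show ?thesis using f1[OF a(1)] by linarith
  next
    case False
    then have "(\<Sum>b\<in>A'. 2) \<le> (\<Sum>b\<in>A'. f b)" by (intro sum_mono) force
    then show ?thesis by simp
  qed
  moreover have "(\<Sum>a\<in>A'. f a) = card (P \<inter> A' \<times> B\<^sub>0)"
  proof -
    have "P \<inter> A' \<times> B\<^sub>0 = (SIGMA a:A'. P `` {a} \<inter> B\<^sub>0)" by auto
    then show ?thesis using fin by (simp add: f_def card_SigmaI)
  qed
  moreover have "card (P \<inter> A' \<times> B\<^sub>0) + 1 \<le> card A' + card B\<^sub>0"
  proof (rule one_degenerate_bipartite_arcs[OF fin(1,3) _ sym_P])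
    show "one_degenerate (A' \<union> B\<^sub>0) P"
      by (rule one_degenerate_subset[OF degenerate]) (auto simp: A'_def B\<^sub>0_def)
    show "A' \<inter> B\<^sub>0 = {}" using disjoint_parts by (auto simp: A'_def B\<^sub>0_def)
    show "A' \<union> B\<^sub>0 \<noteq> {}" using A'B0 by auto
  qed
  ultimately show False using A'B0 by linarith
qed

end

text \<open>All that a copy uses at the redirected vertex \<open>v\<close> are arcs to
  \<open>S\<close>. A vertex of \<open>C\<close> outside of the copy is joined to all of
  \<open>S\<close> in \<open>E\<close> and can take its place; it exists because \<open>C\<close> is
  larger than the copy.\<close>

lemma copy_in_of_redirected:
  assumes V: "finite V" and P: "irrefl P" "P \<subseteq> V \<times> V" and E: "sym E"
    and C: "finite C" "C \<subseteq> U" "S \<times> C \<subseteq> E" "card V < card C"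
    and E': "\<And>a b. (a, b) \<in> E' \<Longrightarrow> a \<noteq> v \<Longrightarrow> b \<noteq> v \<Longrightarrow> (a, b) \<in> E" "E' `` {v} \<subseteq> S" "sym E'"
    and cp: "copy_in V P U E'"
  shows "copy_in V P U E"
proof -
  obtain h where h: "inj_on h V" "\<And>t. t \<in> V \<Longrightarrow> h t \<in> U" "\<And>s t. (s, t) \<in> P \<Longrightarrow> (h s, h t) \<in> E'"
    using copy_inD[OF cp] by blast
  have "card (h ` V) < card C" using C(4) card_image_le[OF V, of h] by linarith
  then obtain v' where v': "v' \<in> C" "v' \<notin> h ` V"
    using V C(1) by (metis card_mono finite_imageI leD subsetI)
  define g where "g t = (if h t = v then v' else h t)" for t
  show ?thesis
  proof (rule copy_inI[of g])
    show "inj_on g V"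
    proof (rule inj_onI)
      fix s t assume st: "s \<in> V" "t \<in> V" "g s = g t"
      then have "h s = h t" using v'(2) unfolding g_def by (metis image_eqI)
      then show "s = t" using h(1) st by (simp add: inj_on_def)
    qed
    show "g t \<in> U" if "t \<in> V" for t using that h(2) v'(1) C(2) by (auto simp: g_def)
    show "(g s, g t) \<in> E" if st: "(s, t) \<in> P" for s t
    proof -
      have V2: "s \<in> V" "t \<in> V" "s \<noteq> t" using st P by (auto simp: irrefl_def)
      have hE: "(h s, h t) \<in> E'" "(h t, h s) \<in> E'" using h(3)[OF st] E'(3) by (auto dest: symD)
      have ne: "h s \<noteq> h t" using V2 h(1) by (auto simp: inj_on_def)
      consider "h s = v" | "h t = v" | "h s \<noteq> v" "h t \<noteq> v" by blast
      then show ?thesis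
      proof cases
        case 1
        then have "h t \<in> S" using hE E'(2) by auto
        then show ?thesis using 1 ne v'(1) C(3) E by (auto simp: g_def dest: symD)
      next
        case 2
        then have "h s \<in> S" using hE E'(2) by auto
        then show ?thesis using 2 ne v'(1) C(3) by (auto simp: g_def)
      next
        case 3
        then show ?thesis using hE E'(1) by (auto simp: g_def)
      qed
    qed
  qed
qed

section \<open>Joins with stars\<close>

text \<open>A maximal family \<open>F\<close> of vertices of degree \<open>k\<close> with disjoint
  closed neighbourhoods has at most \<open>q\<close> members, and by maximality every vertex of
  degree \<open>k\<close> is within distance two of \<open>F\<close>. A ball of radius two has at
  most \<open>1 + k + k * (k - 1) = k\<^sup>2 + 1\<close> vertices.\<close>

lemma card_max_degree_vertices:
  assumes R: "finite R" and E: "sym E"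
    and deg: "\<And>v. v \<in> R \<Longrightarrow> card (E `` {v} \<inter> R) \<le> k"
    and F: "\<And>F. F \<subseteq> R \<Longrightarrow> (\<And>v. v \<in> F \<Longrightarrow> card (E `` {v} \<inter> R) = k) \<Longrightarrow>
      (\<And>u v. u \<in> F \<Longrightarrow> v \<in> F \<Longrightarrow> u \<noteq> v \<Longrightarrow>
        insert u (E `` {u} \<inter> R) \<inter> insert v (E `` {v} \<inter> R) = {}) \<Longrightarrow> card F \<le> q"
  shows "card {v \<in> R. card (E `` {v} \<inter> R) = k} \<le> q * (k\<^sup>2 + 1)"
proof -
  define N where "N v = E `` {v} \<inter> R" for v
  define D where "D = {v \<in> R. card (N v) = k}"
  have finN: "finite (N v)" for v using R by (simp add: N_def)
  have fD: "finite D" using R by (simp add: D_def)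
  define fam where "fam F \<longleftrightarrow> F \<subseteq> D \<and>
      (\<forall>u\<in>F. \<forall>v\<in>F. u \<noteq> v \<longrightarrow> insert u (N u) \<inter> insert v (N v) = {})" for F
  have fam0: "fam {}" by (simp add: fam_def)
  have "\<forall>F. fam F \<longrightarrow> card F < Suc (card D)"
    using fD by (auto simp: fam_def less_Suc_eq_le intro: card_mono)
  then obtain F where F1: "fam F" "\<And>G. fam G \<Longrightarrow> card G \<le> card F"
    using ex_has_greatest_nat[of fam "{}" card "Suc (card D)"] fam0 by auto
  have FD: "F \<subseteq> D" "finite F" using F1(1) fD finite_subset by (auto simp: fam_def)
  have Fq: "card F \<le> q"
  proof (rule F)
    show "F \<subseteq> R" using FD by (auto simp: D_def)
    show "card (E `` {v} \<inter> R) = k" if "v \<in> F" for v using that FD by (auto simp: D_def N_def)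
    show "insert u (E `` {u} \<inter> R) \<inter> insert v (E `` {v} \<inter> R) = {}"
      if "u \<in> F" "v \<in> F" "u \<noteq> v" for u v
      using that F1(1) unfolding fam_def N_def by blast
  qed
  \<comment> \<open>The ball of radius two about \<open>f\<close>, grouped by the first step
    \<open>w\<close>. Each group has at most \<open>k\<close> elements, as \<open>w\<close> takes
    the place of \<open>f\<close> among the neighbours of \<open>w\<close>.\<close>
  define Z where "Z f = insert f (\<Union>w\<in>N f. insert w (N w - {f}))" for f
  have "D \<subseteq> (\<Union>f\<in>F. Z f)"
  proof
    fix v assume v: "v \<in> D"
    show "v \<in> (\<Union>f\<in>F. Z f)"
    proof (cases "v \<in> F")
      case True
      then show ?thesis by (auto simp: Z_def)
    next
      case False
      then have "card (insert v F) > card F" using FD by simp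
      then have nf: "\<not> fam (insert v F)" using F1(2) not_less by blast
      have "\<exists>f\<in>F. insert v (N v) \<inter> insert f (N f) \<noteq> {}"
      proof (rule ccontr)
        assume "\<not> ?thesis"
        then have no: "insert v (N v) \<inter> insert f (N f) = {}" "insert f (N f) \<inter> insert v (N v) = {}"
          if "f \<in> F" for f using that by blast+
        have "fam (insert v F)"
          unfolding fam_def
        proof (intro conjI ballI impI)
          show "insert v F \<subseteq> D" using v FD by blast
          fix a b assume ab: "a \<in> insert v F" "b \<in> insert v F" "a \<noteq> b"
          show "insert a (N a) \<inter> insert b (N b) = {}"
          proof (cases "a = v \<or> b = v")
            case True
            then show ?thesis using ab no by auto
          next
            case False
            then show ?thesis using ab F1(1) unfolding fam_def by blast
          qed
        qed
        with nf show False by simp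
      qed
      then obtain f where f: "f \<in> F" "insert v (N v) \<inter> insert f (N f) \<noteq> {}" "v \<noteq> f"
        using False by blast
      then obtain x where x: "x \<in> insert v (N v)" "x \<in> insert f (N f)" by blast
      have vf: "v \<in> R" "f \<in> R" using v f(1) FD by (auto simp: D_def)
      have symN: "a \<in> N b" if "b \<in> N a" "a \<in> R" for a b
        using that E by (auto simp: N_def dest: symD)
      have "v \<in> Z f"
      proof (cases "x = v")
        case True
        then show ?thesis using x(2) f(3) by (auto simp: Z_def)
      next
        case False
        then have "v \<in> N x" using x(1) symN vf by blast
        then show ?thesis using x(2) f(3) by (cases "x = f") (auto simp: Z_def)
      qed
      then show ?thesis using f(1) by blast
    qed
  qed
  then have "card D \<le> card (\<Union>f\<in>F. Z f)"
    using FD finN by (intro card_mono) (auto simp: Z_def)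
  also have "\<dots> \<le> (\<Sum>f\<in>F. card (Z f))" using FD by (intro card_UN_le) auto
  also have "\<dots> \<le> (\<Sum>f\<in>F. k\<^sup>2 + 1)"
  proof (rule sum_mono)
    fix f assume f: "f \<in> F"
    have fR: "f \<in> R" and cN: "card (N f) = k" using f FD by (auto simp: D_def)
    have "card (insert w (N w - {f})) \<le> k" if "w \<in> N f" for w
    proof -
      have "f \<in> N w" "w \<in> R" using that fR E by (auto simp: N_def dest: symD)
      then have "card (N w - {f}) = card (N w) - 1" "card (N w) \<noteq> 0"
        using finN by auto
      moreover have "card (N w) \<le> k" using deg \<open>w \<in> R\<close> by (simp add: N_def)
      moreover have "card (insert w (N w - {f})) \<le> Suc (card (N w - {f}))"
        by (rule card_insert_le_m1) simp_all
      ultimately show ?thesis by linarith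
    qed
    then have "(\<Sum>w\<in>N f. card (insert w (N w - {f}))) \<le> (\<Sum>w\<in>N f. k)" by (rule sum_mono)
    moreover have "card (\<Union>w\<in>N f. insert w (N w - {f})) \<le> (\<Sum>w\<in>N f. card (insert w (N w - {f})))"
      using finN by (intro card_UN_le)
    moreover have "card (Z f) \<le> Suc (card (\<Union>w\<in>N f. insert w (N w - {f})))"
      unfolding Z_def by (rule card_insert_le_m1) simp_all
    ultimately show "card (Z f) \<le> k\<^sup>2 + 1" using cN by (simp add: power2_eq_square)
  qed
  also have "\<dots> \<le> q * (k\<^sup>2 + 1)" using mult_le_mono1[OF Fq, of "k\<^sup>2 + 1"] by simp
  finally show ?thesis by (simp add: D_def N_def)
qed

section \<open>The template: isolated vertices joined to disjoint stars\<close>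

lemma parcs_star: "parcs (star d) = Inl ` {0..<1} \<times> Inr ` {0..<d - 1} \<union> Inr ` {0..<d - 1} \<times> Inl ` {0..<1}"
  and pverts_star: "pverts (star d) = {0..<1} <+> {0..<d - 1}"
  by (simp_all add: star_def complete_bipartite_graph_def join_def edgeless_graph_def)

lemma card_star_nbrs:
  assumes "2 \<le> d"
  shows "card (parcs (star d) `` {x}) \<le> d - 1"
proof (cases x)
  case (Inl i)
  then have "parcs (star d) `` {x} \<subseteq> Inr ` {0..<d - 1}" by (auto simp: parcs_star)
  then have "card (parcs (star d) `` {x}) \<le> card (Inr ` {0..<d - 1} :: (nat + nat) set)"
    by (intro card_mono) auto
  then show ?thesis by (simp add: card_image)
next
  case (Inr i)
  then have "parcs (star d) `` {x} \<subseteq> {Inl 0}" by (auto simp: parcs_star)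
  then have "card (parcs (star d) `` {x}) \<le> card {Inl 0 :: nat + nat}"
    by (intro card_mono) auto
  then show ?thesis using assms by simp
qed

lemma pair_wf_digraph_join:
  assumes "pair_wf_digraph G" "pair_wf_digraph H"
  shows "pair_wf_digraph (join G H)"
proof -
  interpret G: pair_wf_digraph G by fact
  interpret H: pair_wf_digraph H by fact
  show ?thesis
    by unfold_locales (auto simp: join_def dest: G.in_arcsD1 G.in_arcsD2 H.in_arcsD1 H.in_arcsD2)
qed

lemma pair_wf_digraph_edgeless_graph: "pair_wf_digraph (edgeless_graph n)"
  by unfold_locales (auto simp: edgeless_graph_def)

lemma pair_wf_digraph_disjoint_copies:
  assumes "pair_wf_digraph G"
  shows "pair_wf_digraph (disjoint_copies k G)"
proof -
  interpret G: pair_wf_digraph G by fact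
  show ?thesis
    by unfold_locales (auto simp: disjoint_copies_def dest: G.in_arcsD1 G.in_arcsD2)
qed

lemma pair_wf_digraph_star: "pair_wf_digraph (star d)"
  unfolding star_def complete_bipartite_graph_def
  by (intro pair_wf_digraph_join pair_wf_digraph_edgeless_graph)

abbreviation (input) join_stars :: "nat \<Rightarrow> nat \<Rightarrow> nat \<Rightarrow> (nat + nat \<times> (nat + nat)) pair_pre_digraph" where
  "join_stars l m d \<equiv> join (edgeless_graph l) (disjoint_copies m (star d))"

lemma pverts_join_stars:
  "pverts (join_stars l m d) = {0..<l} <+> {0..<m} \<times> ({0..<1} <+> {0..<d - 1})"
  by (simp add: join_def edgeless_graph_def disjoint_copies_def pverts_star)

lemma parcs_join_stars_cases:
  assumes "(x, y) \<in> parcs (join_stars l m d)"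
  obtains (copy) i u v where "x = Inr (i, u)" "y = Inr (i, v)" "i < m" "(u, v) \<in> parcs (star d)"
  | (left) i p where "x = Inl i" "y = Inr p" "i < l" "p \<in> {0..<m} \<times> pverts (star d)"
  | (right) i p where "x = Inr p" "y = Inl i" "i < l" "p \<in> {0..<m} \<times> pverts (star d)"
  using assms by (auto simp: join_def edgeless_graph_def disjoint_copies_def)

lemma embeddable_iff_copy_in:
  assumes "pair_wf_digraph T" "pair_wf_digraph G"
  shows "embeddable T G \<longleftrightarrow> copy_in (pverts T) (parcs T) (pverts G) (parcs G)"
  unfolding embeddable_iff[OF assms] copy_in_def by fast

text \<open>The vertices in \<open>F\<close> become centres, with leaves chosen among their
  neighbours in \<open>R\<close>; disjointness of the closed neighbourhoods keeps the stars
  apart.\<close>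

lemma copy_in_join_stars:
  assumes S: "S \<subseteq> U" "card S = l" "finite S" and R: "R \<subseteq> U" "finite R" "S \<inter> R = {}" "S \<times> R \<subseteq> E"
    and E: "sym E" "irrefl E"
    and F: "F \<subseteq> R" "m \<le> card F" "\<And>v. v \<in> F \<Longrightarrow> d - 1 \<le> card (E `` {v} \<inter> R)"
      "\<And>u v. u \<in> F \<Longrightarrow> v \<in> F \<Longrightarrow> u \<noteq> v \<Longrightarrow>
        insert u (E `` {u} \<inter> R) \<inter> insert v (E `` {v} \<inter> R) = {}"
  shows "copy_in (pverts (join_stars l m d)) (parcs (join_stars l m d)) U E"
proof -
  obtain s where s: "bij_betw s {0..<l} S"
    using finite_same_card_bij[of "{0..<l}" S] S by auto
  have "finite F" using F(1) R(2) finite_subset by blast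
  then obtain c where c: "inj_on c {0..<m}" "c ` {0..<m} \<subseteq> F"
    using card_le_inj[of "{0..<m}" F] F(2) by auto
  have "\<exists>g. inj_on g {0..<d - 1} \<and> g ` {0..<d - 1} \<subseteq> E `` {v} \<inter> R" if "v \<in> F" for v
    using card_le_inj[of "{0..<d - 1}" "E `` {v} \<inter> R"] F(3)[OF that] R(2) by auto
  then obtain g where g: "\<And>v. v \<in> F \<Longrightarrow> inj_on (g v) {0..<d - 1}"
      "\<And>v. v \<in> F \<Longrightarrow> g v ` {0..<d - 1} \<subseteq> E `` {v} \<inter> R" by metis
  define q where "q p = (case snd p of Inl _ \<Rightarrow> c (fst p) | Inr j \<Rightarrow> g (c (fst p)) j)" for p :: "nat \<times> (nat + nat)"
  have cF: "c i \<in> F" if "i < m" for i using that c(2) by auto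
  have gN: "g (c i) j \<in> E `` {c i} \<inter> R" if "i < m" "j < d - 1" for i j
  proof -
    have "g (c i) j \<in> g (c i) ` {0..<d - 1}" using that by (intro imageI) simp
    then show ?thesis using g(2)[OF cF[OF that(1)]] by blast
  qed
  have q_mem: "q p \<in> insert (c (fst p)) (E `` {c (fst p)} \<inter> R)" "q p \<in> R"
    if "p \<in> {0..<m} \<times> pverts (star d)" for p
    using that gN cF F(1) by (auto simp: q_def pverts_star split: sum.splits)
  have q_inj: "inj_on q ({0..<m} \<times> pverts (star d))"
  proof (rule inj_onI)
    fix p p' assume p: "p \<in> {0..<m} \<times> pverts (star d)" "p' \<in> {0..<m} \<times> pverts (star d)" "q p = q p'"
    have lt: "fst p < m" "fst p' < m" using p by auto
    have "c (fst p) = c (fst p')"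
    proof (rule ccontr)
      assume "c (fst p) \<noteq> c (fst p')"
      from F(4)[OF cF[OF lt(1)] cF[OF lt(2)] this] show False
        using q_mem(1)[OF p(1)] q_mem(1)[OF p(2)] unfolding p(3) by blast
    qed
    then have f: "fst p = fst p'" using c(1) lt by (auto simp: inj_on_def)
    have ne: "g (c i) j \<noteq> c i" if "i < m" "j < d - 1" for i j
      using gN[OF that] E(2) by (auto simp: irrefl_def)
    have "snd p = snd p'"
    proof (cases "snd p"; cases "snd p'")
      fix i j assume ij: "snd p = Inl i" "snd p' = Inl j"
      then show ?thesis using p(1,2) by (auto simp: pverts_star)
    next
      fix i j assume ij: "snd p = Inl i" "snd p' = Inr j"
      have "j < d - 1" using p(2) ij by (auto simp: pverts_star)
      from ne[OF lt(1) this] show ?thesis using p(3) ij f by (auto simp: q_def)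
    next
      fix i j assume ij: "snd p = Inr i" "snd p' = Inl j"
      then have "i < d - 1" using p(1) by (auto simp: pverts_star)
      then show ?thesis using ne[OF lt(1)] p(3) ij f by (auto simp: q_def)
    next
      fix i j assume ij: "snd p = Inr i" "snd p' = Inr j"
      then have "i < d - 1" "j < d - 1" using p(1,2) by (auto simp: pverts_star)
      moreover have "g (c (fst p)) i = g (c (fst p)) j" using p(3) ij f by (simp add: q_def)
      ultimately have "i = j" using g(1)[OF cF[OF lt(1)]] by (simp add: inj_on_def)
      then show ?thesis using ij by simp
    qed
    with f show "p = p'" by (rule prod_eqI)
  qed
  show ?thesis
  proof (rule copy_inI[of "case_sum s q"])
    have sS: "s i \<in> S" if "i < l" for i using s that by (auto simp: bij_betw_def)
    show "inj_on (case_sum s q) (pverts (join_stars l m d))"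
      unfolding pverts_join_stars
    proof (rule inj_onI)
      fix x y :: "nat + nat \<times> (nat + nat)"
      assume xy: "x \<in> {0..<l} <+> {0..<m} \<times> ({0..<1} <+> {0..<d - 1})"
        "y \<in> {0..<l} <+> {0..<m} \<times> ({0..<1} <+> {0..<d - 1})" "case_sum s q x = case_sum s q y"
      have no: "s i \<noteq> q p" if "i < l" "p \<in> {0..<m} \<times> pverts (star d)" for i p
        using sS[OF that(1)] q_mem(2)[OF that(2)] R(3) by auto
      show "x = y"
        using xy(1)
      proof (elim PlusE)
        fix i assume i: "x = Inl i" "i \<in> {0..<l}"
        show ?thesis
          using xy(2)
        proof (elim PlusE)
          fix j assume "y = Inl j" "j \<in> {0..<l}"
          then show ?thesis using xy(3) i s by (auto simp: bij_betw_def inj_on_def)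
        next
          fix p assume "y = Inr p" "p \<in> {0..<m} \<times> ({0..<1} <+> {0..<d - 1})"
          then show ?thesis using xy(3) i no[of i p] by (simp add: pverts_star)
        qed
      next
        fix p assume p: "x = Inr p" "p \<in> {0..<m} \<times> ({0..<1} <+> {0..<d - 1})"
        show ?thesis
          using xy(2)
        proof (elim PlusE)
          fix i assume "y = Inl i" "i \<in> {0..<l}"
          then show ?thesis using xy(3) p no[of i p] by (simp add: pverts_star)
        next
          fix p' assume "y = Inr p'" "p' \<in> {0..<m} \<times> ({0..<1} <+> {0..<d - 1})"
          then show ?thesis using xy(3) p inj_onD[OF q_inj, of p p'] by (simp add: pverts_star)
        qed
      qed
    qed
    show "case_sum s q x \<in> U" if "x \<in> pverts (join_stars l m d)" for x
      using that q_mem(2) sS S(1) R(1) unfolding pverts_join_stars pverts_star[symmetric] by auto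
    show "(case_sum s q x, case_sum s q y) \<in> E" if "(x, y) \<in> parcs (join_stars l m d)" for x y
      using that
    proof (cases rule: parcs_join_stars_cases)
      case (copy i u v)
      have "(c i, g (c i) j) \<in> E \<and> (g (c i) j, c i) \<in> E" if "j < d - 1" for j
        using gN[OF copy(3) that] E(1) by (auto dest: symD)
      then show ?thesis using copy by (auto simp: parcs_star q_def)
    next
      case (left i p)
      then show ?thesis using sS[of i] q_mem(2)[of p] R(4) by auto
    next
      case (right i p)
      then have "(s i, q p) \<in> E" using sS[of i] q_mem(2)[of p] R(4) by auto
      then show ?thesis using right E(1) by (auto dest: symD)
    qed
  qed
qed

lemma out_degree_eq_card_nbrs: "out_degree (with_proj G) v = card (parcs G `` {v})"
proof -
  have "out_arcs (with_proj G) v = Pair v ` (parcs G `` {v})"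
    by (auto simp: out_arcs_def)
  then show ?thesis by (simp add: out_degree_def card_image inj_on_def)
qed

text \<open>Embeddability also settles the degenerate parameters. Minimum degree \<open>0\<close>
  would reduce the tree to one vertex, against \<open>card A \<le> card B\<close>. For
  \<open>d = 1\<close> the template is bipartite with one side of size \<open>l\<close>, too small
  for either part. For \<open>l = 0\<close> it has maximum degree at most \<open>d - 1\<close>,
  while vertices of \<open>A\<close> have degree at least \<open>d\<close>.\<close>

lemma tree_class_parts:
  assumes T: "T \<in> tree_class m (l + 1) d" and J: "embeddable T (join_stars l m d)"
  obtains A B where "tree_parts (parcs T) A B l m d" "A \<union> B = pverts T" "1 \<le> l" "2 \<le> d"
    "copy_in (A \<union> B) (parcs T) (pverts (join_stars l m d)) (parcs (join_stars l m d))"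
proof -
  from T obtain A B where AB: "undirected_tree T" "card (pverts T) = m" "bipartition T A B"
    "card A \<le> card B" "card A = l + 1" "Min (out_degree (with_proj T) ` A) = d"
    unfolding tree_class_def by blast
  interpret pair_graph T using AB(1) by (simp add: undirected_tree_def)
  have symP: "sym (parcs T)" using pair_sym_arcs by (simp add: symmetric_def)
  have VAB: "A \<union> B = pverts T" "A \<inter> B = {}" "parcs T \<subseteq> A \<times> B \<union> B \<times> A"
    using AB(3) by (simp_all add: bipartition_def)
  have fin: "finite A" "finite B" using VAB(1) pair_finite_verts by (metis finite_Un)+
  have neA: "A \<noteq> {}" using AB(5) by auto
  have dimg: "d \<in> (\<lambda>a. card (parcs T `` {a})) ` A"
    and dmin: "\<And>a. a \<in> A \<Longrightarrow> d \<le> card (parcs T `` {a})"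
    using AB(6) Min_in[of "(\<lambda>a. card (parcs T `` {a})) ` A"] Min_le[of "(\<lambda>a. card (parcs T `` {a})) ` A"]
      fin neA by (auto simp: out_degree_eq_card_nbrs)
  have tp: "tree_parts (parcs T) A B l m d"
  proof
    show "card A + card B = m" using card_Un_disjoint[OF fin VAB(2)] VAB(1) AB(2) by simp
    show "\<exists>a\<in>A. card (parcs T `` {a}) = d" using dimg by auto
  qed (use fin one_degenerate_tree[OF AB(1)] symP VAB AB(5) dmin in simp_all)
  have cp: "copy_in (A \<union> B) (parcs T) (pverts (join_stars l m d)) (parcs (join_stars l m d))"
    unfolding VAB(1)
    by (intro iffD1[OF embeddable_iff_copy_in, OF _ _ J] pair_wf_digraph_join pair_wf_digraph_edgeless_graph
        pair_wf_digraph_disjoint_copies pair_wf_digraph_star pair_wf_digraph_axioms)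
  from copy_inD[OF cp] obtain h where h: "inj_on h (A \<union> B)"
    "\<And>t. t \<in> A \<union> B \<Longrightarrow> h t \<in> pverts (join_stars l m d)"
    "\<And>s t. (s, t) \<in> parcs T \<Longrightarrow> (h s, h t) \<in> parcs (join_stars l m d)" by blast
  obtain a where a: "a \<in> A" "card (parcs T `` {a}) = d" using dimg by auto
  have d0: "d \<noteq> 0"
  proof
    assume "d = 0"
    moreover have "finite (parcs T `` {a})" using pair_finite_arcs by (rule finite_Image)
    ultimately have "parcs T `` {a} = {}" using a(2) by simp
    then have "{a} = pverts T"
      using a(1) VAB(1) by (intro undirected_tree_closed_set[OF AB(1)]) auto
    then have "card B \<le> 0" using VAB a(1) by (metis Un_upper2 card.empty disjoint_iff insert_absorb le_zero_eq subset_singletonD singletonI)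
    then show False using AB(4,5) by simp
  qed
  have inl_le: "card X \<le> l" if "X \<subseteq> A \<union> B" "\<And>x. x \<in> X \<Longrightarrow> isl (h x)" for X
  proof -
    have "h ` X \<subseteq> Inl ` {0..<l}"
      using that h(2) unfolding pverts_join_stars by (fastforce simp: isl_def)
    moreover have "card (h ` X) = card X" using h(1) that(1) by (meson card_image inj_on_subset)
    ultimately have "card X \<le> card (Inl ` {0..<l} :: (nat + nat \<times> (nat + nat)) set)"
      by (metis card_mono finite_atLeastLessThan finite_imageI)
    then show ?thesis by (simp add: card_image)
  qed
  have d1: "d \<noteq> 1"
  proof
    assume "d = 1"
    \<comment> \<open>\<open>W\<close> records where the bipartition of the tree agrees with the
      sides of the template. Every arc changes side in both, so \<open>W\<close> is empty or
      everything, and one part lies within the \<open>l\<close> vertices on the left.\<close>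
    define W where "W = {t \<in> A. isl (h t)} \<union> {t \<in> B. \<not> isl (h t)}"
    have swap: "isl (h s) \<longleftrightarrow> \<not> isl (h t)" if "(s, t) \<in> parcs T" for s t
      using h(3)[OF that] by (cases rule: parcs_join_stars_cases) (auto simp: parcs_star \<open>d = 1\<close>)
    have "W = {} \<or> W = pverts T"
    proof (rule disjCI)
      assume "W \<noteq> pverts T"
      moreover have "t \<in> W" if "(s, t) \<in> parcs T" "s \<in> W" for s t
        using that swap[OF that(1)] VAB(2,3) unfolding W_def by blast
      moreover have "W \<subseteq> pverts T" using VAB(1) by (auto simp: W_def)
      ultimately show "W = {}" using undirected_tree_closed_set[OF AB(1), of W] by blast
    qed
    then show False
    proof
      assume "W = {}"
      then have "card B \<le> l" by (intro inl_le) (auto simp: W_def)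
      then show False using AB(4,5) by simp
    next
      assume "W = pverts T"
      then have "A \<subseteq> W" using VAB(1) by blast
      then have "card A \<le> l" using VAB(2) by (intro inl_le) (auto simp: W_def)
      then show False using AB(5) by simp
    qed
  qed
  have l0: "l \<noteq> 0"
  proof
    assume l: "l = 0"
    then obtain p where p: "h a = Inr p" using h(2)[of a] a(1) unfolding pverts_join_stars by auto
    have nB: "parcs T `` {a} \<subseteq> A \<union> B" using VAB(3) by auto
    have "h ` (parcs T `` {a}) \<subseteq> (\<lambda>u. Inr (fst p, u)) ` (parcs (star d) `` {snd p})"
    proof
      fix y assume "y \<in> h ` (parcs T `` {a})"
      then have "(h a, y) \<in> parcs (join_stars l m d)" using h(3) by auto
      then show "y \<in> (\<lambda>u. Inr (fst p, u)) ` (parcs (star d) `` {snd p})"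
        by (cases rule: parcs_join_stars_cases) (auto simp: l p)
    qed
    then have "card (h ` (parcs T `` {a})) \<le>
        card ((\<lambda>u. Inr (fst p, u) :: nat + nat \<times> (nat + nat)) ` (parcs (star d) `` {snd p}))"
      by (intro card_mono) (auto simp: parcs_star)
    also have "\<dots> \<le> card (parcs (star d) `` {snd p})"
      by (intro card_image_le) (auto simp: parcs_star)
    also have "\<dots> \<le> d - 1" using d0 d1 by (intro card_star_nbrs) simp
    also have "card (h ` (parcs T `` {a})) = d"
      using a(2) h(1) nB by (metis card_image inj_on_subset)
    finally show False using d0 by simp
  qed
  show thesis using that[OF tp VAB(1) _ _ cp] l0 d0 d1 by simp
qed

section \<open>The largest eigenvalue as a maximum of the Rayleigh quotient\<close>

text \<open>The bilinear form of the adjacency matrix; for equal arguments each edge counts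
  twice.\<close>

definition arc_form :: "'a rel \<Rightarrow> ('a \<Rightarrow> real) \<Rightarrow> ('a \<Rightarrow> real) \<Rightarrow> real" where
  "arc_form E x y = (\<Sum>(u, v)\<in>E. x u * y v)"

lemma arc_form_commute: "sym E \<Longrightarrow> arc_form E x y = arc_form E y x"
  unfolding arc_form_def
  by (rule sum.reindex_bij_witness[of _ prod.swap prod.swap]) (auto dest: symD)

lemma arc_form_eq_sum:
  assumes "finite V" "E \<subseteq> V \<times> V"
  shows "arc_form E x y = (\<Sum>v\<in>V. x v * (\<Sum>w\<in>E `` {v}. y w))"
proof -
  have "E = (SIGMA v:V. E `` {v})" using assms(2) by auto
  then have "arc_form E x y = (\<Sum>(u, v)\<in>(SIGMA v:V. E `` {v}). x u * y v)"
    by (simp add: arc_form_def)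
  also have "\<dots> = (\<Sum>v\<in>V. \<Sum>w\<in>E `` {v}. x v * y w)"
    using assms(1) finite_subset[OF _ assms(1), of "E `` {v}" for v] assms(2)
    by (intro sum.Sigma[symmetric]) blast+
  finally show ?thesis by (simp add: sum_distrib_left)
qed

lemma arc_form_add_left: "arc_form E (\<lambda>v. x v + x' v) y = arc_form E x y + arc_form E x' y"
  unfolding arc_form_def by (simp add: sum.distrib distrib_right case_prod_unfold)

lemma arc_form_scale: "arc_form E (\<lambda>v. c * x v) (\<lambda>v. c' * y v) = c * c' * arc_form E x y"
  unfolding arc_form_def by (simp add: sum_distrib_left case_prod_unfold algebra_simps)

lemma arc_form_cong:
  "E \<subseteq> V \<times> V \<Longrightarrow> (\<And>v. v \<in> V \<Longrightarrow> x v = x' v \<and> y v = y' v) \<Longrightarrow> arc_form E x y = arc_form E x' y'"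
  unfolding arc_form_def by (rule sum.cong) auto

lemma quadratic_nonneg_imp_linear_zero:
  fixes a b :: real
  assumes "\<And>t. 0 \<le> 2 * t * a + t\<^sup>2 * b"
  shows "a = 0"
proof (rule ccontr)
  assume a: "a \<noteq> 0"
  define c where "c = \<bar>b\<bar> + 1"
  have c: "c > 0" "b - 2 * c < 0" by (simp_all add: c_def)
  have "0 \<le> 2 * (- a / c) * a + (- a / c)\<^sup>2 * b" by (rule assms)
  also have "\<dots> = (a / c)\<^sup>2 * (b - 2 * c)"
    using c by (simp add: field_simps power2_eq_square)
  also have "\<dots> < 0" using a c by (intro mult_pos_neg) auto
  finally show False by simp
qed

text \<open>First-order optimality: moving \<open>x\<close> along the unit vector at
  \<open>v\<close> cannot lift the quotient above \<open>\<mu>\<close>, so the linear coefficient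
  vanishes. Stating it for any vector that attains the bound allows a second use after the arc set
  has been changed.\<close>

lemma arc_form_maximiser_eigenvector:
  assumes V: "finite V" "E \<subseteq> V \<times> V" "sym E"
    and max: "\<And>y. arc_form E y y \<le> \<mu> * (\<Sum>v\<in>V. (y v)\<^sup>2)"
    and eq: "arc_form E x x = \<mu> * (\<Sum>v\<in>V. (x v)\<^sup>2)" and v: "v \<in> V"
  shows "(\<Sum>w\<in>E `` {v}. x w) = \<mu> * x v"
proof -
  define e :: "'a \<Rightarrow> real" where "e u = (if u = v then 1 else 0)" for u
  define s where "s = (\<Sum>w\<in>E `` {v}. x w)"
  have ex: "arc_form E e x = s"
    using v V(1) by (simp add: arc_form_eq_sum[OF V(1,2)] e_def s_def if_distrib[of "\<lambda>c. c * _"] cong: if_cong)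
  have "0 \<le> 2 * t * (\<mu> * x v - s) + t\<^sup>2 * (\<mu> - arc_form E e e)" for t
  proof -
    let ?y = "\<lambda>u. x u + t * e u"
    have te: "arc_form E (\<lambda>u. t * e u) x = t * s" for t
      using arc_form_scale[of E t e 1 x] by (simp add: ex)
    have tt: "arc_form E (\<lambda>u. t * e u) (\<lambda>u. t * e u) = t\<^sup>2 * arc_form E e e"
      using arc_form_scale[of E t e t e] by (simp add: power2_eq_square)
    have "arc_form E ?y ?y = arc_form E x ?y + arc_form E (\<lambda>u. t * e u) ?y"
      by (rule arc_form_add_left)
    also have "arc_form E x ?y = arc_form E x x + t * s"
      unfolding arc_form_commute[OF V(3), of x ?y] arc_form_add_left te by (rule refl)
    also have "arc_form E (\<lambda>u. t * e u) ?y = t * s + t\<^sup>2 * arc_form E e e"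
      unfolding arc_form_commute[OF V(3), of _ ?y] arc_form_add_left
        arc_form_commute[OF V(3), of x "\<lambda>u. t * e u"] te tt by (rule refl)
    finally have 1: "arc_form E ?y ?y = arc_form E x x + 2 * t * s + t\<^sup>2 * arc_form E e e" by simp
    have "(\<Sum>u\<in>V. (?y u)\<^sup>2) = (\<Sum>u\<in>V. (x u)\<^sup>2 + (2 * t * x u + t\<^sup>2) * e u)"
      by (intro sum.cong) (auto simp: e_def power2_eq_square algebra_simps)
    also have "\<dots> = (\<Sum>u\<in>V. (x u)\<^sup>2) + 2 * t * x v + t\<^sup>2"
      using v V(1) by (simp add: sum.distrib e_def if_distrib[of "\<lambda>c. _ * c"] cong: if_cong)
    finally have "(\<Sum>u\<in>V. (?y u)\<^sup>2) = (\<Sum>u\<in>V. (x u)\<^sup>2) + 2 * t * x v + t\<^sup>2" .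
    with max[of ?y] 1 eq show ?thesis by (simp add: algebra_simps)
  qed
  then have "\<mu> * x v - s = 0" by (rule quadratic_nonneg_imp_linear_zero)
  then show ?thesis by (simp add: s_def)
qed

text \<open>Compactness yields a maximiser on the unit sphere and homogeneity extends the bound to
  all vectors. Passing to absolute values preserves maximality because the form has non-negative
  coefficients.\<close>

lemma arc_form_attains_max:
  fixes V :: "'a set"
  assumes V: "finite V" "V \<noteq> {}" "E \<subseteq> V \<times> V"
  obtains x :: "'a \<Rightarrow> real" and \<mu> where "(\<Sum>v\<in>V. (x v)\<^sup>2) = 1" "arc_form E x x = \<mu>" "\<And>v. 0 \<le> x v"
    "\<And>y. arc_form E y y \<le> \<mu> * (\<Sum>v\<in>V. (y v)\<^sup>2)"
proof -
  \<comment> \<open>Vectors are functions on the whole type. Fixing the coordinates outside of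
    \<open>V\<close> at \<open>0\<close> and bounding the others gives a product of compact
    sets.\<close>
  define S where "S v = (if v \<in> V then {-1..1} else {0::real})" for v
  define K where "K = PiE UNIV S \<inter> {x. (\<Sum>v\<in>V. (x v)\<^sup>2) = 1}"
  have finE: "finite E" using V finite_subset by blast
  have "compactin (product_topology (\<lambda>_. euclidean) UNIV) (PiE UNIV S)"
    unfolding compactin_PiE by (auto simp: S_def)
  then have "compact (PiE UNIV S)" by (simp add: euclidean_product_topology)
  moreover have "closed {x::'a \<Rightarrow> real. (\<Sum>v\<in>V. (x v)\<^sup>2) = 1}"
    by (intro closed_Collect_eq continuous_intros continuous_on_product_coordinates)
  ultimately have cK: "compact K" unfolding K_def by (rule compact_Int_closed)
  have cont: "continuous_on K (\<lambda>x. arc_form E x x)"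
    unfolding arc_form_def case_prod_unfold
    by (intro continuous_intros continuous_on_product_coordinates[THEN continuous_on_subset]) auto
  have memK: "(\<lambda>v. if v \<in> V then x v else 0) \<in> K" if "(\<Sum>v\<in>V. (x v)\<^sup>2) = 1" for x :: "'a \<Rightarrow> real"
  proof -
    have "\<bar>x v\<bar> \<le> 1" if "v \<in> V" for v
    proof -
      have "(x v)\<^sup>2 \<le> (\<Sum>v\<in>V. (x v)\<^sup>2)" using that V(1) by (intro member_le_sum) auto
      then show ?thesis using \<open>(\<Sum>v\<in>V. (x v)\<^sup>2) = 1\<close> by (simp add: abs_square_le_1)
    qed
    then show ?thesis using that by (auto simp: K_def S_def abs_le_iff)
  qed
  obtain v0 where "v0 \<in> V" using V(2) by blast
  then have "(\<Sum>v\<in>V. (if v = v0 then 1 else 0 :: real)\<^sup>2) = 1"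
    using V(1) by (simp add: if_distrib[of "\<lambda>c. c\<^sup>2"] cong: if_cong)
  from memK[OF this] have "K \<noteq> {}" by blast
  from continuous_attains_sup[OF cK this cont] obtain z
    where z: "z \<in> K" "\<And>y. y \<in> K \<Longrightarrow> arc_form E y y \<le> arc_form E z z" by blast
  define \<mu> where "\<mu> = arc_form E z z"
  have max1: "arc_form E y y \<le> \<mu>" if "(\<Sum>v\<in>V. (y v)\<^sup>2) = 1" for y
    using z(2)[OF memK[OF that]] arc_form_cong[OF V(3), of y "\<lambda>v. if v \<in> V then y v else 0"
        y "\<lambda>v. if v \<in> V then y v else 0"] by (simp add: \<mu>_def)
  have max: "arc_form E y y \<le> \<mu> * (\<Sum>v\<in>V. (y v)\<^sup>2)" for y
  proof (cases "(\<Sum>v\<in>V. (y v)\<^sup>2) = 0")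
    case True
    then have "y v = 0" if "v \<in> V" for v using that V(1) by (simp add: sum_nonneg_eq_0_iff)
    then have "arc_form E y y = arc_form E (\<lambda>_. 0) (\<lambda>_. 0)" by (intro arc_form_cong[OF V(3)]) simp
    then show ?thesis using True by (simp add: arc_form_def)
  next
    case False
    define N where "N = (\<Sum>v\<in>V. (y v)\<^sup>2)"
    have N: "N > 0" using False by (simp add: N_def less_le sum_nonneg)
    define c where "c = inverse (sqrt N)"
    have cc: "c * c = inverse N" using N by (simp add: c_def flip: inverse_mult_distrib)
    have "(\<Sum>v\<in>V. (c * y v)\<^sup>2) = c\<^sup>2 * N"
      by (simp add: N_def power_mult_distrib sum_distrib_left)
    then have "arc_form E (\<lambda>v. c * y v) (\<lambda>v. c * y v) \<le> \<mu>"
      using cc N by (intro max1) (simp add: power2_eq_square)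
    then have "inverse N * arc_form E y y \<le> \<mu>" by (simp add: arc_form_scale cc)
    then show ?thesis using N by (simp add: N_def[symmetric] field_simps)
  qed
  define x where "x v = \<bar>z v\<bar>" for v
  have x1: "(\<Sum>v\<in>V. (x v)\<^sup>2) = 1" using z(1) by (simp add: K_def x_def)
  have "\<mu> \<le> arc_form E x x"
    unfolding \<mu>_def arc_form_def
    by (rule sum_mono) (auto simp: x_def abs_mult[symmetric])
  then have x2: "arc_form E x x = \<mu>" using max1[OF x1] by simp
  show thesis by (rule that[OF x1 x2 _ max]) (simp add: x_def)
qed

lemma adjacency_matrix_mult_vec:
  assumes "pverts G = {0..<n}" "parcs G \<subseteq> {0..<n} \<times> {0..<n}" "i < n" "v \<in> carrier_vec n"
  shows "(adjacency_matrix G *\<^sub>v v) $ i = (\<Sum>j\<in>parcs G `` {i}. v $ j)"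
proof -
  have "(adjacency_matrix G *\<^sub>v v) $ i = (\<Sum>j\<in>{0..<n}. (if (i, j) \<in> parcs G then 1 else 0) * v $ j)"
    using assms by (simp add: adjacency_matrix_def Let_def scalar_prod_def)
  also have "\<dots> = (\<Sum>j\<in>{0..<n}. if j \<in> parcs G `` {i} then v $ j else 0)"
    by (intro sum.cong) auto
  also have "\<dots> = (\<Sum>j\<in>{0..<n} \<inter> parcs G `` {i}. v $ j)" by (simp add: sum.inter_restrict)
  also have "{0..<n} \<inter> parcs G `` {i} = parcs G `` {i}" using assms(2) by auto
  finally show ?thesis .
qed

text \<open>The maximum of the quotient is an eigenvalue, and every eigenvalue is the quotient of
  its own eigenvector, hence no larger. The Perron vector is set to \<open>0\<close> beyond the
  vertices so that its bounds hold for all arguments.\<close>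

lemma largest_eigenvalue_rayleigh:
  assumes G: "pverts G = {0..<n}" "parcs G \<subseteq> {0..<n} \<times> {0..<n}" "sym (parcs G)" and n: "n > 0"
  shows "arc_form (parcs G) y y \<le> largest_eigenvalue G * (\<Sum>v\<in>{0..<n}. (y v)\<^sup>2)"
    and "\<exists>x. (\<forall>v. 0 \<le> x v \<and> x v \<le> 1) \<and> (\<exists>u<n. x u = 1) \<and>
      (\<forall>v<n. (\<Sum>w\<in>parcs G `` {v}. x w) = largest_eigenvalue G * x v)"
proof -
  let ?A = "adjacency_matrix G" and ?V = "{0..<n}"
  have A: "?A \<in> carrier_mat n n" using G(1) by (simp add: adjacency_matrix_def)
  obtain x \<mu> where x: "(\<Sum>v\<in>?V. (x v)\<^sup>2) = 1" "arc_form (parcs G) x x = \<mu>" "\<And>v. 0 \<le> x v"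
    "\<And>y. arc_form (parcs G) y y \<le> \<mu> * (\<Sum>v\<in>?V. (y v)\<^sup>2)"
    using arc_form_attains_max[of ?V "parcs G"] G n by (metis atLeastLessThan_empty_iff2 finite_atLeastLessThan not_le)
  have eig: "(\<Sum>w\<in>parcs G `` {v}. x w) = \<mu> * x v" if "v < n" for v
    using that x by (intro arc_form_maximiser_eigenvector[OF _ G(2,3)]) auto
  have "\<exists>v\<in>?V. x v \<noteq> 0"
  proof (rule ccontr)
    assume "\<not> ?thesis"
    then show False using x(1) by simp
  qed
  then obtain v0 where v0: "v0 < n" "x v0 \<noteq> 0" by auto
  have "\<mu> \<in> spectrum ?A"
  proof -
    have "eigenvector ?A (vec n x) \<mu>"
      unfolding eigenvector_def
    proof (intro conjI)
      show "vec n x \<in> carrier_vec (dim_row ?A)" using A by simp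
      show "vec n x \<noteq> 0\<^sub>v (dim_row ?A)"
        using v0 A by (metis carrier_matD(1) index_vec index_zero_vec(1))
      show "?A *\<^sub>v vec n x = \<mu> \<cdot>\<^sub>v vec n x"
      proof (rule eq_vecI)
        show "(?A *\<^sub>v vec n x) $ i = (\<mu> \<cdot>\<^sub>v vec n x) $ i" if "i < dim_vec (\<mu> \<cdot>\<^sub>v vec n x)" for i
        proof -
          have i: "i < n" using that by simp
          have "(?A *\<^sub>v vec n x) $ i = (\<Sum>j\<in>parcs G `` {i}. vec n x $ j)"
            by (rule adjacency_matrix_mult_vec[OF G(1,2) i]) simp
          also have "\<dots> = (\<Sum>j\<in>parcs G `` {i}. x j)" using G(2) by (intro sum.cong) auto
          finally show ?thesis using eig[OF i] i by simp
        qed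
      qed (use A in simp)
    qed
    then show ?thesis by (auto simp: spectrum_def eigenvalue_def)
  qed
  moreover have "k \<le> \<mu>" if "k \<in> spectrum ?A" for k
  proof -
    from that obtain v where v: "v \<in> carrier_vec n" "v \<noteq> 0\<^sub>v n" "?A *\<^sub>v v = k \<cdot>\<^sub>v v"
      using A by (auto simp: spectrum_def eigenvalue_def eigenvector_def)
    define y where "y i = v $ i" for i
    have "(\<Sum>w\<in>parcs G `` {i}. y w) = k * y i" if "i < n" for i
      using adjacency_matrix_mult_vec[OF G(1,2) that v(1)] v(1,3) that by (simp add: y_def)
    then have "arc_form (parcs G) y y = (\<Sum>i\<in>?V. y i * (k * y i))"
      unfolding arc_form_eq_sum[OF finite_atLeastLessThan G(2)] by (intro sum.cong) auto
    also have "\<dots> = k * (\<Sum>i\<in>?V. (y i)\<^sup>2)" by (simp add: sum_distrib_left power2_eq_square algebra_simps)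
    finally have le: "k * (\<Sum>i\<in>?V. (y i)\<^sup>2) \<le> \<mu> * (\<Sum>i\<in>?V. (y i)\<^sup>2)" using x(4)[of y] by simp
    have "\<exists>i<n. v $ i \<noteq> 0" using v(1,2) by (metis carrier_vecD eq_vecI index_zero_vec(1,2))
    then obtain i where "i \<in> ?V" "y i \<noteq> 0" by (auto simp: y_def)
    then have "(\<Sum>i\<in>?V. (y i)\<^sup>2) > 0" by (intro sum_pos2[of _ i]) auto
    with le show ?thesis by simp
  qed
  ultimately have \<mu>: "largest_eigenvalue G = \<mu>"
    unfolding largest_eigenvalue_def using card_finite_spectrum(1)[OF A] by (intro Max_eqI) auto
  show "arc_form (parcs G) y y \<le> largest_eigenvalue G * (\<Sum>v\<in>{0..<n}. (y v)\<^sup>2)"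
    using x(4) by (simp add: \<mu>)
  define M where "M = Max (x ` ?V)"
  have "M \<in> x ` ?V" using n unfolding M_def by (intro Max_in) auto
  moreover have "x v \<le> M" if "v < n" for v using that unfolding M_def by (intro Max_ge) auto
  ultimately have M: "M \<in> x ` ?V" "\<And>v. v < n \<Longrightarrow> x v \<le> M" by blast+
  have Mpos: "M > 0" using M(2)[OF v0(1)] v0(2) x(3)[of v0] by linarith
  show "\<exists>x. (\<forall>v. 0 \<le> x v \<and> x v \<le> 1) \<and> (\<exists>u<n. x u = 1) \<and>
      (\<forall>v<n. (\<Sum>w\<in>parcs G `` {v}. x w) = largest_eigenvalue G * x v)"
  proof (intro exI[of _ "\<lambda>v. if v < n then x v / M else 0"] conjI allI impI)
    obtain u where "u < n" "x u = M" using M(1) by force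
    then show "\<exists>u<n. (if u < n then x u / M else 0) = 1" using Mpos by (intro exI[of _ u]) simp
    fix v
    show "0 \<le> (if v < n then x v / M else 0)" using x(3)[of v] Mpos by simp
    show "(if v < n then x v / M else 0) \<le> 1" using M(2)[of v] Mpos by simp
    assume v: "v < n"
    have "(\<Sum>w\<in>parcs G `` {v}. if w < n then x w / M else 0) = (\<Sum>w\<in>parcs G `` {v}. x w) / M"
      unfolding sum_divide_distrib using G(2) by (intro sum.cong) auto
    then show "(\<Sum>w\<in>parcs G `` {v}. if w < n then x w / M else 0)
        = largest_eigenvalue G * (if v < n then x v / M else 0)"
      using eig[OF v] v by (simp add: \<mu>)
  qed
qed

section \<open>Perron vectors of graphs with few edges\<close>

text \<open>What the spectral part needs to know of the tree is condensed into three counting bounds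
  and the lower bound on \<open>\<mu>\<^sup>2\<close>. Entries of \<open>x\<close> may vanish, as
  the graph may be disconnected.\<close>

locale perron =
  fixes V :: "'a set" and E :: "'a rel" and x :: "'a \<Rightarrow> real" and \<mu> :: real and l m :: nat
  assumes finite_V: "finite V" and E_sub: "E \<subseteq> V \<times> V" and sym_E: "sym E" and irrefl_E: "irrefl E"
    and x_nonneg: "0 \<le> x v" and x_le_1: "x v \<le> 1" and x_max: "\<exists>u\<in>V. x u = 1"
    and eigen: "v \<in> V \<Longrightarrow> (\<Sum>w\<in>E `` {v}. x w) = \<mu> * x v"
    and lam_nonneg: "0 \<le> \<mu>" and lam_sq: "real l * (real (card V) - real l) \<le> \<mu>\<^sup>2"
    and arcs_le: "U \<subseteq> V \<Longrightarrow> card (E \<inter> U \<times> U) \<le> 2 * m * card U"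
    and arcs_Times_le: "X \<subseteq> V \<Longrightarrow> Y \<subseteq> V \<Longrightarrow> X \<inter> Y = {} \<Longrightarrow> card (E \<inter> X \<times> Y) \<le> m * card X + l * card Y"
    and common_nbrs_less: "X \<subseteq> V \<Longrightarrow> card X = l + 1 \<Longrightarrow> card {w \<in> V. X \<subseteq> E `` {w}} < m"
    and l_pos: "0 < l" and m_pos: "0 < m"
begin

abbreviation n :: nat where "n \<equiv> card V"

abbreviation deg :: "'a \<Rightarrow> nat" where "deg v \<equiv> card (E `` {v})"

lemma nbrs_sub: "E `` {v} \<subseteq> V" and finite_nbrs [simp]: "finite (E `` {v})"
proof -
  show "E `` {v} \<subseteq> V" using E_sub by auto
  then show "finite (E `` {v})" using finite_V finite_subset by blast
qed

lemma n_pos: "0 < n"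
  using x_max finite_V card_gt_0_iff by blast

lemma finite_E: "finite E"
  using E_sub finite_V finite_subset by blast

lemma card_arcs_eq_sum: "X \<subseteq> V \<Longrightarrow> card (E \<inter> X \<times> Y) = (\<Sum>v\<in>X. card (E `` {v} \<inter> Y))"
proof -
  assume "X \<subseteq> V"
  then have "finite X" using finite_V finite_subset by blast
  moreover have "E \<inter> X \<times> Y = (SIGMA v:X. E `` {v} \<inter> Y)" by auto
  ultimately show ?thesis by simp
qed

lemma sum_deg_le: "(\<Sum>v\<in>V. deg v) \<le> 2 * m * n"
proof -
  have "E `` {v} \<inter> V = E `` {v}" for v using nbrs_sub[of v] by blast
  then show ?thesis using arcs_le[of V] card_arcs_eq_sum[of V V] by simp
qed

lemma sum_deg_subset_le: "U \<subseteq> V \<Longrightarrow> (\<Sum>v\<in>U. real (deg v)) \<le> 2 * real m * real n"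
proof -
  assume "U \<subseteq> V"
  then have "(\<Sum>v\<in>U. deg v) \<le> (\<Sum>v\<in>V. deg v)" using finite_V by (intro sum_mono2) auto
  then have "(\<Sum>v\<in>U. deg v) \<le> 2 * m * n" using sum_deg_le by linarith
  then have "real (\<Sum>v\<in>U. deg v) \<le> real (2 * m * n)" by (simp only: of_nat_le_iff)
  then show ?thesis by simp
qed

lemma lam_x_le_deg: "v \<in> V \<Longrightarrow> \<mu> * x v \<le> deg v"
  using eigen[of v] sum_bounded_above[of "E `` {v}" x 1] x_le_1 by simp

lemma two_step: "v \<in> V \<Longrightarrow> \<mu>\<^sup>2 * x v = (\<Sum>w\<in>E `` {v}. \<Sum>u\<in>E `` {w}. x u)"
proof -
  assume v: "v \<in> V"
  have "(\<Sum>w\<in>E `` {v}. \<Sum>u\<in>E `` {w}. x u) = (\<Sum>w\<in>E `` {v}. \<mu> * x w)"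
    using nbrs_sub by (intro sum.cong refl eigen) blast
  also have "\<dots> = \<mu> * (\<mu> * x v)" by (simp add: sum_distrib_left[symmetric] eigen[OF v])
  finally show ?thesis by (simp add: power2_eq_square)
qed

lemma nbr_sum_split:
  assumes L: "\<And>u. u \<in> V \<Longrightarrow> u \<notin> L \<Longrightarrow> x u \<le> \<epsilon>" and e: "0 \<le> \<epsilon>"
  shows "(\<Sum>u\<in>E `` {w}. x u) \<le> (\<Sum>u\<in>E `` {w} \<inter> L. x u) + \<epsilon> * deg w"
proof -
  have "(\<Sum>u\<in>E `` {w}. x u) = (\<Sum>u\<in>E `` {w} \<inter> L. x u) + (\<Sum>u\<in>E `` {w} - L. x u)"
    by (rule sum.Int_Diff) simp
  also have "(\<Sum>u\<in>E `` {w} - L. x u) \<le> (\<Sum>u\<in>E `` {w} - L. \<epsilon>)"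
    using L nbrs_sub by (intro sum_mono) blast
  also have "\<dots> \<le> (\<Sum>u\<in>E `` {w}. \<epsilon>)" using e by (intro sum_mono2) auto
  also have "\<dots> = \<epsilon> * deg w" by simp
  finally show ?thesis by simp
qed

text \<open>Among the walks of length two from \<open>v\<close>, those ending outside of
  \<open>L\<close> contribute at most \<open>\<epsilon>\<close> each, and their number is at most
  the degree sum.\<close>

lemma two_step_le:
  assumes v: "v \<in> V" and L: "\<And>u. u \<in> V \<Longrightarrow> u \<notin> L \<Longrightarrow> x u \<le> \<epsilon>" and e: "0 \<le> \<epsilon>"
  shows "\<mu>\<^sup>2 * x v \<le> (\<Sum>w\<in>E `` {v}. \<Sum>u\<in>E `` {w} \<inter> L. x u) + 2 * \<epsilon> * m * n"
proof -
  have "\<mu>\<^sup>2 * x v \<le> (\<Sum>w\<in>E `` {v}. (\<Sum>u\<in>E `` {w} \<inter> L. x u) + \<epsilon> * deg w)"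
    unfolding two_step[OF v] by (intro sum_mono nbr_sum_split L e)
  also have "\<dots> = (\<Sum>w\<in>E `` {v}. \<Sum>u\<in>E `` {w} \<inter> L. x u) + \<epsilon> * (\<Sum>w\<in>E `` {v}. real (deg w))"
    by (simp add: sum.distrib sum_distrib_left)
  also have "\<epsilon> * (\<Sum>w\<in>E `` {v}. real (deg w)) \<le> \<epsilon> * (2 * real m * real n)"
    using e nbrs_sub by (intro mult_left_mono sum_deg_subset_le)
  finally show ?thesis by (simp add: algebra_simps)
qed

text \<open>Entries of size at least \<open>\<epsilon>\<close> sit on few vertices, because
  \<open>\<mu> * x u\<close> is at most the degree. Walks ending at them are counted by the arcs
  between \<open>L\<close> and the neighbours of \<open>v\<close>, with main term
  \<open>l * deg v\<close>. Comparison with \<open>\<mu>\<^sup>2 \<ge> l (n - l)\<close> cancels the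
  factor \<open>l\<close>.\<close>

lemma entry_le_degree:
  fixes \<sigma> :: real
  assumes v: "v \<in> V" and \<sigma>: "0 < \<sigma>" "3 * real l \<le> \<sigma> * n" "108 * real m ^ 3 \<le> \<sigma>\<^sup>2 * \<mu>"
  shows "x v * n \<le> deg v + \<sigma> * n"
proof -
  \<comment> \<open>The small entries then cost exactly \<open>\<sigma> * n / 3\<close>; the arcs at
    \<open>L\<close> and the passage from \<open>n - l\<close> to \<open>n\<close> cost at most
    another third each. The constant \<open>108 = 9 * 12\<close> comes from
    \<open>card L \<le> 12 m\<^sup>2 n / (\<sigma> \<mu>)\<close> and the demand
    \<open>9 m card L \<le> \<sigma> n\<close>.\<close>
  define \<epsilon> where "\<epsilon> = \<sigma> / (6 * m)"
  define L where "L = {u \<in> V. \<epsilon> \<le> x u}"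
  have m1: "real m > 0" using m_pos by simp
  have e: "\<epsilon> > 0" using \<sigma>(1) m1 by (simp add: \<epsilon>_def)
  have "0 < \<sigma>\<^sup>2 * \<mu>" using \<sigma>(3) m1 by (smt (verit) zero_less_power)
  then have lam: "\<mu> > 0" using \<sigma>(1) by (simp add: zero_less_mult_iff)
  have LV: "L \<subseteq> V" "finite L" using finite_V by (auto simp: L_def)
  have cL: "card L * (\<epsilon> * \<mu>) \<le> 2 * real m * n"
  proof -
    have "card L * (\<epsilon> * \<mu>) = (\<Sum>u\<in>L. \<mu> * \<epsilon>)" by simp
    also have "\<dots> \<le> (\<Sum>u\<in>L. real (deg u))"
    proof (rule sum_mono)
      fix u assume u: "u \<in> L"
      then have "\<mu> * \<epsilon> \<le> \<mu> * x u" using lam by (simp add: L_def)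
      then show "\<mu> * \<epsilon> \<le> deg u" using lam_x_le_deg[of u] u LV by force
    qed
    also have "\<dots> \<le> 2 * real m * n" by (rule sum_deg_subset_le[OF LV(1)])
    finally show ?thesis .
  qed
  have "(\<Sum>w\<in>E `` {v}. \<Sum>u\<in>E `` {w} \<inter> L. x u) \<le> (\<Sum>w\<in>E `` {v}. real (card (E `` {w} \<inter> L)))"
    using x_le_1 sum_bounded_above[of "E `` {w} \<inter> L" x 1 for w] by (intro sum_mono) simp
  also have "\<dots> = card (E \<inter> (E `` {v}) \<times> L)"
    by (simp add: card_arcs_eq_sum[OF nbrs_sub])
  also have "\<dots> \<le> real (l * deg v + 3 * m * card L)"
  proof -
    have "E \<inter> (E `` {v}) \<times> L \<subseteq> E \<inter> (E `` {v} - L) \<times> L \<union> E \<inter> L \<times> L" by blast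
    then have "card (E \<inter> (E `` {v}) \<times> L) \<le> card (E \<inter> (E `` {v} - L) \<times> L) + card (E \<inter> L \<times> L)"
      using finite_E by (meson card_Un_le card_mono finite_Int finite_UnI order_trans)
    also have "card (E \<inter> (E `` {v} - L) \<times> L) = card (E \<inter> L \<times> (E `` {v} - L))"
      by (rule card_arcs_Times_swap[OF sym_E])
    also have "\<dots> \<le> m * card L + l * card (E `` {v} - L)"
      using nbrs_sub LV by (intro arcs_Times_le) auto
    also have "card (E `` {v} - L) \<le> deg v" by (intro card_mono) auto
    also have "card (E \<inter> L \<times> L) \<le> 2 * m * card L" by (rule arcs_le[OF LV(1)])
    finally have "card (E \<inter> (E `` {v}) \<times> L) \<le> l * deg v + 3 * m * card L" by (simp add: algebra_simps)
    then show ?thesis by (simp only: of_nat_le_iff)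
  qed
  finally have 1: "\<mu>\<^sup>2 * x v \<le> l * deg v + 3 * m * card L + 2 * \<epsilon> * m * n"
    using two_step_le[OF v, of L \<epsilon>] e by (force simp: L_def)
  have 2: "2 * \<epsilon> * m * n = \<sigma> * n / 3" using m1 by (simp add: \<epsilon>_def)
  have 3: "3 * m * card L \<le> \<sigma> * n / 3"
  proof -
    have "card L * (\<sigma> * \<mu>) \<le> 12 * (real m)\<^sup>2 * n"
      using cL m1 by (simp add: \<epsilon>_def field_simps power2_eq_square)
    then have "9 * m * (card L * (\<sigma> * \<mu>)) \<le> 9 * m * (12 * (real m)\<^sup>2 * n)"
      using m1 by (intro mult_left_mono) auto
    also have "\<dots> = (108 * real m ^ 3) * n" by (simp add: power3_eq_cube power2_eq_square)
    also have "\<dots> \<le> \<sigma>\<^sup>2 * \<mu> * n" using \<sigma>(3) by (intro mult_right_mono) auto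
    finally have "(\<sigma> * \<mu>) * (9 * m * card L) \<le> (\<sigma> * \<mu>) * (\<sigma> * n)"
      by (simp add: power2_eq_square algebra_simps)
    then have "9 * real m * card L \<le> \<sigma> * n" using \<sigma>(1) lam by (subst (asm) mult_le_cancel_left_pos) auto
    then show ?thesis by simp
  qed
  have "l * (real n - l) * x v \<le> \<mu>\<^sup>2 * x v" using lam_sq x_nonneg by (rule mult_right_mono)
  with 1 2 3 have 4: "l * (real n - l) * x v \<le> l * deg v + 2 * \<sigma> * n / 3" by linarith
  have "l * (x v * n) = l * (real n - l) * x v + l * (l * x v)" by (simp add: algebra_simps)
  also have "\<dots> \<le> l * deg v + 2 * \<sigma> * n / 3 + l * l"
    using 4 mult_left_mono[OF mult_left_le[OF x_le_1[of v], of l], of l] by simp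
  also have "\<dots> \<le> l * deg v + l * (2 * \<sigma> * n / 3) + l * (\<sigma> * n / 3)"
  proof -
    have "1 * (2 * \<sigma> * n / 3) \<le> l * (2 * \<sigma> * n / 3)" using l_pos \<sigma>(1) by (intro mult_right_mono) auto
    moreover have "real l * l \<le> l * (\<sigma> * n / 3)" using \<sigma>(2) by (intro mult_left_mono) auto
    ultimately show ?thesis unfolding of_nat_mult by linarith
  qed
  also have "\<dots> = l * (deg v + \<sigma> * n)" by (simp add: algebra_simps)
  finally show ?thesis using l_pos by simp
qed

text \<open>Each such vertex is a common neighbour of one of at most \<open>2 ^ card L\<close>
  subsets of size \<open>l + 1\<close>, and each of these has fewer than \<open>m\<close> common
  neighbours.\<close>

lemma card_many_nbrs_le:
  assumes L: "L \<subseteq> V"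
  shows "card {w \<in> V. l < card (E `` {w} \<inter> L)} \<le> 2 ^ card L * m"
proof -
  have fL: "finite L" using L finite_V finite_subset by blast
  define F where "F = {X \<in> Pow L. card X = l + 1}"
  have fF: "finite F" "card F \<le> 2 ^ card L"
    using fL card_mono[of "Pow L" F] by (auto simp: F_def card_Pow)
  have "{w \<in> V. l < card (E `` {w} \<inter> L)} \<subseteq> (\<Union>X\<in>F. {w \<in> V. X \<subseteq> E `` {w}})"
  proof
    fix w assume w: "w \<in> {w \<in> V. l < card (E `` {w} \<inter> L)}"
    then have "l + 1 \<le> card (E `` {w} \<inter> L)" by simp
    then obtain X where "X \<subseteq> E `` {w} \<inter> L" "card X = l + 1" "finite X"
      by (rule obtain_subset_with_card_n)
    then show "w \<in> (\<Union>X\<in>F. {w \<in> V. X \<subseteq> E `` {w}})" using w by (auto simp: F_def)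
  qed
  then have "card {w \<in> V. l < card (E `` {w} \<inter> L)} \<le> card (\<Union>X\<in>F. {w \<in> V. X \<subseteq> E `` {w}})"
    using fF finite_V by (intro card_mono) auto
  also have "\<dots> \<le> (\<Sum>X\<in>F. card {w \<in> V. X \<subseteq> E `` {w}})" by (rule card_UN_le[OF fF(1)])
  also have "\<dots> \<le> (\<Sum>X\<in>F. m)"
    using common_nbrs_less L by (intro sum_mono less_imp_le) (auto simp: F_def)
  also have "\<dots> \<le> 2 ^ card L * m" using fF(2) by simp
  finally show ?thesis .
qed

text \<open>Let \<open>L\<close> be the vertices of linear degree and \<open>g w\<close> the weight
  of the neighbours of \<open>w\<close> in \<open>L\<close>. If \<open>g w \<le> l - \<tau>\<close>
  held for all but the exceptional \<open>w\<close>, the walks from a vertex of entry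
  \<open>1\<close> would give \<open>\<mu>\<^sup>2 < l (n - l)\<close>. So some \<open>w\<close>
  with at most \<open>l\<close> neighbours in \<open>L\<close> has \<open>g w > l - \<tau>\<close>.
  As entries are at most \<open>1\<close>, there are exactly \<open>l\<close> such neighbours, all
  with entry above \<open>1 - \<tau>\<close>.\<close>

lemma ex_dominating_set:
  fixes \<tau> \<sigma> :: real
  assumes \<tau>: "0 < \<tau>" "\<tau> \<le> 1" and \<sigma>: "0 < \<sigma>" "8 * \<sigma> * m \<le> \<tau>" "3 * real l \<le> \<sigma> * n"
      "108 * real m ^ 3 \<le> \<sigma>\<^sup>2 * \<mu>"
    and K: "2 * m / \<sigma> \<le> real K" "2 * (real l ^ 2 + 2 ^ K * m * K) < \<tau> * n"
  shows "\<exists>S\<subseteq>V. card S = l \<and> (\<forall>s\<in>S. 1 - \<tau> \<le> x s \<and> (1 - 2 * \<tau>) * n \<le> deg s)"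
proof -
  have n0: "real n > 0" using n_pos by simp
  define L where "L = {v \<in> V. \<sigma> * n \<le> deg v}"
  have LV: "L \<subseteq> V" "finite L" using finite_V by (auto simp: L_def)
  have cL: "card L \<le> K"
  proof -
    have "card L * (\<sigma> * n) = (\<Sum>v\<in>L. \<sigma> * n)" by simp
    also have "\<dots> \<le> (\<Sum>v\<in>L. real (deg v))" by (intro sum_mono) (simp add: L_def)
    also have "\<dots> \<le> 2 * real m * n" by (rule sum_deg_subset_le[OF LV(1)])
    finally have "card L * \<sigma> \<le> 2 * real m" using n0 by simp
    then have "real (card L) \<le> 2 * m / \<sigma>" using \<sigma>(1) by (simp add: field_simps)
    then have "real (card L) \<le> real K" using K(1) by linarith
    then show ?thesis by simp
  qed
  have xL: "x u \<le> 2 * \<sigma>" if "u \<in> V" "u \<notin> L" for u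
  proof -
    have "x u * n \<le> deg u + \<sigma> * n" by (rule entry_le_degree[OF that(1) \<sigma>(1,3,4)])
    also have "\<dots> \<le> 2 * \<sigma> * n" using that by (simp add: L_def)
    finally show ?thesis using n0 by simp
  qed
  define g where "g w = (\<Sum>u\<in>E `` {w} \<inter> L. x u)" for w
  define Bad where "Bad = {w \<in> V. l < card (E `` {w} \<inter> L)}"
  have g0: "0 \<le> g w" for w using x_nonneg by (simp add: g_def sum_nonneg)
  have gK: "g w \<le> K" for w
  proof -
    have "g w \<le> card (E `` {w} \<inter> L)"
      using x_le_1 sum_bounded_above[of "E `` {w} \<inter> L" x 1] by (simp add: g_def)
    also have "\<dots> \<le> card L" using LV(2) by (intro of_nat_mono card_mono) auto
    finally show ?thesis using cL by linarith
  qed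
  have "\<exists>w\<in>V. card (E `` {w} \<inter> L) \<le> l \<and> l - \<tau> < g w"
  proof (rule ccontr)
    assume "\<not> ?thesis"
    then have gle: "g w \<le> l - \<tau>" if "w \<in> V - Bad" for w using that by (force simp: Bad_def)
    have BV: "Bad \<subseteq> V" by (auto simp: Bad_def)
    obtain u0 where u0: "u0 \<in> V" "x u0 = 1" using x_max by blast
    have "\<mu>\<^sup>2 * x u0 \<le> (\<Sum>w\<in>E `` {u0}. g w) + 2 * (2 * \<sigma>) * m * n"
      unfolding g_def using xL \<sigma>(1) by (intro two_step_le[OF u0(1)]) auto
    also have "(\<Sum>w\<in>E `` {u0}. g w) \<le> (\<Sum>w\<in>V. g w)"
      using nbrs_sub finite_V g0 by (intro sum_mono2) auto
    also have "(\<Sum>w\<in>V. g w) = (\<Sum>w\<in>V - Bad. g w) + (\<Sum>w\<in>Bad. g w)"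
      using sum.subset_diff[OF BV finite_V] by simp
    also have "(\<Sum>w\<in>V - Bad. g w) \<le> n * (l - \<tau>)"
    proof -
      have "(\<Sum>w\<in>V - Bad. g w) \<le> (\<Sum>w\<in>V - Bad. l - \<tau>)" using gle by (intro sum_mono) auto
      also have "\<dots> \<le> (\<Sum>w\<in>V. l - \<tau>)"
        using finite_V l_pos \<tau>(2) by (intro sum_mono2) auto
      finally show ?thesis by simp
    qed
    also have "(\<Sum>w\<in>Bad. g w) \<le> 2 ^ K * m * K"
    proof -
      have "(\<Sum>w\<in>Bad. g w) \<le> card Bad * real K" using sum_bounded_above[of Bad g K] gK by simp
      also have "card Bad \<le> 2 ^ card L * m" unfolding Bad_def by (rule card_many_nbrs_le[OF LV(1)])
      also have "(2::nat) ^ card L \<le> 2 ^ K" using cL by (intro power_increasing) auto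
      finally show ?thesis by (simp add: mult_right_mono)
    qed
    finally have "\<mu>\<^sup>2 \<le> n * (l - \<tau>) + 2 ^ K * m * K + 4 * \<sigma> * m * n" using u0(2) by simp
    \<comment> \<open>One half of the deficit \<open>\<tau> * n\<close> absorbs the small entries,
      the other half \<open>l\<^sup>2\<close> and the exceptional vertices.\<close>
    moreover have "4 * \<sigma> * m * n \<le> \<tau> * n / 2"
      using mult_right_mono[OF \<sigma>(2) of_nat_0_le_iff[of n]] by simp
    ultimately show False using lam_sq K(2) by (simp add: algebra_simps power2_eq_square)
  qed
  then obtain w where w: "w \<in> V" "card (E `` {w} \<inter> L) \<le> l" "l - \<tau> < g w" by blast
  define S where "S = E `` {w} \<inter> L"
  have S: "finite S" "S \<subseteq> V" using nbrs_sub LV by (auto simp: S_def)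
  have "g w \<le> card S"
    using x_le_1 sum_bounded_above[of S x 1] by (simp add: g_def S_def)
  then have cS: "card S = l" using w(2,3) \<tau>(2) by (simp add: S_def)
  have xs: "1 - \<tau> \<le> x s" if "s \<in> S" for s
  proof -
    have "g w = x s + (\<Sum>u\<in>S - {s}. x u)" using S(1) that by (simp add: g_def S_def sum.remove)
    also have "(\<Sum>u\<in>S - {s}. x u) \<le> card (S - {s})"
      using x_le_1 sum_bounded_above[of "S - {s}" x 1] by simp
    also have "real (card (S - {s})) = real l - 1" using that S(1) cS l_pos by (simp add: of_nat_diff)
    finally show ?thesis using w(3) by linarith
  qed
  moreover have "(1 - 2 * \<tau>) * n \<le> deg s" if "s \<in> S" for s
  proof -
    have "(1 - \<tau>) * n \<le> x s * n" using xs[OF that] by (intro mult_right_mono) auto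
    also have "\<dots> \<le> deg s + \<sigma> * n" using that S(2) by (intro entry_le_degree[OF _ \<sigma>(1,3,4)]) auto
    also have "\<sigma> * n \<le> \<tau> * n"
    proof (rule mult_right_mono)
      have "\<sigma> * 1 \<le> \<sigma> * (8 * m)" using \<sigma>(1) m_pos by (intro mult_left_mono) auto
      then show "\<sigma> \<le> \<tau>" using \<sigma>(2) by (simp add: algebra_simps)
    qed simp
    finally show ?thesis by (simp add: algebra_simps)
  qed
  ultimately show ?thesis using S(2) cS by blast
qed

text \<open>A vertex outside of \<open>S\<close> has fewer than \<open>m\<close> neighbours that are
  joined to all of \<open>S\<close>, since it would otherwise complete \<open>S\<close> to
  \<open>l + 1\<close> vertices with \<open>m\<close> common neighbours. Its degree, and with it its
  entry, is small. The choice of \<open>\<tau>\<close> makes the total error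
  \<open>2 * l * \<tau> + 2 * \<tau>\<close> equal to \<open>\<eta>\<close>.\<close>

lemma dominating_set:
  fixes \<eta> \<tau> \<sigma> :: real
  assumes \<eta>: "0 < \<eta>" "\<eta> \<le> 1" and \<tau>: "\<tau> = \<eta> / (2 * l + 2)" and \<sigma>: "\<sigma> = \<tau> / (8 * m)"
    and K: "K = nat \<lceil>2 * m / \<sigma>\<rceil>"
    and n1: "3 * real l \<le> \<sigma> * n" "2 * (real l ^ 2 + 2 ^ K * m * K) < \<tau> * n" "real m \<le> \<tau> * n"
      "2 * l \<le> n" "2 * (108 * real m ^ 3 / \<sigma>\<^sup>2)\<^sup>2 \<le> n"
  shows "\<exists>S\<subseteq>V. card S = l \<and> (\<forall>s\<in>S. 1 - \<eta> \<le> x s) \<and> (\<forall>v\<in>V - S. x v \<le> \<eta>) \<and>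
    card {w \<in> V. \<not> S \<subseteq> E `` {w}} \<le> \<eta> * n"
proof -
  have n0: "real n > 0" using n_pos by simp
  have t: "0 < \<tau>" "\<tau> \<le> \<eta>" using \<eta> by (simp_all add: \<tau> field_simps)
  have s: "0 < \<sigma>" using t m_pos by (simp add: \<sigma>)
  have s2: "8 * \<sigma> * m \<le> \<tau>" using m_pos by (simp add: \<sigma>)
  have "(108 * real m ^ 3 / \<sigma>\<^sup>2)\<^sup>2 \<le> \<mu>\<^sup>2"
  proof -
    have "real n / 2 \<le> 1 * (real n - l)" using n1(4) by simp
    also have "\<dots> \<le> l * (real n - l)" using l_pos n1(4) by (intro mult_right_mono) auto
    finally show ?thesis using lam_sq n1(5) by linarith
  qed
  then have "108 * real m ^ 3 / \<sigma>\<^sup>2 \<le> \<mu>" using lam_nonneg by (rule power2_le_imp_le)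
  then have s4: "108 * real m ^ 3 \<le> \<sigma>\<^sup>2 * \<mu>" using s by (simp add: field_simps)
  have K1: "2 * m / \<sigma> \<le> real K" unfolding K by linarith
  from ex_dominating_set[OF t(1) _ s s2 n1(1) s4 K1 n1(2)] t \<eta> obtain S
    where S: "S \<subseteq> V" "card S = l" "\<And>s. s \<in> S \<Longrightarrow> 1 - \<tau> \<le> x s"
      "\<And>s. s \<in> S \<Longrightarrow> (1 - 2 * \<tau>) * n \<le> deg s" by force
  have fS: "finite S" using S(1) finite_V finite_subset by blast
  define Z where "Z = {w \<in> V. \<not> S \<subseteq> E `` {w}}"
  have "Z \<subseteq> (\<Union>s\<in>S. V - E `` {s})" using sym_E by (auto simp: Z_def dest: symD)
  then have "card Z \<le> card (\<Union>s\<in>S. V - E `` {s})" using fS finite_V by (intro card_mono) auto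
  also have "\<dots> \<le> (\<Sum>s\<in>S. card (V - E `` {s}))" by (rule card_UN_le[OF fS])
  finally have "real (card Z) \<le> (\<Sum>s\<in>S. real (card (V - E `` {s})))"
    by (metis of_nat_mono of_nat_sum)
  also have "\<dots> \<le> (\<Sum>s\<in>S. 2 * \<tau> * n)"
  proof (rule sum_mono)
    fix s assume "s \<in> S"
    have "deg s \<le> n" using nbrs_sub finite_V by (intro card_mono)
    then have "real (card (V - E `` {s})) = real n - deg s"
      using nbrs_sub by (simp add: card_Diff_subset of_nat_diff)
    then show "real (card (V - E `` {s})) \<le> 2 * \<tau> * n" using S(4)[OF \<open>s \<in> S\<close>] by (simp add: algebra_simps)
  qed
  finally have cZ: "real (card Z) \<le> 2 * l * \<tau> * n" using S(2) by simp
  have "(2 * l + 2) * \<tau> = \<eta>" unfolding \<tau> by simp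
  then have te: "2 * l * \<tau> + 2 * \<tau> = \<eta>" by (simp add: algebra_simps)
  have "x v \<le> \<eta>" if v: "v \<in> V - S" for v
  proof -
    have "E `` {v} \<subseteq> {w \<in> V. insert v S \<subseteq> E `` {w}} \<union> Z"
      using nbrs_sub sym_E by (auto simp: Z_def dest: symD)
    then have "deg v \<le> card ({w \<in> V. insert v S \<subseteq> E `` {w}} \<union> Z)"
      using finite_V by (intro card_mono) (auto simp: Z_def)
    also have "\<dots> \<le> card {w \<in> V. insert v S \<subseteq> E `` {w}} + card Z" by (rule card_Un_le)
    also have "card {w \<in> V. insert v S \<subseteq> E `` {w}} \<le> m"
    proof -
      have "insert v S \<subseteq> V" "card (insert v S) = l + 1" using v S(1,2) fS by auto
      from common_nbrs_less[OF this] show ?thesis by simp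
    qed
    finally have "real (deg v) \<le> m + real (card Z)" by linarith
    moreover have "x v * n \<le> deg v + \<sigma> * n"
      using v by (intro entry_le_degree[OF _ s n1(1) s4]) auto
    moreover have "\<sigma> * n \<le> \<tau> * n"
    proof (rule mult_right_mono)
      have "\<sigma> * 1 \<le> \<sigma> * (8 * m)" using s m_pos by (intro mult_left_mono) auto
      then show "\<sigma> \<le> \<tau>" using s2 by (simp add: algebra_simps)
    qed simp
    ultimately have "x v * n \<le> 2 * l * \<tau> * n + \<tau> * n + \<tau> * n" using n1(3) cZ by linarith
    also have "\<dots> = (2 * l * \<tau> + 2 * \<tau>) * n" by (simp add: algebra_simps)
    also have "\<dots> = \<eta> * n" by (simp only: te)
    finally show ?thesis using n0 by simp
  qed
  moreover have "real (card Z) \<le> \<eta> * n"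
  proof -
    have "2 * l * \<tau> * n \<le> \<eta> * n" using te t by (intro mult_right_mono) auto
    then show ?thesis using cZ by linarith
  qed
  moreover have "1 - \<eta> \<le> x s" if "s \<in> S" for s using S(3)[OF that] t by linarith
  ultimately show ?thesis using S(1,2) by (auto simp: Z_def)
qed

end

lemma eventually_dominating_set:
  fixes \<eta> :: real
  assumes \<eta>: "0 < \<eta>" "\<eta> \<le> 1" and m: "0 < m"
  shows "\<exists>N. \<forall>(V::'a set) E x \<mu>. perron V E x \<mu> l m \<longrightarrow> N < card V \<longrightarrow>
    (\<exists>S\<subseteq>V. card S = l \<and> (\<forall>s\<in>S. 1 - \<eta> \<le> x s) \<and> (\<forall>v\<in>V - S. x v \<le> \<eta>) \<and>
      card {w \<in> V. \<not> S \<subseteq> E `` {w}} \<le> \<eta> * card V)"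
proof -
  define \<tau> where "\<tau> = \<eta> / (2 * l + 2)"
  define \<sigma> where "\<sigma> = \<tau> / (8 * m)"
  define K where "K = nat \<lceil>2 * m / \<sigma>\<rceil>"
  have t: "0 < \<tau>" using \<eta> by (simp add: \<tau>_def)
  have s: "0 < \<sigma>" using t m by (simp add: \<sigma>_def)
  define q where "q = (\<lambda>r. nat \<lceil>r :: real\<rceil>)"
  have q: "r \<le> real k" if "q r \<le> k" for r k using that unfolding q_def by linarith
  \<comment> \<open>The \<open>+ 1\<close> yields the one strict inequality. All thresholds depend
    on \<open>\<eta>\<close>, \<open>l\<close> and \<open>m\<close> only, which makes
    \<open>N\<close> uniform in the graph.\<close>
  define N where "N = Max {q (3 * l / \<sigma>), q (2 * (real l ^ 2 + 2 ^ K * m * K) / \<tau> + 1), q (m / \<tau>),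
      2 * l, q (2 * (108 * real m ^ 3 / \<sigma>\<^sup>2)\<^sup>2)}"
  show ?thesis
  proof (intro exI[of _ N] allI impI)
    fix V :: "'a set" and E x \<mu>
    assume p: "perron V E x \<mu> l m" and N: "N < card V"
    have *: "q (3 * l / \<sigma>) \<le> card V" "q (2 * (real l ^ 2 + 2 ^ K * m * K) / \<tau> + 1) \<le> card V"
      "q (m / \<tau>) \<le> card V" "2 * l \<le> card V" "q (2 * (108 * real m ^ 3 / \<sigma>\<^sup>2)\<^sup>2) \<le> card V"
      using N by (simp_all add: N_def)
    show "\<exists>S\<subseteq>V. card S = l \<and> (\<forall>s\<in>S. 1 - \<eta> \<le> x s) \<and> (\<forall>v\<in>V - S. x v \<le> \<eta>) \<and>
        card {w \<in> V. \<not> S \<subseteq> E `` {w}} \<le> \<eta> * card V"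
    proof (rule perron.dominating_set[OF p \<eta> \<tau>_def \<sigma>_def K_def])
      show "3 * real l \<le> \<sigma> * card V" using q[OF *(1)] s by (simp add: field_simps)
      have "2 * (real l ^ 2 + 2 ^ K * m * K) / \<tau> < card V" using q[OF *(2)] by simp
      then show "2 * (real l ^ 2 + 2 ^ K * m * K) < \<tau> * card V" using t by (simp add: field_simps)
      show "real m \<le> \<tau> * card V" using q[OF *(3)] t by (simp add: field_simps)
      show "2 * (108 * real m ^ 3 / \<sigma>\<^sup>2)\<^sup>2 \<le> card V" by (rule q[OF *(5)])
    qed (rule *(4))
  qed
qed

section \<open>The structure of extremal graphs\<close>

lemma arc_form_Un_disjoint:
  "finite E \<Longrightarrow> finite E' \<Longrightarrow> E \<inter> E' = {} \<Longrightarrow> arc_form (E \<union> E') x y = arc_form E x y + arc_form E' x y"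
  unfolding arc_form_def by (rule sum.union_disjoint)

lemma arc_form_Times: "arc_form (X \<times> Y) x y = sum x X * sum y Y"
  unfolding arc_form_def by (simp add: sum_product sum.cartesian_product)

lemma arc_form_attach_vertex:
  assumes "finite E" "finite D" "\<And>a b. (a, b) \<in> E \<Longrightarrow> a \<noteq> v \<and> b \<noteq> v" "v \<notin> D"
  shows "arc_form (E \<union> (D \<times> {v} \<union> {v} \<times> D)) x x = arc_form E x x + 2 * x v * sum x D"
proof -
  have "arc_form (E \<union> (D \<times> {v} \<union> {v} \<times> D)) x x = arc_form E x x + arc_form (D \<times> {v} \<union> {v} \<times> D) x x"
    using assms by (intro arc_form_Un_disjoint) auto
  also have "arc_form (D \<times> {v} \<union> {v} \<times> D) x x = arc_form (D \<times> {v}) x x + arc_form ({v} \<times> D) x x"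
    using assms(2,4) by (intro arc_form_Un_disjoint) auto
  finally show ?thesis by (simp add: arc_form_Times)
qed

text \<open>Extremality enters through \<open>max\<close> alone: competing arc sets are tested with
  the vector \<open>x\<close> of the extremal graph itself.\<close>

locale extremal = tree: tree_parts P A B l m d + perron V E x \<mu> l m
  for P :: "'a rel" and A B and l m d :: nat and V :: "'b set" and E x \<mu> +
  assumes free: "\<not> copy_in (A \<union> B) P V E"
    and max: "E' \<subseteq> V \<times> V \<Longrightarrow> sym E' \<Longrightarrow> irrefl E' \<Longrightarrow> \<not> copy_in (A \<union> B) P V E' \<Longrightarrow>
      arc_form E' y y \<le> \<mu> * (\<Sum>v\<in>V. (y v)\<^sup>2)"
    and template: "copy_in (A \<union> B) P (pverts (join_stars l m d)) (parcs (join_stars l m d))"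
    and d2: "2 \<le> d"
begin

lemma arc_form_x: "arc_form E x x = \<mu> * (\<Sum>v\<in>V. (x v)\<^sup>2)"
  unfolding arc_form_eq_sum[OF finite_V E_sub]
  by (simp add: eigen sum_distrib_left power2_eq_square algebra_simps)

text \<open>The conditions on \<open>\<eta>\<close> ensure that entries on \<open>S\<close> are at
  least \<open>3 / 4\<close>, that at most \<open>d\<close> entries outside of \<open>S\<close> sum
  to at most \<open>1 / 4\<close>, that the vertices missing part of \<open>S\<close> span few arcs,
  and that the edges given up to make \<open>S\<close> a clique cost less than one edge inside
  \<open>S\<close> gains.\<close>

context
  fixes S :: "'b set" and \<eta> :: real
  assumes S: "S \<subseteq> V" "card S = l" and xS: "\<And>s. s \<in> S \<Longrightarrow> 1 - \<eta> \<le> x s"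
    and xR: "\<And>v. v \<in> V - S \<Longrightarrow> x v \<le> \<eta>"
    and few: "card {w \<in> V. \<not> S \<subseteq> E `` {w}} \<le> \<eta> * n"
    and eta: "0 < \<eta>" "4 * \<eta> \<le> 1" "4 * real d * \<eta> \<le> 1" "256 * real m * (real l + real d)\<^sup>2 * \<eta> \<le> 1"
      "real ((m - 1) * ((d - 1)\<^sup>2 + 1)) * \<eta> \<le> 1"
    and n_large: "2 * l \<le> n" "2 * m < n"
begin

lemma finite_S: "finite S"
  using S(1) finite_V finite_subset by blast

text \<open>At least three quarters of the vertices are joined to all of \<open>S\<close>; if
  \<open>d\<close> of them were adjacent to \<open>v\<close>, the others would leave room for a copy
  of the tree.\<close>

lemma card_nbrs_common_le:
  assumes v: "v \<in> V - S"
  shows "card (E `` {v} \<inter> {w \<in> V - S. S \<subseteq> E `` {w}}) \<le> d - 1"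
    and "m < card {w \<in> V - S. S \<subseteq> E `` {w}}"
proof -
  define R where "R = {w \<in> V - S. S \<subseteq> E `` {w}}"
  have fR: "finite R" using finite_V by (simp add: R_def)
  \<comment> \<open>Members of \<open>S\<close> fall into the second set, because no vertex is its
    own neighbour.\<close>
  have "V = R \<union> {w \<in> V. \<not> S \<subseteq> E `` {w}}"
    using irrefl_E by (auto simp: R_def irrefl_def)
  then have "n \<le> card R + card {w \<in> V. \<not> S \<subseteq> E `` {w}}" by (metis card_Un_le)
  then have "real n \<le> real (card R + card {w \<in> V. \<not> S \<subseteq> E `` {w}})" by (simp only: of_nat_le_iff)
  then have "real n \<le> card R + \<eta> * n" using few by simp
  moreover have "4 * \<eta> * n \<le> 1 * real n" using eta(2) by (intro mult_right_mono) auto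
  ultimately have "3 * real n \<le> 4 * card R" by simp
  then show mR: "m < card R" using n_large(2) by linarith
  have SR: "S \<times> R \<subseteq> E" using sym_E by (auto simp: R_def dest: symD)
  have "\<not> d \<le> card (E `` {v} \<inter> R)"
  proof
    assume "d \<le> card (E `` {v} \<inter> R)"
    then have "copy_in (A \<union> B) P V E"
      using v fR SR mR S
      by (intro tree.copy_in_of_big_star[OF sym_E irrefl_E S finite_S, where R = R and v = v])
        (auto simp: R_def)
    with free show False by simp
  qed
  then show "card (E `` {v} \<inter> R) \<le> d - 1" by linarith
qed

text \<open>
  The vertices missing some vertex of \<open>S\<close> are too few to carry a spectral radius comparable to
  \<open>\<mu>\<close>; hence one of them receives most of its weight from outside of the set.
\<close>
lemma ex_low_inner_weight:
  assumes Z: "Z \<subseteq> V" "Z \<noteq> {}" "card Z \<le> \<eta> * n" and c: "0 < c" "4 * m * \<eta> \<le> c\<^sup>2"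
  shows "\<exists>v\<in>Z. (\<Sum>w\<in>E `` {v} \<inter> Z. x w) \<le> c * \<mu> * x v"
proof (rule ccontr)
  assume "\<not> ?thesis"
  then have gt: "c * \<mu> * x v < (\<Sum>w\<in>E `` {v} \<inter> Z. x w)" if "v \<in> Z" for v using that by force
  have fZ: "finite Z" using Z(1) finite_V finite_subset by blast
  define X where "X = (\<Sum>v\<in>Z. (x v)\<^sup>2)"
  have "(c * \<mu>)\<^sup>2 * X = (\<Sum>v\<in>Z. (c * \<mu> * x v)\<^sup>2)"
    by (simp add: X_def power_mult_distrib sum_distrib_left)
  also have "\<dots> < (\<Sum>v\<in>Z. (\<Sum>w\<in>E `` {v} \<inter> Z. x w)\<^sup>2)"
    using Z(2) fZ gt c x_nonneg lam_nonneg
    by (intro sum_strict_mono power_strict_mono) auto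
  \<comment> \<open>Cauchy-Schwarz in each row: the squared norm of the matrix restricted to
    \<open>Z\<close> is at most its number of arcs, which is linear in
    \<open>card Z\<close>.\<close>
  also have "\<dots> \<le> (\<Sum>v\<in>Z. card (E `` {v} \<inter> Z) * X)"
  proof (rule sum_mono)
    fix v
    have "(\<Sum>w\<in>E `` {v} \<inter> Z. x w)\<^sup>2 \<le> (\<Sum>w\<in>E `` {v} \<inter> Z. 1\<^sup>2) * (\<Sum>w\<in>E `` {v} \<inter> Z. (x w)\<^sup>2)"
      using Cauchy_Schwarz_ineq_sum[of "\<lambda>_. 1" x "E `` {v} \<inter> Z"] by simp
    also have "\<dots> \<le> card (E `` {v} \<inter> Z) * X"
      using fZ unfolding X_def by (auto intro!: mult_left_mono sum_mono2)
    finally show "(\<Sum>w\<in>E `` {v} \<inter> Z. x w)\<^sup>2 \<le> card (E `` {v} \<inter> Z) * X" .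
  qed
  also have "\<dots> = card (E \<inter> Z \<times> Z) * X"
    by (simp add: card_arcs_eq_sum[OF Z(1)] sum_distrib_right)
  also have "\<dots> \<le> (2 * real m * card Z) * X"
  proof (rule mult_right_mono)
    have "card (E \<inter> Z \<times> Z) \<le> 2 * m * card Z" by (rule arcs_le[OF Z(1)])
    then have "real (card (E \<inter> Z \<times> Z)) \<le> real (2 * m * card Z)" by (simp only: of_nat_le_iff)
    then show "real (card (E \<inter> Z \<times> Z)) \<le> 2 * real m * card Z" by simp
    show "0 \<le> X" by (simp add: X_def sum_nonneg)
  qed
  finally have lt: "(c * \<mu>)\<^sup>2 * X < (2 * real m * card Z) * X" .
  moreover have "0 \<le> X" by (simp add: X_def sum_nonneg)
  ultimately have "(c * \<mu>)\<^sup>2 < 2 * real m * card Z" by (simp add: mult_less_cancel_right)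
  also have "\<dots> \<le> 2 * real m * (\<eta> * n)" using Z(3) by (intro mult_left_mono) auto
  also have "\<dots> = (4 * m * \<eta>) * (n / 2)" by simp
  also have "\<dots> \<le> c\<^sup>2 * (n / 2)" using c by (intro mult_right_mono) auto
  also have "\<dots> \<le> c\<^sup>2 * \<mu>\<^sup>2"
  proof (rule mult_left_mono)
    have "real n / 2 \<le> 1 * (real n - l)" using n_large(1) by simp
    also have "\<dots> \<le> l * (real n - l)" using l_pos n_large(1) by (intro mult_right_mono) auto
    finally show "real n / 2 \<le> \<mu>\<^sup>2" using lam_sq by linarith
  qed simp
  finally show False by (simp add: power_mult_distrib)
qed

text \<open>Redirecting the edges of a suitable \<open>v\<close> to \<open>S\<close> loses weight at
  most \<open>1 / 4\<close> in \<open>R\<close> and \<open>1 / 4\<close> in \<open>Z\<close>, but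
  gains at least \<open>3 / 4\<close> from a vertex of \<open>S\<close> that \<open>v\<close> was
  missing. Maximality therefore leaves only the case \<open>x v = 0\<close>.\<close>

lemma S_dominates:
  assumes w: "w \<in> V - S"
  shows "S \<subseteq> E `` {w}"
proof (rule ccontr)
  assume nS: "\<not> S \<subseteq> E `` {w}"
  define R where "R = {w \<in> V - S. S \<subseteq> E `` {w}}"
  define Z where "Z = {w \<in> V - S. \<not> S \<subseteq> E `` {w}}"
  have "card Z \<le> card {w \<in> V. \<not> S \<subseteq> E `` {w}}"
    using finite_V by (intro card_mono) (auto simp: Z_def)
  then have cZ: "card Z \<le> \<eta> * n" using few by linarith
  define q where "q = real l + real d"
  have q: "q \<ge> 1" "q > 0" using l_pos by (simp_all add: q_def)
  \<comment> \<open>Chosen for \<open>2 * c * q = 1 / 4\<close>: since \<open>c \<le> 1 / 2\<close>,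
    the eigenvalue equation gives \<open>\<mu> * x v \<le> 2 * q\<close>, so the weight of the
    neighbours of \<open>v\<close> in \<open>Z\<close> is at most \<open>1 / 4\<close>.\<close>
  define c where "c = 1 / (8 * q)"
  have c: "0 < c" "c \<le> 1 / 2" "2 * c * q = 1 / 4" using q by (simp_all add: c_def field_simps)
  have c2: "4 * m * \<eta> \<le> c\<^sup>2"
    using eta(4) q unfolding q_def[symmetric] by (simp add: c_def power_divide field_simps)
  have "Z \<noteq> {}" "Z \<subseteq> V" using w nS by (auto simp: Z_def)
  then obtain v where v: "v \<in> Z" "(\<Sum>w\<in>E `` {v} \<inter> Z. x w) \<le> c * \<mu> * x v"
    using ex_low_inner_weight[OF _ _ cZ c(1) c2] by blast
  have vR: "v \<in> V - S" "\<not> S \<subseteq> E `` {v}" using v(1) by (auto simp: Z_def)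
  then obtain s0 where s0: "s0 \<in> S" "s0 \<notin> E `` {v}" by blast
  have RV: "R \<subseteq> V - S" "finite R" using finite_V by (auto simp: R_def)
  have wR: "(\<Sum>w\<in>E `` {v} \<inter> R. x w) \<le> 1 / 4"
  proof -
    have "(\<Sum>w\<in>E `` {v} \<inter> R. x w) \<le> card (E `` {v} \<inter> R) * \<eta>"
      using sum_bounded_above[of "E `` {v} \<inter> R" x \<eta>] xR RV by auto
    also have "\<dots> \<le> real d * \<eta>"
      using card_nbrs_common_le(1)[OF vR(1)] eta(1) by (intro mult_right_mono) (auto simp: R_def)
    finally show ?thesis using eta(3) by simp
  qed
  have wS: "(\<Sum>w\<in>E `` {v} \<inter> S. x w) \<le> l"
  proof -
    have "(\<Sum>w\<in>E `` {v} \<inter> S. x w) \<le> card (E `` {v} \<inter> S)"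
      using sum_bounded_above[of "E `` {v} \<inter> S" x 1] x_le_1 by simp
    also have "\<dots> \<le> card S" using finite_S by (intro of_nat_mono card_mono) auto
    finally show ?thesis by (simp add: S(2))
  qed
  have split: "(\<Sum>w\<in>E `` {v}. x w) = (\<Sum>w\<in>E `` {v} \<inter> S. x w) + (\<Sum>w\<in>E `` {v} \<inter> R. x w) + (\<Sum>w\<in>E `` {v} \<inter> Z. x w)"
  proof -
    have "E `` {v} = (E `` {v} \<inter> S \<union> E `` {v} \<inter> R) \<union> E `` {v} \<inter> Z"
      using nbrs_sub[of v] by (auto simp: R_def Z_def)
    then have "(\<Sum>w\<in>E `` {v}. x w) = sum x ((E `` {v} \<inter> S \<union> E `` {v} \<inter> R) \<union> E `` {v} \<inter> Z)" by simp
    also have "\<dots> = sum x (E `` {v} \<inter> S \<union> E `` {v} \<inter> R) + (\<Sum>w\<in>E `` {v} \<inter> Z. x w)"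
      by (rule sum.union_disjoint) (auto simp: R_def Z_def)
    also have "sum x (E `` {v} \<inter> S \<union> E `` {v} \<inter> R) = (\<Sum>w\<in>E `` {v} \<inter> S. x w) + (\<Sum>w\<in>E `` {v} \<inter> R. x w)"
      by (rule sum.union_disjoint) (auto simp: R_def Z_def)
    finally show ?thesis .
  qed
  have wZ: "(\<Sum>w\<in>E `` {v} \<inter> Z. x w) \<le> 1 / 4"
  proof -
    have mx: "\<mu> * x v \<le> l + 1 / 4 + c * (\<mu> * x v)"
      using eigen[of v] vR split wR wS v(2) by (simp add: mult.assoc)
    have "c * (\<mu> * x v) \<le> 1 / 2 * (\<mu> * x v)"
      using c lam_nonneg x_nonneg by (intro mult_right_mono) auto
    with mx have "\<mu> * x v \<le> 2 * (l + 1 / 4)" by simp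
    also have "\<dots> \<le> 2 * q" using d2 by (simp add: q_def)
    finally have "c * (\<mu> * x v) \<le> c * (2 * q)" using c by (intro mult_left_mono) auto
    then show ?thesis using v(2) c(3) by (simp add: algebra_simps)
  qed
  define E\<^sub>0 where "E\<^sub>0 = {(a, b) \<in> E. a \<noteq> v \<and> b \<noteq> v}"
  define E' where "E' = E\<^sub>0 \<union> (S \<times> {v} \<union> {v} \<times> S)"
  have fE0: "finite E\<^sub>0" using finite_E by (rule finite_subset[rotated]) (auto simp: E\<^sub>0_def)
  have vS: "v \<notin> S" "v \<in> V" using vR by auto
  have E'V: "E' \<subseteq> V \<times> V" using E_sub S(1) vS by (auto simp: E'_def E\<^sub>0_def)
  have symE': "sym E'" using sym_E by (auto simp: E'_def E\<^sub>0_def sym_def)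
  have irE': "irrefl E'" using irrefl_E vS by (auto simp: E'_def E\<^sub>0_def irrefl_def)
  have nbr': "E' `` {v} = S" by (auto simp: E'_def E\<^sub>0_def vS)
  have free': "\<not> copy_in (A \<union> B) P V E'"
  proof
    assume cp: "copy_in (A \<union> B) P V E'"
    have "copy_in (A \<union> B) P V E"
    proof (rule copy_in_of_redirected[OF _ tree.irrefl_P _ sym_E RV(2) _ _ _ _ _ symE' cp])
      show "finite (A \<union> B)" using tree.finite_parts by simp
      show "P \<subseteq> (A \<union> B) \<times> (A \<union> B)" using tree.bipartite by auto
      show "R \<subseteq> V" using RV by auto
      show "S \<times> R \<subseteq> E" using sym_E by (auto simp: R_def dest: symD)
      show "card (A \<union> B) < card R" using card_nbrs_common_le(2)[OF vR(1)] tree.card_V by (simp add: R_def)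
      show "E' `` {v} \<subseteq> S" by (simp add: nbr')
      show "(a, b) \<in> E" if "(a, b) \<in> E'" "a \<noteq> v" "b \<noteq> v" for a b
        using that by (auto simp: E'_def E\<^sub>0_def)
    qed
    with free show False by simp
  qed
  have af': "arc_form E' x x = arc_form E\<^sub>0 x x + 2 * x v * sum x S"
    unfolding E'_def using fE0 finite_S vS by (intro arc_form_attach_vertex) (auto simp: E\<^sub>0_def)
  have "E = E\<^sub>0 \<union> (E `` {v} \<times> {v} \<union> {v} \<times> E `` {v})"
    using sym_E by (auto simp: E\<^sub>0_def dest: symD)
  then have "arc_form E x x = arc_form (E\<^sub>0 \<union> (E `` {v} \<times> {v} \<union> {v} \<times> E `` {v})) x x" by simp
  also have "\<dots> = arc_form E\<^sub>0 x x + 2 * x v * sum x (E `` {v})"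
    using fE0 irrefl_E by (intro arc_form_attach_vertex) (auto simp: E\<^sub>0_def irrefl_def)
  finally have af: "arc_form E x x = arc_form E\<^sub>0 x x + 2 * x v * sum x (E `` {v})" .
  have gain: "0 < sum x S - sum x (E `` {v})"
  proof -
    have "sum x S = sum x (E `` {v} \<inter> S) + sum x (S - E `` {v})"
      using sum.Int_Diff[OF finite_S, of x "E `` {v}"] by (simp add: Int_commute)
    moreover have "x s0 \<le> sum x (S - E `` {v})"
      using s0 finite_S x_nonneg by (intro member_le_sum) auto
    moreover have "3 / 4 \<le> x s0" using xS[OF s0(1)] eta(2) by linarith
    ultimately show ?thesis using split wR wZ by linarith
  qed
  have diff: "arc_form E' x x = \<mu> * (\<Sum>v\<in>V. (x v)\<^sup>2) + 2 * x v * (sum x S - sum x (E `` {v}))"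
    using af af' arc_form_x by (simp add: algebra_simps)
  have le': "arc_form E' y y \<le> \<mu> * (\<Sum>v\<in>V. (y v)\<^sup>2)" for y by (rule max[OF E'V symE' irE' free'])
  have "2 * x v * (sum x S - sum x (E `` {v})) \<le> 0" using le'[of x] diff by simp
  \<comment> \<open>If \<open>x v = 0\<close>, the form does not change, so \<open>x\<close> also
    maximises it for the new arc set. The eigenvalue equation at \<open>v\<close> then makes the
    entries on \<open>S\<close> sum to \<open>0\<close>, although they are near
    \<open>1\<close>.\<close>
  then have xv0: "x v = 0" using gain x_nonneg[of v] by (simp add: mult_le_0_iff)
  then have "(\<Sum>w\<in>E' `` {v}. x w) = \<mu> * x v"
    using diff by (intro arc_form_maximiser_eigenvector[OF finite_V E'V symE' le' _ vS(2)]) simp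
  then have "sum x S = 0" using xv0 nbr' by simp
  moreover have "x s0 \<le> sum x S" using s0 finite_S x_nonneg by (intro member_le_sum) auto
  ultimately show False using xS[OF s0(1)] eta(2) by linarith
qed

lemma outside_degree_le:
  assumes v: "v \<in> V - S"
  shows "card (E `` {v} \<inter> (V - S)) \<le> d - 1"
proof -
  have "{w \<in> V - S. S \<subseteq> E `` {w}} = V - S" using S_dominates by blast
  with card_nbrs_common_le(1)[OF v] show ?thesis by simp
qed

lemma S_times_outside: "S \<times> (V - S) \<subseteq> E"
  using S_dominates sym_E by (auto dest: symD)

lemma card_outside_max_degree:
  "card {v \<in> V - S. card (E `` {v} \<inter> (V - S)) = d - 1} \<le> (m - 1) * ((d - 1)\<^sup>2 + 1)"
proof (rule card_max_degree_vertices)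
  show "finite (V - S)" using finite_V by simp
  fix F assume F: "F \<subseteq> V - S" "\<And>v. v \<in> F \<Longrightarrow> card (E `` {v} \<inter> (V - S)) = d - 1"
    "\<And>u v. u \<in> F \<Longrightarrow> v \<in> F \<Longrightarrow> u \<noteq> v \<Longrightarrow>
      insert u (E `` {u} \<inter> (V - S)) \<inter> insert v (E `` {v} \<inter> (V - S)) = {}"
  have "\<not> m \<le> card F"
  proof
    assume mF: "m \<le> card F"
    have "copy_in (pverts (join_stars l m d)) (parcs (join_stars l m d)) V E"
      by (rule copy_in_join_stars[OF S finite_S _ _ _ S_times_outside sym_E irrefl_E F(1) mF _ F(3)])
        (use finite_V F(2) in auto)
    with template have "copy_in (A \<union> B) P V E" by (rule copy_in_trans)
    with free show False by simp
  qed
  then show "card F \<le> m - 1" by simp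
qed (use sym_E outside_degree_le in auto)

text \<open>
  An edge inside \<open>S\<close> is worth more than one edge at each vertex of maximum degree outside of \<open>S\<close>,
  and deleting the latter makes the graph \<open>T\<close>-free whatever happens inside \<open>S\<close>.
\<close>
lemma S_clique:
  assumes st: "s \<in> S" "t \<in> S" "s \<noteq> t"
  shows "(s, t) \<in> E"
proof (rule ccontr)
  assume nst: "(s, t) \<notin> E"
  define D where "D = {v \<in> V - S. card (E `` {v} \<inter> (V - S)) = d - 1}"
  have fD: "finite D" using finite_V by (simp add: D_def)
  have "\<exists>w. w \<in> E `` {v} \<inter> (V - S)" if "v \<in> D" for v
  proof -
    have "card (E `` {v} \<inter> (V - S)) \<noteq> 0" using that d2 by (simp add: D_def)
    then show ?thesis by (metis card.empty ex_in_conv)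
  qed
  \<comment> \<open>One outside neighbour per vertex of degree \<open>d - 1\<close>; removing these
    edges brings all outside degrees down to at most \<open>d - 2\<close>.\<close>
  then obtain f where f: "\<And>v. v \<in> D \<Longrightarrow> f v \<in> E `` {v} \<inter> (V - S)" by metis
  define Q where "Q = (\<lambda>v. (v, f v)) ` D \<union> (\<lambda>v. (f v, v)) ` D"
  have fQ: "finite Q" using fD by (simp add: Q_def)
  have QE: "Q \<subseteq> E" using f sym_E by (auto simp: Q_def dest: symD)
  have symQ: "sym Q" by (auto simp: Q_def sym_def)
  have QR: "Q \<subseteq> (V - S) \<times> (V - S)" using f by (auto simp: Q_def D_def)
  have cQ: "card Q \<le> 2 * card D"
  proof -
    have "card Q \<le> card ((\<lambda>v. (v, f v)) ` D) + card ((\<lambda>v. (f v, v)) ` D)"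
      unfolding Q_def by (rule card_Un_le)
    then show ?thesis using card_image_le[OF fD, of "\<lambda>v. (v, f v)"] card_image_le[OF fD, of "\<lambda>v. (f v, v)"]
      by linarith
  qed
  define E' where "E' = (E - Q) \<union> {(s, t), (t, s)}"
  have E'V: "E' \<subseteq> V \<times> V" using E_sub S(1) st by (auto simp: E'_def)
  have symE': "sym E'" using sym_E symQ by (auto simp: E'_def sym_def)
  have irE': "irrefl E'" using irrefl_E st by (auto simp: E'_def irrefl_def)
  have deg': "card (E' `` {v} \<inter> (V - S)) < d - 1" if v: "v \<in> V - S" for v
  proof -
    have sub: "E' `` {v} \<inter> (V - S) \<subseteq> E `` {v} \<inter> (V - S)" using v st by (auto simp: E'_def)
    show ?thesis
    proof (cases "v \<in> D")
      case True
      have "f v \<notin> E' `` {v}" using True v st f[OF True] by (auto simp: E'_def Q_def)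
      then have "E' `` {v} \<inter> (V - S) \<subset> E `` {v} \<inter> (V - S)" using sub f[OF True] by blast
      then have "card (E' `` {v} \<inter> (V - S)) < card (E `` {v} \<inter> (V - S))"
        by (intro psubset_card_mono) auto
      then show ?thesis using True by (simp add: D_def)
    next
      case False
      then have "card (E `` {v} \<inter> (V - S)) < d - 1" using outside_degree_le[OF v] v by (simp add: D_def)
      moreover have "card (E' `` {v} \<inter> (V - S)) \<le> card (E `` {v} \<inter> (V - S))"
        using sub by (intro card_mono) auto
      ultimately show ?thesis by linarith
    qed
  qed
  have free': "\<not> copy_in (A \<union> B) P V E'"
    using S(2) finite_S finite_V d2 deg'
    by (intro tree.not_copy_in_join[of S]) (auto intro: less_imp_le simp: not_le[symmetric])
  have "arc_form E' x x = arc_form (E - Q) x x + arc_form {(s, t), (t, s)} x x"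
    unfolding E'_def using nst sym_E finite_E by (intro arc_form_Un_disjoint) (auto dest: symD)
  moreover have "arc_form {(s, t), (t, s)} x x = 2 * (x s * x t)"
    using st(3) by (simp add: arc_form_def)
  moreover have "arc_form E x x = arc_form (E - Q) x x + arc_form Q x x"
  proof -
    have "E = (E - Q) \<union> Q" using QE by blast
    then have "arc_form E x x = arc_form ((E - Q) \<union> Q) x x" by simp
    also have "\<dots> = arc_form (E - Q) x x + arc_form Q x x"
      using finite_E fQ by (intro arc_form_Un_disjoint) auto
    finally show ?thesis .
  qed
  moreover have "arc_form E' x x \<le> arc_form E x x"
    unfolding arc_form_x by (rule max[OF E'V symE' irE' free'])
  ultimately have "2 * (x s * x t) \<le> arc_form Q x x" by linarith
  also have "\<dots> \<le> (\<Sum>e\<in>Q. \<eta> * \<eta>)"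
    unfolding arc_form_def
  proof (rule sum_mono)
    fix e assume "e \<in> Q"
    then have "fst e \<in> V - S" "snd e \<in> V - S" using QR by auto
    then show "(case e of (u, v) \<Rightarrow> x u * x v) \<le> \<eta> * \<eta>"
      using xR x_nonneg eta(1) by (auto simp: case_prod_unfold intro!: mult_mono)
  qed
  also have "\<dots> = card Q * (\<eta> * \<eta>)" by simp
  also have "\<dots> \<le> (2 * real ((m - 1) * ((d - 1)\<^sup>2 + 1))) * (\<eta> * \<eta>)"
  proof (rule mult_right_mono)
    have "card Q \<le> 2 * ((m - 1) * ((d - 1)\<^sup>2 + 1))"
      using cQ card_outside_max_degree unfolding D_def[symmetric] by linarith
    then have "real (card Q) \<le> real (2 * ((m - 1) * ((d - 1)\<^sup>2 + 1)))" by (simp only: of_nat_le_iff)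
    then show "real (card Q) \<le> 2 * real ((m - 1) * ((d - 1)\<^sup>2 + 1))" by simp
  qed (use eta(1) in simp)
  \<comment> \<open>The loss is at most \<open>2 * \<eta> \<le> 1 / 2\<close>, whereas the new edge
    is worth at least \<open>2 * (3 / 4)\<^sup>2\<close>.\<close>
  also have "\<dots> = 2 * \<eta> * (real ((m - 1) * ((d - 1)\<^sup>2 + 1)) * \<eta>)" by simp
  also have "\<dots> \<le> 2 * \<eta> * 1" using eta(1,5) by (intro mult_left_mono) auto
  finally have "x s * x t \<le> 1 / 4" using eta(2) by simp
  moreover have "3 / 4 \<le> x s" "3 / 4 \<le> x t" using xS[OF st(1)] xS[OF st(2)] eta(2) by linarith+
  then have "3 / 4 * (3 / 4) \<le> x s * x t" by (intro mult_mono) auto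
  ultimately show False by simp
qed

end

end

lemma eventually_join_structure:
  fixes A B :: "'a set" and l m d :: nat
  shows "\<exists>N. \<forall>(V::'b set) E x \<mu>. extremal P A B l m d V E x \<mu> \<longrightarrow> N < card V \<longrightarrow>
    (\<exists>S\<subseteq>V. card S = l \<and> (\<forall>s\<in>S. \<forall>v\<in>V. v \<noteq> s \<longrightarrow> (s, v) \<in> E) \<and>
      (\<forall>v\<in>V - S. card (E `` {v} \<inter> (V - S)) \<le> d - 1) \<and>
      card {v \<in> V - S. card (E `` {v} \<inter> (V - S)) = d - 1} \<le> (m - 1) * ((d - 1)\<^sup>2 + 1))"
proof (cases "m = 0")
  case True
  then show ?thesis by (auto simp: extremal_def perron_def)
next
  case False
  \<comment> \<open>The sum of all required denominators, so that \<open>\<eta> = 1 / q\<close>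
    meets every smallness condition at once.\<close>
  define q where "q = 4 + 4 * real d + 256 * real m * (real l + real d)\<^sup>2 + real ((m - 1) * ((d - 1)\<^sup>2 + 1))"
  define \<eta> where "\<eta> = 1 / q"
  have q: "q > 0" unfolding q_def by (intro add_pos_nonneg) auto
  have parts: "4 \<le> q" "4 * real d \<le> q" "256 * real m * (real l + real d)\<^sup>2 \<le> q"
    "real ((m - 1) * ((d - 1)\<^sup>2 + 1)) \<le> q"
    unfolding q_def by (simp_all del: of_nat_mult of_nat_add)
  have eta: "0 < \<eta>" "4 * \<eta> \<le> 1" "4 * real d * \<eta> \<le> 1" "256 * real m * (real l + real d)\<^sup>2 * \<eta> \<le> 1"
    "real ((m - 1) * ((d - 1)\<^sup>2 + 1)) * \<eta> \<le> 1"
    using q parts by (simp_all add: \<eta>_def del: of_nat_mult of_nat_add)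
  have "\<eta> \<le> 1" using eta(1,2) by linarith
  then obtain N where N: "\<And>(V::'b set) E x \<mu>. perron V E x \<mu> l m \<Longrightarrow> N < card V \<Longrightarrow>
    \<exists>S\<subseteq>V. card S = l \<and> (\<forall>s\<in>S. 1 - \<eta> \<le> x s) \<and> (\<forall>v\<in>V - S. x v \<le> \<eta>) \<and>
      card {w \<in> V. \<not> S \<subseteq> E `` {w}} \<le> \<eta> * card V"
    using eventually_dominating_set[OF eta(1), of m l] False by blast
  show ?thesis
  proof (intro exI[of _ "N + 2 * l + 2 * m"] allI impI)
    fix V :: "'b set" and E x \<mu>
    assume ex: "extremal P A B l m d V E x \<mu>" and n: "N + 2 * l + 2 * m < card V"
    interpret extremal P A B l m d V E x \<mu> by fact
    obtain S where S: "S \<subseteq> V" "card S = l" "\<And>s. s \<in> S \<Longrightarrow> 1 - \<eta> \<le> x s"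
      "\<And>v. v \<in> V - S \<Longrightarrow> x v \<le> \<eta>" "card {w \<in> V. \<not> S \<subseteq> E `` {w}} \<le> \<eta> * card V"
      using N[OF perron_axioms] n by auto
    have nl: "2 * l \<le> card V" "2 * m < card V" using n by auto
    note facts = S eta nl
    have "(s, v) \<in> E" if "s \<in> S" "v \<in> V" "v \<noteq> s" for s v
      using that S_clique[OF facts, of s v] S_times_outside[OF facts] by (cases "v \<in> S") auto
    then show "\<exists>S\<subseteq>V. card S = l \<and> (\<forall>s\<in>S. \<forall>v\<in>V. v \<noteq> s \<longrightarrow> (s, v) \<in> E) \<and>
      (\<forall>v\<in>V - S. card (E `` {v} \<inter> (V - S)) \<le> d - 1) \<and>
      card {v \<in> V - S. card (E `` {v} \<inter> (V - S)) = d - 1} \<le> (m - 1) * ((d - 1)\<^sup>2 + 1)"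
      using S(1,2) outside_degree_le[OF facts] card_outside_max_degree[OF facts] by blast
  qed
qed

section \<open>Bounds for the spectral radius of joins\<close>

definition circulant :: "nat \<Rightarrow> nat set \<Rightarrow> nat rel" where
  "circulant N D = {(i, j). i < N \<and> j < N \<and> (if i \<le> j then j - i else j + N - i) \<in> D}"

lemma circulant_nbrs:
  assumes "D \<subseteq> {1..<N}" "i < N"
  shows "circulant N D `` {i} = (\<lambda>s. if s + i < N then s + i else s + i - N) ` D"
proof (intro equalityI subsetI)
  fix j assume "j \<in> circulant N D `` {i}"
  then have j: "j < N" "(if i \<le> j then j - i else j + N - i) \<in> D" by (auto simp: circulant_def)
  show "j \<in> (\<lambda>s. if s + i < N then s + i else s + i - N) ` D"
    by (rule image_eqI[OF _ j(2)]) (use j(1) assms(2) in auto)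
next
  fix j assume "j \<in> (\<lambda>s. if s + i < N then s + i else s + i - N) ` D"
  then obtain s where s: "s \<in> D" "j = (if s + i < N then s + i else s + i - N)" by blast
  have "1 \<le> s" "s < N" using s(1) assms(1) by auto
  then have "(if i \<le> j then j - i else j + N - i) = s" "j < N" using s(2) assms(2) by auto
  then show "j \<in> circulant N D `` {i}" using s(1) assms(2) by (simp add: circulant_def)
qed

lemma card_circulant_nbrs:
  assumes "D \<subseteq> {1..<N}" "i < N"
  shows "card (circulant N D `` {i}) = card D"
proof -
  have "inj_on (\<lambda>s. if s + i < N then s + i else s + i - N) D"
  proof (rule inj_onI)
    fix s t assume "s \<in> D" "t \<in> D"
      "(if s + i < N then s + i else s + i - N) = (if t + i < N then t + i else t + i - N)"
    moreover have "s < N" "t < N" "1 \<le> s" "1 \<le> t" using calculation(1,2) assms(1) by auto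
    ultimately show "s = t" using assms(2) by (auto split: if_splits)
  qed
  then show ?thesis unfolding circulant_nbrs[OF assms] by (rule card_image)
qed

lemma sym_circulant:
  assumes "D \<subseteq> {1..<N}" "\<And>s. s \<in> D \<Longrightarrow> N - s \<in> D"
  shows "sym (circulant N D)"
proof (rule symI)
  fix i j assume "(i, j) \<in> circulant N D"
  then have ij: "i < N" "j < N" "(if i \<le> j then j - i else j + N - i) \<in> D" by (auto simp: circulant_def)
  have "i \<noteq> j" using ij(3) assms(1) by auto
  then have "N - (if i \<le> j then j - i else j + N - i) = (if j \<le> i then i - j else i + N - j)"
    using ij(1,2) by auto
  then show "(j, i) \<in> circulant N D" using ij assms(2)[OF ij(3)] by (simp add: circulant_def)
qed

lemma irrefl_circulant: "D \<subseteq> {1..<N} \<Longrightarrow> irrefl (circulant N D)"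
  by (auto simp: irrefl_def circulant_def)

text \<open>
  For \<open>k\<close> and \<open>N\<close> odd there is no \<open>k\<close>-regular graph on \<open>N\<close> vertices; a single vertex of
  degree \<open>k + 1\<close> repairs the parity.
\<close>
lemma almost_regular_exists:
  assumes N: "k + 2 \<le> N"
  obtains H where "H \<subseteq> {0..<N} \<times> {0..<N}" "sym H" "irrefl H"
    "\<And>v. v < N \<Longrightarrow> k \<le> card (H `` {v}) \<and> card (H `` {v}) \<le> k + 1"
    "\<And>u v. u < N \<Longrightarrow> v < N \<Longrightarrow> card (H `` {u}) = k + 1 \<Longrightarrow> card (H `` {v}) = k + 1 \<Longrightarrow> u = v"
proof -
  define a where "a = k div 2"
  define D where "D = {1..a} \<union> {N - a..<N}"
  have aN: "2 * a + 2 \<le> N" using N by (simp add: a_def)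
  have D: "D \<subseteq> {1..<N}" "\<And>s. s \<in> D \<Longrightarrow> N - s \<in> D" using aN by (auto simp: D_def)
  have cD: "card D = 2 * a" using aN unfolding D_def by (subst card_Un_disjoint) auto
  show thesis
  proof (cases "even k")
    case True
    then have k: "k = 2 * a" by (simp add: a_def)
    show thesis
      by (rule that[of "circulant N D"])
        (use card_circulant_nbrs[OF D(1)] sym_circulant[OF D] irrefl_circulant[OF D(1)] in
          \<open>auto simp: k cD circulant_def\<close>)
  next
    case False
    then have k: "k = 2 * a + 1" unfolding a_def by presburger
    define h where "h = N div 2"
    show thesis
    proof (cases "even N")
      case True
      then have Nh: "N = 2 * h" by (simp add: h_def)
      \<comment> \<open>For even \<open>N\<close> the antipodal difference \<open>h\<close> is its
        own inverse and adds exactly one to each degree.\<close>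
      define D' where "D' = insert h D"
      have D': "D' \<subseteq> {1..<N}" "\<And>s. s \<in> D' \<Longrightarrow> N - s \<in> D'"
        using D aN Nh by (auto simp: D'_def)
      have "h \<notin> D" using aN Nh by (auto simp: D_def)
      then have cD': "card D' = k" using cD by (simp add: D'_def k D_def)
      show thesis
        by (rule that[of "circulant N D'"])
          (use card_circulant_nbrs[OF D'(1)] sym_circulant[OF D'] irrefl_circulant[OF D'(1)] in
            \<open>auto simp: cD' circulant_def\<close>)
    next
      case False
      then have Nh: "N = 2 * h + 1" unfolding h_def by presburger
      have ha: "a < h" using N Nh k by simp
      \<comment> \<open>Matching \<open>i\<close> with \<open>i + h\<close> covers every vertex
        except \<open>2 * h\<close>, which is attached to \<open>h - 1\<close>, the only vertex of
        degree two in \<open>M\<close>. The differences \<open>h\<close> and \<open>h + 1\<close>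
        avoid \<open>D\<close> because \<open>a < h\<close>.\<close>
      define M\<^sub>0 where "M\<^sub>0 = {(i, j). i < h \<and> j = i + h} \<union> {(h - 1, 2 * h)}"
      define M where "M = M\<^sub>0 \<union> M\<^sub>0\<inverse>"
      have M: "M \<subseteq> {0..<N} \<times> {0..<N}" "sym M" "irrefl M"
        using ha Nh by (auto simp: M_def M\<^sub>0_def irrefl_def sym_def)
      have disj: "M \<inter> circulant N D = {}"
        using ha Nh by (auto simp: M_def M\<^sub>0_def circulant_def D_def)
      have mem: "j \<in> M `` {v} \<longleftrightarrow> v < h \<and> j = v + h \<or> v = h - 1 \<and> j = 2 * h \<or>
          j < h \<and> v = j + h \<or> j = h - 1 \<and> v = 2 * h" for v j
        by (auto simp: M_def M\<^sub>0_def)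
      have cM: "card (M `` {v}) = (if v = h - 1 then 2 else 1)" if "v < N" for v
      proof -
        have "v < h - 1 \<or> v = h - 1 \<or> h \<le> v \<and> v < 2 * h \<or> v = 2 * h" using that Nh by arith
        then consider "v < h - 1" | "v = h - 1" | "h \<le> v" "v < 2 * h" | "v = 2 * h" by blast
        then show ?thesis
        proof cases
          case 1
          have "M `` {v} = {v + h}"
          proof (rule Set.set_eqI)
            fix j show "j \<in> M `` {v} \<longleftrightarrow> j \<in> {v + h}" unfolding mem singleton_iff using 1 by auto
          qed
          then show ?thesis using 1 by simp
        next
          case 2
          have "M `` {v} = {v + h, 2 * h}"
          proof (rule Set.set_eqI)
            fix j show "j \<in> M `` {v} \<longleftrightarrow> j \<in> {v + h, 2 * h}" unfolding mem insert_iff empty_iff using 2 ha by presburger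
          qed
          then show ?thesis using 2 ha by simp
        next
          case 3
          have "M `` {v} = {v - h}"
          proof (rule Set.set_eqI)
            fix j show "j \<in> M `` {v} \<longleftrightarrow> j \<in> {v - h}" unfolding mem singleton_iff using 3 ha by auto
          qed
          then show ?thesis using 3 ha by simp
        next
          case 4
          have "M `` {v} = {h - 1}"
          proof (rule Set.set_eqI)
            fix j show "j \<in> M `` {v} \<longleftrightarrow> j \<in> {h - 1}" unfolding mem singleton_iff using 4 ha by presburger
          qed
          then show ?thesis using 4 ha by simp
        qed
      qed
      have fin: "finite (M `` {v})" "finite (circulant N D `` {v})" for v
        using M(1) by (auto intro!: finite_subset[of _ "{0..<N}"] simp: circulant_def)
      have card: "card ((circulant N D \<union> M) `` {v}) = (if v = h - 1 then k + 1 else k)" if "v < N" for v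
      proof -
        have "(circulant N D \<union> M) `` {v} = circulant N D `` {v} \<union> M `` {v}" by auto
        moreover have "circulant N D `` {v} \<inter> M `` {v} = {}" using disj by auto
        ultimately have "card ((circulant N D \<union> M) `` {v}) = card (circulant N D `` {v}) + card (M `` {v})"
          using fin by (simp add: card_Un_disjoint)
        then show ?thesis using card_circulant_nbrs[OF D(1) that] cM[OF that] by (simp add: cD k)
      qed
      show thesis
      proof (rule that[of "circulant N D \<union> M"])
        show "circulant N D \<union> M \<subseteq> {0..<N} \<times> {0..<N}" using M(1) by (auto simp: circulant_def)
        show "sym (circulant N D \<union> M)" using sym_circulant[OF D] M(2) by (rule sym_Un)
        show "irrefl (circulant N D \<union> M)" using irrefl_circulant[OF D(1)] M(3) by (auto simp: irrefl_def)
        show "k \<le> card ((circulant N D \<union> M) `` {v}) \<and> card ((circulant N D \<union> M) `` {v}) \<le> k + 1"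
          if "v < N" for v using card[OF that] by auto
        show "u = v" if "u < N" "v < N" "card ((circulant N D \<union> M) `` {u}) = k + 1"
          "card ((circulant N D \<union> M) `` {v}) = k + 1" for u v
          using that card[OF that(1)] card[OF that(2)] by (auto split: if_splits)
      qed
    qed
  qed
qed

text \<open>\<open>f_spex\<close> is the larger root of
  \<open>(t - k) * (t - l + 1) = l * (n - l)\<close>, the characteristic equation of the two-class
  quotient of a clique joined to a \<open>k\<close>-regular graph. The discriminant
  \<open>(k - (l - 1))\<^sup>2 + 4 * l * (n - l)\<close> shows that both factors are non-negative at
  this root, so their product is at most its square.\<close>

lemma f_spex_quadratic:
  assumes l: "1 \<le> l" and k: "0 \<le> k" and n: "l \<le> n"
  shows "(f_spex l k n - k) * (f_spex l k n - real l + 1) = real l * (real n - l)"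
    and "k \<le> f_spex l k n" and "real l - 1 \<le> f_spex l k n"
    and "sqrt (real l * (real n - l)) \<le> f_spex l k n"
proof -
  define p where "p = real l + k - 1"
  define r where "r = real l * (real n - l)"
  define q where "q = k * (real l - 1)"
  define w where "w = sqrt (p\<^sup>2 + 4 * (r - q))"
  define f where "f = f_spex l k n"
  have r0: "0 \<le> r" using n by (simp add: r_def)
  have q0: "0 \<le> q" using l k by (simp add: q_def)
  have disc: "p\<^sup>2 + 4 * (r - q) = (k - (real l - 1))\<^sup>2 + 4 * r"
    by (simp add: p_def q_def power2_eq_square algebra_simps)
  have f: "2 * f = p + w"
  proof -
    have "r - q = real n * real l + k - real l * k - (real l)\<^sup>2"
      by (simp add: r_def q_def power2_eq_square algebra_simps)
    then show ?thesis unfolding f_def f_spex_def w_def p_def by simp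
  qed
  have w2: "w\<^sup>2 = p\<^sup>2 + 4 * (r - q)" unfolding w_def disc using r0 by (simp add: disc)
  have w0: "0 \<le> w" unfolding w_def disc using r0 by simp
  have "(2 * f - p)\<^sup>2 = p\<^sup>2 + 4 * (r - q)" using f w2 by simp
  then show eq: "(f_spex l k n - k) * (f_spex l k n - real l + 1) = real l * (real n - l)"
    unfolding f_def[symmetric] by (simp add: p_def q_def r_def power2_eq_square algebra_simps)
  have "\<bar>k - (real l - 1)\<bar> \<le> w"
    unfolding w_def disc using r0 by (intro real_le_rsqrt) simp
  then show kf: "k \<le> f_spex l k n" and lf: "real l - 1 \<le> f_spex l k n"
    unfolding f_def[symmetric] using f by (simp_all add: p_def)
  have "(f - k) * (f - real l + 1) \<le> f * f"
    using kf lf l k unfolding f_def[symmetric] by (intro mult_mono) auto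
  then have "r \<le> f * f" using eq unfolding f_def[symmetric] r_def[symmetric] by simp
  then have "r \<le> f\<^sup>2" by (simp add: power2_eq_square)
  moreover have "0 \<le> f" using kf k by (simp add: f_def)
  ultimately show "sqrt (real l * (real n - l)) \<le> f_spex l k n"
    unfolding f_def[symmetric] r_def[symmetric] by (simp add: real_le_lsqrt)
qed

section \<open>Spectral bounds for a clique joined to a graph of bounded degree\<close>

definition join_clique :: "nat \<Rightarrow> nat \<Rightarrow> nat rel \<Rightarrow> nat rel" where
  "join_clique l n H = {(i, j). i < n \<and> j < n \<and> i \<noteq> j \<and> (i < l \<or> j < l)} \<union>
    (\<lambda>(i, j). (i + l, j + l)) ` H"

lemma join_clique_props:
  assumes l: "l \<le> n" and H: "H \<subseteq> {0..<n - l} \<times> {0..<n - l}" "sym H" "irrefl H"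
  shows "join_clique l n H \<subseteq> {0..<n} \<times> {0..<n}" "sym (join_clique l n H)" "irrefl (join_clique l n H)"
    and "s < l \<Longrightarrow> join_clique l n H `` {s} = {0..<n} - {s}"
    and "l \<le> v \<Longrightarrow> v < n \<Longrightarrow> join_clique l n H `` {v} = {0..<l} \<union> (\<lambda>j. j + l) ` (H `` {v - l})"
proof -
  show "join_clique l n H \<subseteq> {0..<n} \<times> {0..<n}" using H(1) l by (auto simp: join_clique_def)
  show "sym (join_clique l n H)" using H(2) by (auto simp: join_clique_def sym_def)
  show "irrefl (join_clique l n H)" using H(3) by (auto simp: join_clique_def irrefl_def)
  show "join_clique l n H `` {s} = {0..<n} - {s}" if "s < l"
    using that l by (auto simp: join_clique_def)
  show "join_clique l n H `` {v} = {0..<l} \<union> (\<lambda>j. j + l) ` (H `` {v - l})" if v: "l \<le> v" "v < n"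
    using v H(1) by (force simp: join_clique_def image_iff)
qed

text \<open>The test vector, \<open>f - k\<close> on the clique and \<open>l\<close> elsewhere, is
  the eigenvector for a \<open>k\<close>-regular \<open>H\<close>. Larger degrees only increase the
  neighbour sums, so its Rayleigh quotient is at least \<open>f\<close>.\<close>

lemma join_clique_eigenvalue_ge:
  assumes l: "1 \<le> l" "l < n" and H: "H \<subseteq> {0..<n - l} \<times> {0..<n - l}" "sym H" "irrefl H"
    and deg: "\<And>v. v < n - l \<Longrightarrow> k \<le> card (H `` {v})"
    and le: "\<And>y. arc_form (join_clique l n H) y y \<le> \<mu> * (\<Sum>v\<in>{0..<n}. (y v)\<^sup>2)"
  shows "f_spex l (real k) n \<le> \<mu>"
proof -
  define f where "f = f_spex l (real k) n"
  let ?E = "join_clique l n H"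
  note props = join_clique_props[OF less_imp_le[OF l(2)] H]
  have fq: "(f - k) * (f - real l + 1) = real l * (real n - l)" "real k \<le> f"
    using f_spex_quadratic[of l "real k" n] l by (simp_all add: f_def)
  define y where "y v = (if v < l then f - k else real l)" for v :: nat
  have y0: "0 \<le> y v" for v using fq(2) by (simp add: y_def)
  have sumS: "(\<Sum>w\<in>{0..<l}. y w) = l * (f - k)" by (simp add: y_def)
  have sumR: "(\<Sum>w\<in>{l..<n}. y w) = (real n - l) * l" using l by (simp add: y_def of_nat_diff)
  have sumV: "(\<Sum>w\<in>{0..<n}. y w) = l * (f - k) + (real n - l) * l"
    using sum.atLeastLessThan_concat[of 0 l n y] l sumS sumR by simp
  have step: "f * y v \<le> (\<Sum>w\<in>?E `` {v}. y w)" if v: "v < n" for v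
  proof (cases "v < l")
    case True
    then have "(\<Sum>w\<in>?E `` {v}. y w) = l * (f - k) + (real n - l) * l - (f - k)"
      using v sumV by (simp add: props(4) sum_diff1 y_def)
    also have "\<dots> = f * (f - k)" using fq(1) by (simp add: algebra_simps)
    finally show ?thesis using True by (simp add: y_def)
  next
    case False
    then have v': "l \<le> v" "v < n" "v - l < n - l" using v by auto
    have fin: "finite (H `` {v - l})" using H(1) by (auto intro: finite_subset[of _ "{0..<n - l}"])
    have "(\<Sum>w\<in>?E `` {v}. y w) = (\<Sum>w\<in>{0..<l}. y w) + (\<Sum>w\<in>(\<lambda>j. j + l) ` (H `` {v - l}). y w)"
      unfolding props(5)[OF v'(1,2)] using fin by (intro sum.union_disjoint) auto
    also have "(\<Sum>w\<in>(\<lambda>j. j + l) ` (H `` {v - l}). y w) = card (H `` {v - l}) * real l"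
      by (subst sum.reindex) (auto simp: y_def)
    finally have eq: "(\<Sum>w\<in>?E `` {v}. y w) = l * (f - k) + card (H `` {v - l}) * real l" by (simp add: sumS)
    have "real k * l \<le> card (H `` {v - l}) * real l"
      using deg[OF v'(3)] by (intro mult_right_mono) auto
    then show ?thesis using eq False by (simp add: y_def algebra_simps)
  qed
  have "f * (\<Sum>v\<in>{0..<n}. (y v)\<^sup>2) = (\<Sum>v\<in>{0..<n}. y v * (f * y v))"
    by (simp add: sum_distrib_left power2_eq_square algebra_simps)
  also have "\<dots> \<le> (\<Sum>v\<in>{0..<n}. y v * (\<Sum>w\<in>?E `` {v}. y w))"
    using step y0 by (intro sum_mono mult_left_mono) auto
  also have "\<dots> = arc_form ?E y y" by (rule arc_form_eq_sum[OF _ props(1), symmetric]) simp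
  also have "\<dots> \<le> \<mu> * (\<Sum>v\<in>{0..<n}. (y v)\<^sup>2)" by (rule le)
  finally have "f * (\<Sum>v\<in>{0..<n}. (y v)\<^sup>2) \<le> \<mu> * (\<Sum>v\<in>{0..<n}. (y v)\<^sup>2)" .
  moreover have "0 < (\<Sum>v\<in>{0..<n}. (y v)\<^sup>2)"
    using l by (intro sum_pos2[of _ l]) (auto simp: y_def)
  ultimately show ?thesis by (simp add: f_def)
qed

lemma (in tree_parts) not_copy_in_join_clique:
  assumes l: "l \<le> n" and H: "H \<subseteq> {0..<n - l} \<times> {0..<n - l}" "sym H" "irrefl H"
    and deg: "\<And>v. v < n - l \<Longrightarrow> card (H `` {v}) \<le> d - 1"
    and uniq: "\<And>u v. u < n - l \<Longrightarrow> v < n - l \<Longrightarrow> card (H `` {u}) = d - 1 \<Longrightarrow> card (H `` {v}) = d - 1 \<Longrightarrow> u = v"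
    and d: "0 < d"
  shows "\<not> copy_in (A \<union> B) P {0..<n} (join_clique l n H)"
proof -
  note props = join_clique_props[OF l H]
  have out: "card (join_clique l n H `` {v} \<inter> ({0..<n} - {0..<l})) = card (H `` {v - l})"
    if v: "v \<in> {0..<n} - {0..<l}" for v
  proof -
    have v': "l \<le> v" "v < n" using v by auto
    have "join_clique l n H `` {v} \<inter> ({0..<n} - {0..<l}) = (\<lambda>j. j + l) ` (H `` {v - l})"
      unfolding props(5)[OF v'] using H(1) by auto
    then show ?thesis by (simp add: card_image)
  qed
  show ?thesis
  proof (rule not_copy_in_join[of "{0..<l}"])
    fix v assume v: "v \<in> {0..<n} - {0..<l}"
    then have "v - l < n - l" by auto
    then show "card (join_clique l n H `` {v} \<inter> ({0..<n} - {0..<l})) \<le> d - 1"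
      using out[OF v] deg by simp
  next
    fix u v assume uv: "u \<in> {0..<n} - {0..<l}" "v \<in> {0..<n} - {0..<l}"
      "d - 1 \<le> card (join_clique l n H `` {u} \<inter> ({0..<n} - {0..<l}))"
      "d - 1 \<le> card (join_clique l n H `` {v} \<inter> ({0..<n} - {0..<l}))"
    have lt: "u - l < n - l" "v - l < n - l" "l \<le> u" "l \<le> v" using uv(1,2) by auto
    have "u - l = v - l"
    proof (rule uniq[OF lt(1,2)])
      show "card (H `` {u - l}) = d - 1" using uv(3) out[OF uv(1)] deg[OF lt(1)] by linarith
      show "card (H `` {v - l}) = d - 1" using uv(4) out[OF uv(2)] deg[OF lt(2)] by linarith
    qed
    then show "u = v" using lt by simp
  qed (use d in auto)
qed

text \<open>
  Eliminating the entry on \<open>S\<close> from the eigenvector equations gives the quadratic inequality that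
  is an equality for \<^const>\<open>f_spex\<close>, up to a term for the \<open>C\<close> vertices of degree \<open>k + 1\<close>.
\<close>
lemma join_eigenvalue_le:
  fixes x :: "'b \<Rightarrow> real"
  assumes V: "finite V" "E \<subseteq> V \<times> V" "sym E" "irrefl E" and x: "\<And>v. 0 \<le> x v" "\<exists>u\<in>V. x u \<noteq> 0"
    and eigen: "\<And>v. v \<in> V \<Longrightarrow> (\<Sum>w\<in>E `` {v}. x w) = \<mu> * x v"
    and S: "S \<subseteq> V" "card S = l" "1 \<le> l" "l < card V" "\<And>s v. s \<in> S \<Longrightarrow> v \<in> V \<Longrightarrow> v \<noteq> s \<Longrightarrow> (s, v) \<in> E"
    and deg: "\<And>v. v \<in> V - S \<Longrightarrow> card (E `` {v} \<inter> (V - S)) \<le> k + 1"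
    and C: "card {v \<in> V - S. card (E `` {v} \<inter> (V - S)) = k + 1} \<le> C"
    and mu: "real k + 1 < \<mu>"
  shows "(\<mu> - k) * (\<mu> - real l + 1) \<le> real l * (real (card V) - l) + real C * l / (\<mu> - k - 1)"
proof -
  define R where "R = V - S"
  have fin: "finite S" "finite R" using V(1) S(1) finite_subset by (auto simp: R_def)
  have cR: "real (card R) = real (card V) - l"
    using S fin by (simp add: R_def card_Diff_subset of_nat_diff)
  define Y where "Y = sum x R"
  define X where "X = sum x V"
  have XY: "X = sum x S + Y" using sum.subset_diff[OF S(1) V(1), of x] by (simp add: X_def Y_def R_def)
  have nS: "E `` {s} = V - {s}" if "s \<in> S" for s
    using S(1,5) V(2,4) that by (auto simp: irrefl_def)
  have mu0: "0 < \<mu> + 1" using mu by linarith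
  have xs: "(\<mu> + 1) * x s = X" if s: "s \<in> S" for s
    using eigen[of s] s S(1) V(1) unfolding nS[OF s] by (auto simp: sum_diff1 X_def algebra_simps)
  \<comment> \<open>Each member of \<open>S\<close> is adjacent to all other vertices, so the
    eigenvalue equation determines a common entry on \<open>S\<close>.\<close>
  define z where "z = X / (\<mu> + 1)"
  have xz: "x s = z" if "s \<in> S" for s using xs[OF that] mu0 by (simp add: z_def field_simps)
  have sumS: "sum x S = l * z" using xz S(2) by simp
  have Yz: "Y = (\<mu> - real l + 1) * z"
  proof -
    have "(\<mu> + 1) * z = l * z + Y" using mu0 XY sumS by (simp add: z_def)
    then show ?thesis by (simp add: algebra_simps)
  qed
  have X0: "0 < X" using x V(1) unfolding X_def by (metis less_le sum_nonneg_eq_0_iff sum_nonneg)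
  have z0: "0 < z" using X0 mu0 by (simp add: z_def)
  define N where "N v = E `` {v} \<inter> R" for v
  have finN: "finite (N v)" for v using fin by (simp add: N_def)
  have eigR: "\<mu> * x v = l * z + sum x (N v)" if v: "v \<in> R" for v
  proof -
    have "S \<subseteq> E `` {v}"
    proof
      fix s assume "s \<in> S"
      then have "(s, v) \<in> E" using v S(5)[of s v] by (auto simp: R_def)
      then show "s \<in> E `` {v}" using V(3) by (auto dest: symD)
    qed
    then have "E `` {v} = S \<union> N v" using V(2) by (auto simp: R_def N_def)
    moreover have "S \<inter> N v = {}" by (auto simp: R_def N_def)
    ultimately have "sum x (E `` {v}) = sum x S + sum x (N v)"
      using fin finN by (simp add: sum.union_disjoint)
    then show ?thesis using eigen[of v] v sumS by (simp add: R_def)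
  qed
  have "R \<noteq> {}" using cR S(4) by auto
  \<comment> \<open>The largest outside entry satisfies
    \<open>(\<mu> - k - 1) * M \<le> l * z\<close>. It is charged once per vertex of degree
    \<open>k + 1\<close>, which produces the error term.\<close>
  define M where "M = Max (x ` R)"
  have M: "M \<in> x ` R" "\<And>v. v \<in> R \<Longrightarrow> x v \<le> M"
    using fin \<open>R \<noteq> {}\<close> by (simp_all add: M_def)
  obtain v\<^sub>0 where v0: "v\<^sub>0 \<in> R" "x v\<^sub>0 = M" using M(1) by blast
  have M0: "0 \<le> M" using x(1)[of v\<^sub>0] v0 by simp
  have "sum x (N v\<^sub>0) \<le> card (N v\<^sub>0) * M"
    using M(2) by (intro sum_bounded_above) (simp add: N_def)
  also have "\<dots> \<le> (real k + 1) * M"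
  proof (rule mult_right_mono)
    have "card (N v\<^sub>0) \<le> k + 1" using deg[of v\<^sub>0] v0 by (simp add: N_def R_def)
    then have "real (card (N v\<^sub>0)) \<le> real (k + 1)" by (simp only: of_nat_le_iff)
    then show "real (card (N v\<^sub>0)) \<le> real k + 1" by simp
  qed (rule M0)
  finally have "(\<mu> - k - 1) * M \<le> l * z" using eigR[OF v0(1)] v0(2) by (simp add: algebra_simps)
  then have Mz: "M \<le> l * z / (\<mu> - k - 1)" using mu by (simp add: field_simps)
  define D where "D = {v \<in> R. card (N v) = k + 1}"
  have "\<mu> * Y = (\<Sum>v\<in>R. \<mu> * x v)" by (simp add: Y_def sum_distrib_left)
  also have "\<dots> = (\<Sum>v\<in>R. l * z + sum x (N v))" by (intro sum.cong refl eigR)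
  also have "\<dots> = card R * (l * z) + (\<Sum>v\<in>R. sum x (N v))" by (simp add: sum.distrib)
  also have "(\<Sum>v\<in>R. sum x (N v)) = (\<Sum>v\<in>R. \<Sum>w\<in>R. if (v, w) \<in> E then x w else 0)"
  proof (rule sum.cong[OF refl])
    fix v
    show "sum x (N v) = (\<Sum>w\<in>R. if (v, w) \<in> E then x w else 0)"
      using sum.inter_restrict[OF fin(2), of x "E `` {v}"] by (simp add: N_def Int_commute)
  qed
  also have "\<dots> = (\<Sum>w\<in>R. \<Sum>v\<in>R. if (v, w) \<in> E then x w else 0)" by (rule sum.swap)
  also have "\<dots> = (\<Sum>w\<in>R. card (N w) * x w)"
  proof (rule sum.cong[OF refl])
    fix w assume "w \<in> R"
    have "(\<Sum>v\<in>R. if (v, w) \<in> E then x w else 0) = (\<Sum>v\<in>R. if v \<in> E `` {w} then x w else 0)"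
      using V(3) by (intro sum.cong) (auto dest: symD)
    also have "\<dots> = (\<Sum>v\<in>R \<inter> E `` {w}. x w)"
      by (rule sum.inter_restrict[OF fin(2), symmetric])
    finally show "(\<Sum>v\<in>R. if (v, w) \<in> E then x w else 0) = card (N w) * x w"
      by (simp add: N_def Int_commute)
  qed
  also have "\<dots> \<le> (\<Sum>w\<in>R. k * x w + (if w \<in> D then M else 0))"
  proof (rule sum_mono)
    fix w assume w: "w \<in> R"
    have cw: "card (N w) \<le> k + 1" using deg[of w] w by (simp add: N_def R_def)
    show "card (N w) * x w \<le> k * x w + (if w \<in> D then M else 0)"
    proof (cases "w \<in> D")
      case True
      then show ?thesis using M(2)[OF w] by (simp add: D_def algebra_simps)
    next
      case False
      then have "card (N w) \<le> k" using cw w by (simp add: D_def)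
      then show ?thesis using False x(1) by (simp add: mult_right_mono)
    qed
  qed
  also have "\<dots> = k * Y + card (R \<inter> D) * M"
    using fin by (simp add: sum.distrib Y_def sum_distrib_left sum.inter_restrict[symmetric])
  also have "R \<inter> D = D" by (auto simp: D_def)
  also have "card D * M \<le> C * (l * z / (\<mu> - k - 1))"
    using C Mz M0 by (intro mult_mono) (auto simp: D_def N_def R_def)
  finally have "(\<mu> - k) * Y \<le> card R * (l * z) + C * (l * z / (\<mu> - k - 1))" by (simp add: algebra_simps)
  then have "((\<mu> - k) * (\<mu> - real l + 1)) * z \<le> (real l * (real (card V) - l) + real C * l / (\<mu> - k - 1)) * z"
    unfolding Yz cR by (simp add: algebra_simps)
  then show ?thesis using z0 by simp
qed

text \<open>Subtracting the equation for \<open>f_spex\<close> isolates the factor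
  \<open>\<mu> - f_spex l k n\<close>. For
  \<open>r = sqrt (l * (n - l)) \<ge> 2 * (k + l + 1)\<close> its cofactor is at least
  \<open>3 * r / 2\<close> and the denominator of the error at least \<open>r / 2\<close>. The bound
  \<open>2 * C / n\<close> then results from \<open>3 * r\<^sup>2 \<ge> 2 * l * n\<close>.\<close>

lemma quadratic_inequality_bound:
  assumes l: "1 \<le> l" and n: "4 * l \<le> n" "l + 4 * (k + l + 1)\<^sup>2 \<le> n"
    and f: "f_spex l (real k) n \<le> \<mu>"
    and le: "(\<mu> - k) * (\<mu> - real l + 1) \<le> real l * (real n - l) + real C * l / (\<mu> - k - 1)"
  shows "\<mu> \<le> f_spex l (real k) n + 2 * real C / n"
proof -
  define f\<^sub>0 where "f\<^sub>0 = f_spex l (real k) n"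
  define r where "r = sqrt (real l * (real n - l))"
  have ln: "l \<le> n" using n by simp
  have f0: "(f\<^sub>0 - k) * (f\<^sub>0 - real l + 1) = real l * (real n - l)" "r \<le> f\<^sub>0"
    using f_spex_quadratic[of l "real k" n] l ln by (simp_all add: f\<^sub>0_def r_def)
  have r2: "r\<^sup>2 = real l * (real n - l)" using ln by (simp add: r_def)
  have "(2 * (real k + l + 1))\<^sup>2 \<le> r\<^sup>2"
  proof -
    define q where "q = real k + l + 1"
    have "real l + 4 * q\<^sup>2 = real (l + 4 * (k + l + 1)\<^sup>2)" by (simp add: q_def)
    also have "\<dots> \<le> real n" using n(2) by (simp only: of_nat_le_iff)
    finally have "(2 * q)\<^sup>2 \<le> 1 * (real n - l)" by (simp add: power_mult_distrib)
    also have "\<dots> \<le> real l * (real n - l)" using l ln by (intro mult_right_mono) auto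
    finally show ?thesis by (simp only: r2 q_def)
  qed
  then have r: "2 * (real k + l + 1) \<le> r" by (rule power2_le_imp_le) (simp add: r_def ln)
  have muf: "f\<^sub>0 \<le> \<mu>" using f by (simp add: f\<^sub>0_def)
  have nonneg: "0 \<le> real k" "0 \<le> real l" by simp_all
  have a: "r / 2 \<le> \<mu> - k - 1" using r f0(2) muf nonneg by argo
  have b: "3 * r / 2 \<le> \<mu> + f\<^sub>0 - (real k + l - 1)" using r f0(2) muf nonneg by argo
  have r0: "0 < r" using r nonneg by argo
  have "(\<mu> - f\<^sub>0) * (\<mu> + f\<^sub>0 - (real k + l - 1)) = (\<mu> - k) * (\<mu> - real l + 1) - (f\<^sub>0 - k) * (f\<^sub>0 - real l + 1)"
    by (simp add: algebra_simps)
  also have "\<dots> \<le> real C * l / (\<mu> - k - 1)" using le f0(1) by linarith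
  also have "\<dots> \<le> real C * l / (r / 2)" using a r0 by (intro divide_left_mono) auto
  finally have 1: "(\<mu> - f\<^sub>0) * (\<mu> + f\<^sub>0 - (real k + l - 1)) \<le> real C * l / (r / 2)" .
  have "(\<mu> - f\<^sub>0) * (3 * r / 2) \<le> (\<mu> - f\<^sub>0) * (\<mu> + f\<^sub>0 - (real k + l - 1))"
    using b muf by (intro mult_left_mono) auto
  with 1 have "(\<mu> - f\<^sub>0) * (3 * r / 2) \<le> real C * l / (r / 2)" by linarith
  then have 2: "(\<mu> - f\<^sub>0) * (3 * r\<^sup>2) \<le> 4 * (real C * l)" using r0 by (simp add: field_simps power2_eq_square)
  have "3 * r\<^sup>2 \<ge> 2 * (real l * n)"
  proof -
    have "real l * (3 * real l) \<le> real l * n" using n(1) by (intro mult_left_mono) auto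
    then show ?thesis unfolding r2 by (simp add: algebra_simps)
  qed
  then have "(\<mu> - f\<^sub>0) * (2 * (real l * n)) \<le> (\<mu> - f\<^sub>0) * (3 * r\<^sup>2)" using muf by (intro mult_left_mono) auto
  with 2 have "real l * ((\<mu> - f\<^sub>0) * n) \<le> real l * (2 * C)" by (simp add: algebra_simps)
  then have "(\<mu> - f\<^sub>0) * n \<le> 2 * C" using l by simp
  moreover have "0 < real n" using l n by simp
  ultimately show ?thesis by (simp add: f\<^sub>0_def field_simps)
qed

section \<open>Extremal graphs as labelled joins\<close>

text \<open>Only \<open>S\<close> is relabelled; the second factor keeps the names of its vertices,
  so that its degrees can be read off from \<open>G\<close>.\<close>

lemma digraph_iso_join_complete_graph:
  assumes G: "pair_wf_digraph G" "sym (parcs G)" "irrefl (parcs G)" and S: "finite S" "S \<subseteq> pverts G" "card S = l"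
    and full: "\<And>s v. s \<in> S \<Longrightarrow> v \<in> pverts G \<Longrightarrow> v \<noteq> s \<Longrightarrow> (s, v) \<in> parcs G"
  shows "digraph_iso (with_proj G) (with_proj (join (complete_graph l)
    \<lparr>pverts = pverts G - S, parcs = parcs G \<inter> (pverts G - S) \<times> (pverts G - S)\<rparr>))"
proof -
  define R where "R = pverts G - S"
  define F where "F = parcs G \<inter> R \<times> R"
  obtain g where g: "bij_betw g S {0..<l}"
    using finite_same_card_bij[OF S(1), of "{0..<l}"] S(3) by auto
  define h where "h v = (if v \<in> S then Inl (g v) else Inr v)" for v
  have hS: "h v = Inl (g v)" if "v \<in> S" for v using that by (simp add: h_def)
  have hR: "h v = Inr v" if "v \<in> R" for v using that by (simp add: h_def R_def)
  have gl: "g ` S = {0..<l}" and ginj: "inj_on g S" using g by (auto simp: bij_betw_def)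
  have V: "pverts G = S \<union> R" using S(2) by (auto simp: R_def)
  have "h ` S = Inl ` g ` S" unfolding image_image by (rule image_cong[OF refl hS])
  then have imS: "h ` S = Inl ` {0..<l}" by (simp only: gl)
  have imR: "h ` R = Inr ` R" by (rule image_cong[OF refl hR])
  have bij: "bij_betw h (pverts G) ({0..<l} <+> R)"
    unfolding bij_betw_def
  proof
    show "inj_on h (pverts G)"
      using ginj by (auto simp: inj_on_def h_def split: if_splits)
    show "h ` pverts G = {0..<l} <+> R" unfolding V image_Un imS imR Plus_def ..
  qed
  have E: "parcs G = {(s, t) \<in> S \<times> S. s \<noteq> t} \<union> F \<union> S \<times> R \<union> R \<times> S"
  proof
    have "parcs G \<subseteq> (S \<union> R) \<times> (S \<union> R)"
      using pair_wf_digraph.in_arcsD1[OF G(1)] pair_wf_digraph.in_arcsD2[OF G(1)] V by auto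
    then show "parcs G \<subseteq> {(s, t) \<in> S \<times> S. s \<noteq> t} \<union> F \<union> S \<times> R \<union> R \<times> S"
      using G(3) by (auto simp: F_def irrefl_def)
    have SR: "S \<times> R \<subseteq> parcs G" using full by (auto simp: R_def)
    then have "R \<times> S \<subseteq> parcs G" using G(2) by (auto dest: symD)
    then show "{(s, t) \<in> S \<times> S. s \<noteq> t} \<union> F \<union> S \<times> R \<union> R \<times> S \<subseteq> parcs G"
      using SR full S(2) by (auto simp: F_def)
  qed
  have 1: "map_prod h h ` {(s, t) \<in> S \<times> S. s \<noteq> t} = map_prod Inl Inl ` {(u, v). u < l \<and> v < l \<and> u \<noteq> v}"
  proof -
    have "map_prod h h ` {(s, t) \<in> S \<times> S. s \<noteq> t} = map_prod Inl Inl ` map_prod g g ` {(s, t) \<in> S \<times> S. s \<noteq> t}"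
      unfolding image_image by (rule image_cong) (auto simp: hS)
    also have "map_prod g g ` {(s, t) \<in> S \<times> S. s \<noteq> t} = {(u, v). u < l \<and> v < l \<and> u \<noteq> v}"
    proof
      show "map_prod g g ` {(s, t) \<in> S \<times> S. s \<noteq> t} \<subseteq> {(u, v). u < l \<and> v < l \<and> u \<noteq> v}"
        using gl ginj by (auto simp: inj_on_def)
      show "{(u, v). u < l \<and> v < l \<and> u \<noteq> v} \<subseteq> map_prod g g ` {(s, t) \<in> S \<times> S. s \<noteq> t}"
      proof clarify
        fix u v assume uv: "u < l" "v < l" "u \<noteq> v"
        then have "u \<in> g ` S" "v \<in> g ` S" unfolding gl by auto
        then obtain s t where "s \<in> S" "u = g s" "t \<in> S" "v = g t" by blast
        then show "(u, v) \<in> map_prod g g ` {(s, t) \<in> S \<times> S. s \<noteq> t}"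
          using uv by (intro image_eqI[of _ _ "(s, t)"]) auto
      qed
    qed
    finally show ?thesis .
  qed
  have 2: "map_prod h h ` F = map_prod Inr Inr ` F"
    by (rule image_cong) (auto simp: F_def hR)
  have 3: "map_prod h h ` (S \<times> R) = Inl ` {0..<l} \<times> Inr ` R"
    and 4: "map_prod h h ` (R \<times> S) = Inr ` R \<times> Inl ` {0..<l}"
    by (simp_all add: map_prod_surj_on[OF imS imR] map_prod_surj_on[OF imR imS])
  have "parcs (join (complete_graph l) \<lparr>pverts = R, parcs = F\<rparr>) = map_prod h h ` parcs G"
    unfolding E image_Un 1 2 3 4 by (simp add: join_def complete_graph_def)
  moreover have "pverts (join (complete_graph l) \<lparr>pverts = R, parcs = F\<rparr>) = {0..<l} <+> R"
    by (simp add: join_def complete_graph_def)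
  ultimately have "digraph_iso (with_proj G) (with_proj (join (complete_graph l) \<lparr>pverts = R, parcs = F\<rparr>))"
    unfolding digraph_iso_pair_iff[OF G(1)] using bij by (intro exI[of _ h]) simp
  then show ?thesis by (simp add: R_def F_def)
qed

lemma pair_graph_of_rel:
  assumes "finite V" "E \<subseteq> V \<times> V" "sym E" "irrefl E"
  shows "pair_graph \<lparr>pverts = V, parcs = E\<rparr>"
proof -
  have "finite E" using assms finite_subset by blast
  then show ?thesis
    using assms by unfold_locales (auto simp: irrefl_def symmetric_def)
qed

lemma pair_graph_rel:
  assumes "pair_graph G"
  shows "parcs G \<subseteq> pverts G \<times> pverts G" "sym (parcs G)" "irrefl (parcs G)" "pair_wf_digraph G"
proof -
  interpret pair_graph G by fact
  show "parcs G \<subseteq> pverts G \<times> pverts G" by (auto dest: in_arcsD1 in_arcsD2)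
  show "sym (parcs G)" using pair_sym_arcs by (simp add: symmetric_def)
  show "irrefl (parcs G)" using no_loops' by (auto simp: irrefl_def)
  show "pair_wf_digraph G" by (rule pair_wf_digraph_axioms)
qed

theorem theorem1p7:
  fixes m l \<delta> :: nat and T :: "'a pair_pre_digraph"
  assumes "T \<in> tree_class m (l + 1) \<delta>"
    and "embeddable T (join (edgeless_graph l) (disjoint_copies m (star \<delta>)))"
  shows "\<exists>N. \<forall>n > N.
    (\<forall>G \<in> SPEX n T. \<exists>H\<^sub>2 :: nat pair_pre_digraph.
        pair_graph H\<^sub>2 \<and> card (pverts H\<^sub>2) = n - l \<and>
        digraph_iso (with_proj G) (with_proj (join (complete_graph l) H\<^sub>2)) \<and>
        max_degree H\<^sub>2 \<le> \<delta> - 1 \<and>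
        card {v \<in> pverts H\<^sub>2. out_degree (with_proj H\<^sub>2) v = \<delta> - 1} \<le> (m - 1) * ((\<delta> - 1)\<^sup>2 + 1)) \<and>
    f_spex l (real \<delta> - 2) n \<le> spex n T \<and>
    spex n T \<le> f_spex l (real \<delta> - 2) n + 2 * (real m - 1) * ((real \<delta> - 1)\<^sup>2 + 1) / real n"
proof -
  obtain A B where tp: "tree_parts (parcs T) A B l m \<delta>" and AB: "A \<union> B = pverts T"
    and l: "1 \<le> l" and d: "2 \<le> \<delta>"
    and template: "copy_in (A \<union> B) (parcs T) (pverts (join_stars l m \<delta>)) (parcs (join_stars l m \<delta>))"
    using tree_class_parts[OF assms] .
  interpret tree_parts "parcs T" A B l m \<delta> by (rule tp)
  have wfT: "pair_wf_digraph T"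
    using assms(1) pair_graph_rel(4) by (auto simp: tree_class_def undirected_tree_def)
  define k where "k = \<delta> - 2"
  define C where "C = (m - 1) * ((\<delta> - 1)\<^sup>2 + 1)"
  have k: "real \<delta> - 2 = real k" "k + 1 = \<delta> - 1" using d by (simp_all add: k_def of_nat_diff)
  have k2: "\<delta> - Suc 0 = Suc k" using k(2) by simp
  have "real (m - 1) = real m - 1" "real (\<delta> - 1) = real \<delta> - 1"
    using m_pos d by (simp_all add: of_nat_diff)
  then have "real C = (real m - 1) * ((real \<delta> - 1)\<^sup>2 + 1)"
    unfolding C_def of_nat_mult of_nat_add of_nat_power of_nat_1 by simp
  then have C: "2 * (real m - 1) * ((real \<delta> - 1)\<^sup>2 + 1) = 2 * real C" by (simp only: mult.assoc)
  obtain N where N: "\<And>(V :: nat set) E x \<mu>. extremal (parcs T) A B l m \<delta> V E x \<mu> \<Longrightarrow> N < card V \<Longrightarrow>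
    \<exists>S\<subseteq>V. card S = l \<and> (\<forall>s\<in>S. \<forall>v\<in>V. v \<noteq> s \<longrightarrow> (s, v) \<in> E) \<and>
      (\<forall>v\<in>V - S. card (E `` {v} \<inter> (V - S)) \<le> \<delta> - 1) \<and>
      card {v \<in> V - S. card (E `` {v} \<inter> (V - S)) = \<delta> - 1} \<le> C"
    using eventually_join_structure[where P = "parcs T" and A = A and B = B and l = l and m = m and d = \<delta>]
    unfolding C_def by blast
  show ?thesis
  proof (intro exI[of _ "N + 4 * l + (l + 4 * (k + l + 1)\<^sup>2) + k + 2"] allI impI)
    fix n assume n: "N + 4 * l + (l + 4 * (k + l + 1)\<^sup>2) + k + 2 < n"
    let ?V = "{0..<n}"
    have n_bounds: "N < n" "4 * l \<le> n" "l + 4 * (k + l + 1)\<^sup>2 \<le> n" "k + 2 \<le> n - l" "l < n" "0 < n"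
      using n l by simp_all
    have free_iff: "G \<in> free_graphs n T \<longleftrightarrow>
        pair_graph G \<and> pverts G = ?V \<and> \<not> copy_in (A \<union> B) (parcs T) ?V (parcs G)" for G
    proof (cases "pair_graph G \<and> pverts G = ?V")
      case True
      then have "embeddable T G \<longleftrightarrow> copy_in (A \<union> B) (parcs T) ?V (parcs G)"
        using embeddable_iff_copy_in[OF wfT pair_graph_rel(4)[of G]] AB by metis
      then show ?thesis using True by (simp add: free_graphs_def)
    qed (auto simp: free_graphs_def)
    \<comment> \<open>Serves twice: for the lower bound via the comparison graph, and as the
      maximality assumption of \<open>extremal\<close>.\<close>
    have le_spex: "arc_form E y y \<le> spex n T * (\<Sum>v\<in>?V. (y v)\<^sup>2)"
      if E: "E \<subseteq> ?V \<times> ?V" "sym E" "irrefl E" "\<not> copy_in (A \<union> B) (parcs T) ?V E" for E y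
    proof -
      let ?G = "\<lparr>pverts = ?V, parcs = E\<rparr>"
      have "?G \<in> free_graphs n T" using E pair_graph_of_rel[of ?V E] by (simp add: free_iff)
      then have "largest_eigenvalue ?G \<le> spex n T"
        unfolding spex_def by (intro Max_ge finite_imageI finite_free_graphs imageI)
      then have "largest_eigenvalue ?G * (\<Sum>v\<in>?V. (y v)\<^sup>2) \<le> spex n T * (\<Sum>v\<in>?V. (y v)\<^sup>2)"
        by (intro mult_right_mono sum_nonneg) auto
      moreover have "arc_form E y y \<le> largest_eigenvalue ?G * (\<Sum>v\<in>?V. (y v)\<^sup>2)"
        using largest_eigenvalue_rayleigh(1)[of ?G n y] E n_bounds(6) by simp
      ultimately show ?thesis by linarith
    qed
    \<comment> \<open>At most one vertex has degree \<open>k + 1 = \<delta> - 1\<close>, exactly the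
      exception that \<open>not_copy_in_join_clique\<close> allows.\<close>
    obtain H where H: "H \<subseteq> {0..<n - l} \<times> {0..<n - l}" "sym H" "irrefl H"
      "\<And>v. v < n - l \<Longrightarrow> k \<le> card (H `` {v}) \<and> card (H `` {v}) \<le> k + 1"
      "\<And>u v. u < n - l \<Longrightarrow> v < n - l \<Longrightarrow> card (H `` {u}) = k + 1 \<Longrightarrow> card (H `` {v}) = k + 1 \<Longrightarrow> u = v"
      by (rule almost_regular_exists[OF n_bounds(4)]) (rule that; blast)
    have ln: "l \<le> n" using n_bounds by simp
    note Jprops = join_clique_props[OF ln H(1-3)]
    have Jfree: "\<not> copy_in (A \<union> B) (parcs T) ?V (join_clique l n H)"
      using H(4,5) d by (intro not_copy_in_join_clique[OF ln H(1-3)]) (auto simp: k2)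
    have lower: "f_spex l (real k) n \<le> spex n T"
      using H(4) le_spex[OF Jprops(1-3) Jfree]
      by (intro join_clique_eigenvalue_ge[OF l n_bounds(5) H(1-3)]) auto
    have nonempty: "free_graphs n T \<noteq> {}"
    proof -
      have "\<lparr>pverts = ?V, parcs = join_clique l n H\<rparr> \<in> free_graphs n T"
        using Jprops(1-3) Jfree pair_graph_of_rel[of ?V "join_clique l n H"] by (simp add: free_iff)
      then show ?thesis by blast
    qed
    have main: "(\<exists>H\<^sub>2 :: nat pair_pre_digraph.
        pair_graph H\<^sub>2 \<and> card (pverts H\<^sub>2) = n - l \<and>
        digraph_iso (with_proj G) (with_proj (join (complete_graph l) H\<^sub>2)) \<and>
        max_degree H\<^sub>2 \<le> \<delta> - 1 \<and>
        card {v \<in> pverts H\<^sub>2. out_degree (with_proj H\<^sub>2) v = \<delta> - 1} \<le> C) \<and>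
        spex n T \<le> f_spex l (real k) n + 2 * real C / n" if G: "G \<in> SPEX n T" for G
    proof -
      define E where "E = parcs G"
      define \<mu> where "\<mu> = spex n T"
      have G1: "pair_graph G" "pverts G = ?V" "\<not> copy_in (A \<union> B) (parcs T) ?V E"
        and mu: "largest_eigenvalue G = \<mu>"
        using G free_iff by (auto simp: SPEX_def E_def \<mu>_def)
      note Eprops = pair_graph_rel[OF G1(1), unfolded G1(2), folded E_def]
      obtain x where x: "\<And>v. 0 \<le> x v \<and> x v \<le> 1" "\<exists>u<n. x u = 1"
        "\<And>v. v < n \<Longrightarrow> (\<Sum>w\<in>E `` {v}. x w) = \<mu> * x v"
        using largest_eigenvalue_rayleigh(2)[of G n] G1(2) Eprops n_bounds(6)
        unfolding E_def[symmetric] mu by blast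
      have fmu: "f_spex l (real k) n \<le> \<mu>" using lower by (simp add: \<mu>_def)
      have r: "sqrt (real l * (real n - l)) \<le> \<mu>"
        using f_spex_quadratic(4)[OF l, of "real k" n] fmu ln by simp
      have r0: "0 \<le> real l * (real n - l)" using ln by simp
      have mu0: "0 \<le> \<mu>" using order_trans[OF real_sqrt_ge_zero[OF r0] r] .
      have "card (E \<inter> X \<times> Y) \<le> m * card X + l * card Y" if "X \<subseteq> ?V" "Y \<subseteq> ?V" "X \<inter> Y = {}" for X Y
        using card_arcs_Times_le[OF Eprops(2) G1(3) _ _ that] that finite_subset by blast
      moreover have "real l * (real n - l) \<le> \<mu>\<^sup>2" using r by (rule sqrt_le_D)
      ultimately have "perron ?V E x \<mu> l m"
        using Eprops x mu0 l m_pos G1(3) card_arcs_le[OF finite_atLeastLessThan Eprops(2) G1(3)]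
          card_common_nbrs_less[OF Eprops(3,2) G1(3) finite_atLeastLessThan]
        by unfold_locales auto
      then interpret perron ?V E x \<mu> l m .
      have "extremal (parcs T) A B l m \<delta> ?V E x \<mu>"
        using G1(3) le_spex template d by unfold_locales (auto simp: \<mu>_def)
      from N[OF this] n_bounds(1) obtain S where S: "S \<subseteq> ?V" "card S = l"
        "\<And>s v. s \<in> S \<Longrightarrow> v \<in> ?V \<Longrightarrow> v \<noteq> s \<Longrightarrow> (s, v) \<in> E"
        "\<And>v. v \<in> ?V - S \<Longrightarrow> card (E `` {v} \<inter> (?V - S)) \<le> \<delta> - 1"
        "card {v \<in> ?V - S. card (E `` {v} \<inter> (?V - S)) = \<delta> - 1} \<le> C" by auto
      have fS: "finite S" using S(1) finite_subset by blast
      define R where "R = ?V - S"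
      define H\<^sub>2 where "H\<^sub>2 = \<lparr>pverts = R, parcs = E \<inter> R \<times> R\<rparr>"
      have cR: "card R = n - l" using S(1,2) fS by (simp add: R_def card_Diff_subset)
      then have neR: "R \<noteq> {}" using n_bounds(5) by auto
      have deg: "out_degree (with_proj H\<^sub>2) v = card (E `` {v} \<inter> R)" if "v \<in> R" for v
      proof -
        have "parcs H\<^sub>2 `` {v} = E `` {v} \<inter> R" using that by (auto simp: H\<^sub>2_def)
        then show ?thesis by (simp add: out_degree_eq_card_nbrs)
      qed
      have "pair_graph H\<^sub>2"
        unfolding H\<^sub>2_def using Eprops(2,3)
        by (intro pair_graph_of_rel) (auto simp: R_def sym_def irrefl_def)
      moreover have "card (pverts H\<^sub>2) = n - l" by (simp add: H\<^sub>2_def cR)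
      moreover have "digraph_iso (with_proj G) (with_proj (join (complete_graph l) H\<^sub>2))"
        unfolding H\<^sub>2_def R_def E_def G1(2)[symmetric]
        by (rule digraph_iso_join_complete_graph)
          (use G1(2) Eprops fS S in \<open>auto simp: E_def[symmetric]\<close>)
      moreover have "max_degree H\<^sub>2 \<le> \<delta> - 1"
      proof -
        have "Max (out_degree (with_proj H\<^sub>2) ` R) \<le> \<delta> - 1"
          using neR S(4) deg by (subst Max_le_iff) (auto simp: R_def)
        then show ?thesis by (simp add: max_degree_def H\<^sub>2_def)
      qed
      moreover have "card {v \<in> pverts H\<^sub>2. out_degree (with_proj H\<^sub>2) v = \<delta> - 1} \<le> C"
      proof -
        have "{v \<in> pverts H\<^sub>2. out_degree (with_proj H\<^sub>2) v = \<delta> - 1} = {v \<in> R. card (E `` {v} \<inter> R) = \<delta> - 1}"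
          using deg by (auto simp: H\<^sub>2_def)
        then show ?thesis using S(5) by (simp add: R_def)
      qed
      moreover have "\<mu> \<le> f_spex l (real k) n + 2 * real C / n"
      proof (rule quadratic_inequality_bound[OF l n_bounds(2,3) fmu])
        have "real (l + 4 * (k + l + 1)\<^sup>2) \<le> real n" using n_bounds(3) by (simp only: of_nat_le_iff)
        then have "(2 * (real k + l + 1))\<^sup>2 \<le> 1 * (real n - l)"
          by (subst power_mult_distrib) (simp add: add_ac)
        also have "\<dots> \<le> real l * (real n - l)" using l ln by (intro mult_right_mono) auto
        finally have "2 * (real k + l + 1) \<le> sqrt (real l * (real n - l))" by (rule real_le_rsqrt)
        moreover have "0 \<le> real k" "0 \<le> real l" by simp_all
        ultimately have muk: "real k + 1 < \<mu>" using r by argo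
        have "(\<mu> - k) * (\<mu> - real l + 1) \<le> real l * (real (card ?V) - l) + real C * l / (\<mu> - k - 1)"
        proof (rule join_eigenvalue_le[OF finite_atLeastLessThan Eprops(1-3) _ _ _ S(1,2) l])
          show "\<exists>u\<in>?V. x u \<noteq> 0" using x(2) by force
          show "card (E `` {v} \<inter> (?V - S)) \<le> k + 1" if "v \<in> ?V - S" for v
            using S(4)[OF that] by (simp add: k2)
          show "card {v \<in> ?V - S. card (E `` {v} \<inter> (?V - S)) = k + 1} \<le> C"
            using S(5) by (simp only: k(2))
        qed (use x S(3) muk n_bounds(5) in auto)
        then show "(\<mu> - k) * (\<mu> - real l + 1) \<le> real l * (real n - l) + real C * l / (\<mu> - k - 1)" by simp
      qed
      ultimately show ?thesis by (auto simp: \<mu>_def)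
    qed
    \<comment> \<open>The comparison graph makes the set of tree-free graphs non-empty, so the
      maximum is attained; an extremal graph is what carries the upper bound over to
      \<open>spex n T\<close>.\<close>
    have "spex n T \<in> largest_eigenvalue ` free_graphs n T"
      unfolding spex_def using nonempty finite_free_graphs by (intro Max_in) auto
    then obtain G where "G \<in> SPEX n T" by (auto simp: SPEX_def)
    with main have upper: "spex n T \<le> f_spex l (real k) n + 2 * real C / n" by blast
    show "(\<forall>G \<in> SPEX n T. \<exists>H\<^sub>2 :: nat pair_pre_digraph.
        pair_graph H\<^sub>2 \<and> card (pverts H\<^sub>2) = n - l \<and>
        digraph_iso (with_proj G) (with_proj (join (complete_graph l) H\<^sub>2)) \<and>
        max_degree H\<^sub>2 \<le> \<delta> - 1 \<and>
        card {v \<in> pverts H\<^sub>2. out_degree (with_proj H\<^sub>2) v = \<delta> - 1} \<le> (m - 1) * ((\<delta> - 1)\<^sup>2 + 1)) \<and>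
      f_spex l (real \<delta> - 2) n \<le> spex n T \<and>
      spex n T \<le> f_spex l (real \<delta> - 2) n + 2 * (real m - 1) * ((real \<delta> - 1)\<^sup>2 + 1) / real n"
      unfolding k(1) C C_def[symmetric] using main lower upper by blast
  qed
qed

end
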